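(* Let $(\mathcal{L},[.,.],\alpha)$ be a multiplicative Hom-Leibniz algebra over $\mathbb{K}$ such that $\mathbb{H}=H^2(\mathcal{L},\mathcal{L})$ is finite-dimensional, and let $\eta_1$ be its infinitesimal deformation with base $C_1=\mathbb{K}\oplus\mathbb{H}'$ described in the context. For any infinitesimal deformation $\lambda$ of $(\mathcal{L},[.,.],\alpha)$ with a finite-dimensional base $A$, there exists a unique algebra homomorphism $\phi=\mathrm{id}+a_\lambda:C_1=\mathbb{K}\oplus\mathbb{H}'\to A$ (the identity on scalars, and a linear map $a_\lambda$ from $\mathbb{H}'$ to the augmentation ideal of $A$) such that $\lambda$ is equivalent to the push-out $\phi_\ast\eta_1$.
   Context: $\mathbb{K}$ is an algebraically closed field of characteristic $0$. A (multiplicative) Hom-Leibniz algebra $(\mathcal{L},[.,.],\alpha)$ is a $\mathbb{K}$-vector space with a bilinear bracket and a linear map $\alpha:\mathcal{L}\to\mathcal{L}$ such that $[\alpha(x),[y,z]]=[[x,y],\alpha(z)]-[[x,z],\alpha(y)]$ and $\alpha([x,y])=[\alpha(x),\alpha(y)]$. A morphism is a linear map preserving brackets and commuting with the twisting maps. $\mathcal{C}^n(\mathcal{L},\mathcal{L})$ is the space of $n$-linear maps $\varphi:\mathcal{L}^n\to\mathcal{L}$ with $\alpha\circ\varphi=\varphi\circ(\alpha,\dots,\alpha)$; $\delta^1 f(x,y)=[x,f(y)]+[f(x),y]-f([x,y])$ and $\delta^2\varphi(x,y,z)=[\alpha(x),\varphi(y,z)]+[\varphi(x,z),\alpha(y)]-[\varphi(x,y),\alpha(z)]-\varphi([x,y],\alpha(z))+\varphi([x,z],\alpha(y))+\varphi(\alpha(x),[y,z])$;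 $H^2(\mathcal{L},\mathcal{L})=\ker\delta^2/\mathrm{im}\,\delta^1$. Deformations: for a commutative unital $\mathbb{K}$-algebra $A$ with augmentation $\varepsilon:A\to\mathbb{K}$ (unital algebra homomorphism), $\mathfrak m=\ker\varepsilon$, a deformation $\lambda$ of $\mathcal{L}$ with base $A$ is an $A$-bilinear bracket $[.,.]_\lambda$ on $A\otimes\mathcal{L}$ making $(A\otimes\mathcal{L},[.,.]_\lambda,\mathrm{id}\otimes\alpha)$ a (multiplicative) Hom-Leibniz algebra and such that $\varepsilon\otimes\mathrm{id}:A\otimes\mathcal{L}\to\mathcal{L}$ is a Hom-Leibniz morphism. It is infinitesimal if $\mathfrak m^2=0$. Two deformations $\lambda_1,\lambda_2$ with base $A$ are equivalent if there is an $A$-linear isomorphism of Hom-Leibniz algebras $(A\otimes\mathcal{L},[.,.]_{\lambda_1},\mathrm{id}\otimes\alpha)\to(A\otimes\mathcal{L},[.,.]_{\lambda_2},\mathrm{id}\otimes\alpha)$ whose composition with $\varepsilon\otimes\mathrm{id}$ is $\varepsilon\otimes\mathrm{id}$. If $\phi:A\to A'$ is a unital algebra homomorphism with $\varepsilon'\circ\phi=\varepsilon$, the push-out $\phi_\ast\lambda$ is the deformation with base $A'$ such that, if $[1\otimes l_1,1\otimes l_2]_\lambda=1\otimes[l_1,l_2]+\sum_jc_j\otimes y_j$ with $c_j\in\mathfrak m$, $y_j\in\mathcal{L}$, then $[1\otimes l_1,1\otimes l_2]_{\phi_\ast\lambda}=1\otimes[l_1,l_2]+\sum_j\phi(c_j)\otimes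 y_j$. Construction of $\eta_1$: $\mathbb{H}'$ is the dual of $\mathbb{H}$, and $C_1=\mathbb{K}\oplus\mathbb{H}'$ has product $(k_1,h_1)(k_2,h_2)=(k_1k_2,k_1h_2+k_2h_1)$ and augmentation the projection to $\mathbb{K}$. Fix a linear map $\mu:\mathbb{H}\to\mathcal{C}^2(\mathcal{L},\mathcal{L})$ sending each class to a cocycle representing it, a basis $\{h_i\}_{1\le i\le r}$ of $\mathbb{H}$ with dual basis $\{g_i\}$, and put $\mu_i=\mu(h_i)$. Then $\eta_1$ is given by $[1\otimes l_1,1\otimes l_2]_{\eta_1}=1\otimes[l_1,l_2]+\sum_{i=1}^r g_i\otimes\mu_i(l_1,l_2)$. *)

theory Defs
  imports
    "HOL-Algebra.Algebraic_Closure"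
    "Jordan_Normal_Form.Missing_VectorSpace"
begin

section \<open>Linear algebra over a field, with explicit carriers\<close>

text \<open>
  Vector spaces over \<open>K\<close> are modules in the sense of \<^locale>\<open>vectorspace\<close>, and \<open>K\<close>-algebras are
  those of \<^locale>\<open>algebra\<close>. Maps matter only on carriers. Records built below for plain vector
  spaces fill the unused ring fields \<open>mult\<close> and \<open>one\<close> with zeros, as the library does.
\<close>

definition char_zero :: "('k, 'm) ring_scheme \<Rightarrow> bool" where
  "char_zero K \<longleftrightarrow> (\<forall>n::nat. 0 < n \<longrightarrow> [n] \<cdot>\<^bsub>K\<^esub> \<one>\<^bsub>K\<^esub> \<noteq> \<zero>\<^bsub>K\<^esub>)"

definition bilinear_map ::
  "('k, 'm) ring_scheme \<Rightarrow> ('k, 'u, 'm1) module_scheme \<Rightarrow> ('k, 'v, 'm2) module_scheme \<Rightarrow>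
   ('k, 'w, 'm3) module_scheme \<Rightarrow> ('u \<Rightarrow> 'v \<Rightarrow> 'w) \<Rightarrow> bool" where
  "bilinear_map K U V W b \<longleftrightarrow>
     (\<forall>u\<in>carrier U. b u \<in> module_hom K V W) \<and>
     (\<forall>v\<in>carrier V. (\<lambda>u. b u v) \<in> module_hom K U W)"

text \<open>\<open>K\<close> as an algebra over itself.\<close>

definition scalars :: "('k, 'm) ring_scheme \<Rightarrow> ('k, 'k) module" where
  "scalars K = \<lparr>carrier = carrier K, monoid.mult = monoid.mult K, one = \<one>\<^bsub>K\<^esub>, zero = \<zero>\<^bsub>K\<^esub>, add = add K,
                smult = monoid.mult K\<rparr>"

definition fun_space :: "'s set \<Rightarrow> ('k, 'v, 'm) module_scheme \<Rightarrow> ('k, 's \<Rightarrow> 'v) module" where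
  "fun_space S V =
     \<lparr>carrier = S \<rightarrow>\<^sub>E carrier V,
      monoid.mult = (\<lambda>f g. \<lambda>s\<in>S. \<zero>\<^bsub>V\<^esub>),
      one = (\<lambda>s\<in>S. \<zero>\<^bsub>V\<^esub>),
      zero = (\<lambda>s\<in>S. \<zero>\<^bsub>V\<^esub>),
      add = (\<lambda>f g. \<lambda>s\<in>S. f s \<oplus>\<^bsub>V\<^esub> g s),
      smult = (\<lambda>k f. \<lambda>s\<in>S. k \<odot>\<^bsub>V\<^esub> f s)\<rparr>"

definition dual_space ::
  "('k, 'm) ring_scheme \<Rightarrow> ('k, 'v, 'n) module_scheme \<Rightarrow> ('k, 'v \<Rightarrow> 'k) module" where
  "dual_space K V =
     (fun_space (carrier V) (scalars K))
       \<lparr>carrier := {f \<in> carrier V \<rightarrow>\<^sub>E carrier K. f \<in> module_hom K V (scalars K)}\<rparr>"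

text \<open>The quotient \<open>V/W\<close>; its elements are the cosets \<open>W + v\<close>.\<close>

definition quot_space ::
  "('k, 'v, 'm) module_scheme \<Rightarrow> 'v set \<Rightarrow> ('k, 'v set) module" where
  "quot_space V W =
     \<lparr>carrier = a_rcosets\<^bsub>V\<^esub> W,
      monoid.mult = (\<lambda>P Q. W),
      one = W,
      zero = W,
      add = set_add V,
      smult = (\<lambda>k P. \<Union>x\<in>P. W +>\<^bsub>V\<^esub> (k \<odot>\<^bsub>V\<^esub> x))\<rparr>"


section \<open>Tensor products\<close>

text \<open>
  \<open>A \<otimes> L\<close> is the free vector space on \<open>A \<times> L\<close> (finitely supported functions) modulo the span of
  the bilinearity relations.
\<close>

definition free_space ::
  "('k, 'm) ring_scheme \<Rightarrow> 's set \<Rightarrow> ('k, 's \<Rightarrow> 'k) module" where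
  "free_space K S =
     (fun_space S (scalars K))
       \<lparr>carrier := {f \<in> S \<rightarrow>\<^sub>E carrier K. finite {s \<in> S. f s \<noteq> \<zero>\<^bsub>K\<^esub>}}\<rparr>"

definition free_gen :: "('k, 'm) ring_scheme \<Rightarrow> 's set \<Rightarrow> 's \<Rightarrow> 's \<Rightarrow> 'k" where
  "free_gen K S s = (\<lambda>t\<in>S. if t = s then \<one>\<^bsub>K\<^esub> else \<zero>\<^bsub>K\<^esub>)"

definition tensor_rels ::
  "('k, 'm) ring_scheme \<Rightarrow> ('k, 'a, 'n) module_scheme \<Rightarrow> ('k, 'l, 'p) module_scheme \<Rightarrow>
   ('a \<times> 'l \<Rightarrow> 'k) set" where
  "tensor_rels K A L =
     (let S = carrier A \<times> carrier L; F = free_space K S; e = (\<lambda>a l. free_gen K S (a, l)) in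
        {e (a \<oplus>\<^bsub>A\<^esub> b) l \<ominus>\<^bsub>F\<^esub> (e a l \<oplus>\<^bsub>F\<^esub> e b l) | a b l.
           a \<in> carrier A \<and> b \<in> carrier A \<and> l \<in> carrier L} \<union>
        {e a (l \<oplus>\<^bsub>L\<^esub> m) \<ominus>\<^bsub>F\<^esub> (e a l \<oplus>\<^bsub>F\<^esub> e a m) | a l m.
           a \<in> carrier A \<and> l \<in> carrier L \<and> m \<in> carrier L} \<union>
        {e (k \<odot>\<^bsub>A\<^esub> a) l \<ominus>\<^bsub>F\<^esub> (k \<odot>\<^bsub>F\<^esub> e a l) | k a l.
           k \<in> carrier K \<and> a \<in> carrier A \<and> l \<in> carrier L} \<union>
        {e a (k \<odot>\<^bsub>L\<^esub> l) \<ominus>\<^bsub>F\<^esub> (k \<odot>\<^bsub>F\<^esub> e a l) | k a l.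
           k \<in> carrier K \<and> a \<in> carrier A \<and> l \<in> carrier L})"

definition tensor_null ::
  "('k, 'm) ring_scheme \<Rightarrow> ('k, 'a, 'n) module_scheme \<Rightarrow> ('k, 'l, 'p) module_scheme \<Rightarrow>
   ('a \<times> 'l \<Rightarrow> 'k) set" where
  "tensor_null K A L =
     module.span K (free_space K (carrier A \<times> carrier L)) (tensor_rels K A L)"

definition tensor ::
  "('k, 'm) ring_scheme \<Rightarrow> ('k, 'a, 'n) module_scheme \<Rightarrow> ('k, 'l, 'p) module_scheme \<Rightarrow>
   ('k, ('a \<times> 'l \<Rightarrow> 'k) set) module" where
  "tensor K A L = quot_space (free_space K (carrier A \<times> carrier L)) (tensor_null K A L)"

definition tens ::
  "('k, 'm) ring_scheme \<Rightarrow> ('k, 'a, 'n) module_scheme \<Rightarrow> ('k, 'l, 'p) module_scheme \<Rightarrow>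
   'a \<Rightarrow> 'l \<Rightarrow> ('a \<times> 'l \<Rightarrow> 'k) set" where
  "tens K A L a l =
     tensor_null K A L +>\<^bsub>free_space K (carrier A \<times> carrier L)\<^esub>
       free_gen K (carrier A \<times> carrier L) (a, l)"

text \<open>
  For bilinear \<open>g : A \<times> L \<rightarrow> M\<close>, this is the linear map \<open>A \<otimes> L \<rightarrow> M\<close> with \<open>a \<otimes> l \<mapsto> g a l\<close>: all
  representatives of a class have the same image under the linear extension of \<open>g\<close> to the free
  space, and \<^const>\<open>the_elem\<close> picks that common value.
\<close>

definition tensor_lift ::
  "('k, 'm) ring_scheme \<Rightarrow> ('k, 'a, 'n) module_scheme \<Rightarrow> ('k, 'l, 'p) module_scheme \<Rightarrow>
   ('k, 'w, 'q) module_scheme \<Rightarrow> ('a \<Rightarrow> 'l \<Rightarrow> 'w) \<Rightarrow> ('a \<times> 'l \<Rightarrow> 'k) set \<Rightarrow> 'w" where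
  "tensor_lift K A L M g t =
     the_elem ((\<lambda>f. \<Oplus>\<^bsub>M\<^esub>p\<in>{p \<in> carrier A \<times> carrier L. f p \<noteq> \<zero>\<^bsub>K\<^esub>}.
                       f p \<odot>\<^bsub>M\<^esub> g (fst p) (snd p)) ` t)"

text \<open>\<open>A \<otimes> L\<close> as an \<open>A\<close>-module: \<open>a (b \<otimes> l) = ab \<otimes> l\<close>.\<close>

definition tensor_mod ::
  "('k, 'm) ring_scheme \<Rightarrow> ('k, 'a, 'n) module_scheme \<Rightarrow> ('k, 'l, 'p) module_scheme \<Rightarrow>
   ('a, ('a \<times> 'l \<Rightarrow> 'k) set) module" where
  "tensor_mod K A L =
     \<lparr>carrier = carrier (tensor K A L),
      monoid.mult = monoid.mult (tensor K A L),
      one = one (tensor K A L),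
      zero = zero (tensor K A L),
      add = add (tensor K A L),
      smult = (\<lambda>a. tensor_lift K A L (tensor K A L) (\<lambda>b l. tens K A L (a \<otimes>\<^bsub>A\<^esub> b) l))\<rparr>"

definition id_tensor ::
  "('k, 'm) ring_scheme \<Rightarrow> ('k, 'a, 'n) module_scheme \<Rightarrow> ('k, 'l, 'p) module_scheme \<Rightarrow>
   ('l \<Rightarrow> 'l) \<Rightarrow> ('a \<times> 'l \<Rightarrow> 'k) set \<Rightarrow> ('a \<times> 'l \<Rightarrow> 'k) set" where
  "id_tensor K A L \<alpha> = tensor_lift K A L (tensor K A L) (\<lambda>a l. tens K A L a (\<alpha> l))"

text \<open>\<open>\<epsilon> \<otimes> id\<close>, with \<open>K \<otimes> L\<close> identified with \<open>L\<close>.\<close>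

definition aug_tensor ::
  "('k, 'm) ring_scheme \<Rightarrow> ('k, 'a, 'n) module_scheme \<Rightarrow> ('k, 'l, 'p) module_scheme \<Rightarrow>
   ('a \<Rightarrow> 'k) \<Rightarrow> ('a \<times> 'l \<Rightarrow> 'k) set \<Rightarrow> 'l" where
  "aug_tensor K A L \<epsilon> = tensor_lift K A L L (\<lambda>a l. \<epsilon> a \<odot>\<^bsub>L\<^esub> l)"

text \<open>
  The \<open>A\<close>-bilinear operation on \<open>A \<otimes> L\<close> determined by a \<open>K\<close>-bilinear \<open>F : L \<times> L \<rightarrow> A \<otimes> L\<close> through
  \<open>(a \<otimes> x, b \<otimes> y) \<mapsto> ab F(x, y)\<close>.
\<close>

definition bilinear_ext ::
  "('k, 'm) ring_scheme \<Rightarrow> ('k, 'a, 'n) module_scheme \<Rightarrow> ('k, 'l, 'p) module_scheme \<Rightarrow>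
   ('l \<Rightarrow> 'l \<Rightarrow> ('a \<times> 'l \<Rightarrow> 'k) set) \<Rightarrow>
   ('a \<times> 'l \<Rightarrow> 'k) set \<Rightarrow> ('a \<times> 'l \<Rightarrow> 'k) set \<Rightarrow> ('a \<times> 'l \<Rightarrow> 'k) set" where
  "bilinear_ext K A L F s t =
     tensor_lift K A L (tensor K A L)
       (\<lambda>a x. tensor_lift K A L (tensor K A L)
          (\<lambda>b y. (a \<otimes>\<^bsub>A\<^esub> b) \<odot>\<^bsub>tensor_mod K A L\<^esub> F x y) t) s"


section \<open>Hom-Leibniz algebras\<close>

locale hom_leibniz_algebra = vectorspace K L
  for K :: "('k, 'm) ring_scheme" (structure) and L :: "('k, 'l, 'p) module_scheme" (structure) +
  fixes br :: "'l \<Rightarrow> 'l \<Rightarrow> 'l" and \<alpha> :: "'l \<Rightarrow> 'l"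
  assumes br_bilinear: "bilinear_map K L L L br"
    and alpha_linear: "\<alpha> \<in> module_hom K L L"
    and hom_leibniz: "\<lbrakk>x \<in> carrier L; y \<in> carrier L; z \<in> carrier L\<rbrakk> \<Longrightarrow>
          br (\<alpha> x) (br y z) = br (br x y) (\<alpha> z) \<ominus>\<^bsub>L\<^esub> br (br x z) (\<alpha> y)"
    and alpha_mult: "\<lbrakk>x \<in> carrier L; y \<in> carrier L\<rbrakk> \<Longrightarrow> \<alpha> (br x y) = br (\<alpha> x) (\<alpha> y)"

definition hom_leibniz_morphisms ::
  "('k, 'm) ring_scheme \<Rightarrow>
   ('k, 'u, 'p) module_scheme \<Rightarrow> ('u \<Rightarrow> 'u \<Rightarrow> 'u) \<Rightarrow> ('u \<Rightarrow> 'u) \<Rightarrow>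
   ('k, 'v, 'q) module_scheme \<Rightarrow> ('v \<Rightarrow> 'v \<Rightarrow> 'v) \<Rightarrow> ('v \<Rightarrow> 'v) \<Rightarrow> ('u \<Rightarrow> 'v) set" where
  "hom_leibniz_morphisms K U br \<alpha> V br' \<alpha>' =
     {f \<in> module_hom K U V.
        (\<forall>x\<in>carrier U. \<forall>y\<in>carrier U. f (br x y) = br' (f x) (f y)) \<and>
        (\<forall>x\<in>carrier U. f (\<alpha> x) = \<alpha>' (f x))}"


section \<open>The second cohomology space\<close>

definition cochains1 ::
  "('k, 'm) ring_scheme \<Rightarrow> ('k, 'l, 'p) module_scheme \<Rightarrow> ('l \<Rightarrow> 'l) \<Rightarrow> ('k, 'l \<Rightarrow> 'l) module" where
  "cochains1 K L \<alpha> =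
     (fun_space (carrier L) L)
       \<lparr>carrier := {f \<in> carrier L \<rightarrow>\<^sub>E carrier L.
          f \<in> module_hom K L L \<and> (\<forall>x\<in>carrier L. \<alpha> (f x) = f (\<alpha> x))}\<rparr>"

definition cochains2 ::
  "('k, 'm) ring_scheme \<Rightarrow> ('k, 'l, 'p) module_scheme \<Rightarrow> ('l \<Rightarrow> 'l) \<Rightarrow>
   ('k, 'l \<times> 'l \<Rightarrow> 'l) module" where
  "cochains2 K L \<alpha> =
     (fun_space (carrier L \<times> carrier L) L)
       \<lparr>carrier := {\<phi> \<in> carrier L \<times> carrier L \<rightarrow>\<^sub>E carrier L.
          bilinear_map K L L L (\<lambda>x y. \<phi> (x, y)) \<and>
          (\<forall>x\<in>carrier L. \<forall>y\<in>carrier L. \<alpha> (\<phi> (x, y)) = \<phi> (\<alpha> x, \<alpha> y))}\<rparr>"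

definition delta1 ::
  "('k, 'l, 'p) module_scheme \<Rightarrow> ('l \<Rightarrow> 'l \<Rightarrow> 'l) \<Rightarrow> ('l \<Rightarrow> 'l) \<Rightarrow> 'l \<times> 'l \<Rightarrow> 'l" where
  "delta1 L br f =
     (\<lambda>(x, y)\<in>carrier L \<times> carrier L. br x (f y) \<oplus>\<^bsub>L\<^esub> br (f x) y \<ominus>\<^bsub>L\<^esub> f (br x y))"

definition delta2 ::
  "('k, 'l, 'p) module_scheme \<Rightarrow> ('l \<Rightarrow> 'l \<Rightarrow> 'l) \<Rightarrow> ('l \<Rightarrow> 'l) \<Rightarrow> ('l \<times> 'l \<Rightarrow> 'l) \<Rightarrow>
   'l \<times> 'l \<times> 'l \<Rightarrow> 'l" where
  "delta2 L br \<alpha> \<phi> =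
     (\<lambda>(x, y, z)\<in>carrier L \<times> carrier L \<times> carrier L.
        br (\<alpha> x) (\<phi> (y, z)) \<oplus>\<^bsub>L\<^esub> br (\<phi> (x, z)) (\<alpha> y) \<ominus>\<^bsub>L\<^esub> br (\<phi> (x, y)) (\<alpha> z)
        \<ominus>\<^bsub>L\<^esub> \<phi> (br x y, \<alpha> z) \<oplus>\<^bsub>L\<^esub> \<phi> (br x z, \<alpha> y) \<oplus>\<^bsub>L\<^esub> \<phi> (\<alpha> x, br y z))"

definition cocycles2 ::
  "('k, 'm) ring_scheme \<Rightarrow> ('k, 'l, 'p) module_scheme \<Rightarrow> ('l \<Rightarrow> 'l \<Rightarrow> 'l) \<Rightarrow> ('l \<Rightarrow> 'l) \<Rightarrow>
   ('l \<times> 'l \<Rightarrow> 'l) set" where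
  "cocycles2 K L br \<alpha> =
     {\<phi> \<in> carrier (cochains2 K L \<alpha>).
        delta2 L br \<alpha> \<phi> = \<zero>\<^bsub>fun_space (carrier L \<times> carrier L \<times> carrier L) L\<^esub>}"

definition coboundaries2 ::
  "('k, 'm) ring_scheme \<Rightarrow> ('k, 'l, 'p) module_scheme \<Rightarrow> ('l \<Rightarrow> 'l \<Rightarrow> 'l) \<Rightarrow> ('l \<Rightarrow> 'l) \<Rightarrow>
   ('l \<times> 'l \<Rightarrow> 'l) set" where
  "coboundaries2 K L br \<alpha> = delta1 L br ` carrier (cochains1 K L \<alpha>)"

definition cohomology2 ::
  "('k, 'm) ring_scheme \<Rightarrow> ('k, 'l, 'p) module_scheme \<Rightarrow> ('l \<Rightarrow> 'l \<Rightarrow> 'l) \<Rightarrow> ('l \<Rightarrow> 'l) \<Rightarrow>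
   ('k, ('l \<times> 'l \<Rightarrow> 'l) set) module" where
  "cohomology2 K L br \<alpha> =
     quot_space ((cochains2 K L \<alpha>)\<lparr>carrier := cocycles2 K L br \<alpha>\<rparr>) (coboundaries2 K L br \<alpha>)"


section \<open>Deformations with an augmented base\<close>

definition alg_hom ::
  "('k, 'm) ring_scheme \<Rightarrow> ('k, 'a, 'n) module_scheme \<Rightarrow> ('k, 'b, 'p) module_scheme \<Rightarrow>
   ('a \<Rightarrow> 'b) set" where
  "alg_hom K A B = ring_hom A B \<inter> module_hom K A B"

definition augmented_algebra ::
  "('k, 'm) ring_scheme \<Rightarrow> ('k, 'a, 'n) module_scheme \<Rightarrow> ('a \<Rightarrow> 'k) \<Rightarrow> bool" where
  "augmented_algebra K A \<epsilon> \<longleftrightarrow> algebra K A \<and> \<epsilon> \<in> alg_hom K A (scalars K)"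

definition aug_ideal ::
  "('k, 'm) ring_scheme \<Rightarrow> ('k, 'a, 'n) module_scheme \<Rightarrow> ('a \<Rightarrow> 'k) \<Rightarrow> 'a set" where
  "aug_ideal K A \<epsilon> = a_kernel A K \<epsilon>"

definition deformation ::
  "('k, 'm) ring_scheme \<Rightarrow> ('k, 'l, 'p) module_scheme \<Rightarrow> ('l \<Rightarrow> 'l \<Rightarrow> 'l) \<Rightarrow> ('l \<Rightarrow> 'l) \<Rightarrow>
   ('k, 'a, 'n) module_scheme \<Rightarrow> ('a \<Rightarrow> 'k) \<Rightarrow>
   (('a \<times> 'l \<Rightarrow> 'k) set \<Rightarrow> ('a \<times> 'l \<Rightarrow> 'k) set \<Rightarrow> ('a \<times> 'l \<Rightarrow> 'k) set) \<Rightarrow> bool" where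
  "deformation K L br \<alpha> A \<epsilon> lam \<longleftrightarrow>
     augmented_algebra K A \<epsilon> \<and>
     hom_leibniz_algebra K (tensor K A L) lam (id_tensor K A L \<alpha>) \<and>
     bilinear_map A (tensor_mod K A L) (tensor_mod K A L) (tensor_mod K A L) lam \<and>
     aug_tensor K A L \<epsilon> \<in>
       hom_leibniz_morphisms K (tensor K A L) lam (id_tensor K A L \<alpha>) L br \<alpha>"

definition infinitesimal_base ::
  "('k, 'm) ring_scheme \<Rightarrow> ('k, 'a, 'n) module_scheme \<Rightarrow> ('a \<Rightarrow> 'k) \<Rightarrow> bool" where
  "infinitesimal_base K A \<epsilon> \<longleftrightarrow>
     (\<forall>a\<in>aug_ideal K A \<epsilon>. \<forall>b\<in>aug_ideal K A \<epsilon>. a \<otimes>\<^bsub>A\<^esub> b = \<zero>\<^bsub>A\<^esub>)"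

definition equivalent_deformations ::
  "('k, 'm) ring_scheme \<Rightarrow> ('k, 'l, 'p) module_scheme \<Rightarrow> ('l \<Rightarrow> 'l) \<Rightarrow>
   ('k, 'a, 'n) module_scheme \<Rightarrow> ('a \<Rightarrow> 'k) \<Rightarrow>
   (('a \<times> 'l \<Rightarrow> 'k) set \<Rightarrow> ('a \<times> 'l \<Rightarrow> 'k) set \<Rightarrow> ('a \<times> 'l \<Rightarrow> 'k) set) \<Rightarrow>
   (('a \<times> 'l \<Rightarrow> 'k) set \<Rightarrow> ('a \<times> 'l \<Rightarrow> 'k) set \<Rightarrow> ('a \<times> 'l \<Rightarrow> 'k) set) \<Rightarrow> bool" where
  "equivalent_deformations K L \<alpha> A \<epsilon> lam1 lam2 \<longleftrightarrow>
     (\<exists>\<rho>. \<rho> \<in> module_hom A (tensor_mod K A L) (tensor_mod K A L) \<and>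
          bij_betw \<rho> (carrier (tensor K A L)) (carrier (tensor K A L)) \<and>
          \<rho> \<in> hom_leibniz_morphisms K (tensor K A L) lam1 (id_tensor K A L \<alpha>)
                                      (tensor K A L) lam2 (id_tensor K A L \<alpha>) \<and>
          (\<forall>t\<in>carrier (tensor K A L). aug_tensor K A L \<epsilon> (\<rho> t) = aug_tensor K A L \<epsilon> t))"

text \<open>
  \<open>is_pushout K L br \<alpha> A \<epsilon> lam B \<epsilon>' \<phi> lam'\<close>: \<open>lam'\<close> is the push-out along \<open>\<phi> : A \<rightarrow> B\<close> of the
  deformation \<open>lam\<close> with base \<open>A\<close>. On the carrier it is unique, since \<open>1 \<otimes> L\<close> generates \<open>B \<otimes> L\<close>
  over \<open>B\<close>.
\<close>

definition is_pushout ::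
  "('k, 'm) ring_scheme \<Rightarrow> ('k, 'l, 'p) module_scheme \<Rightarrow> ('l \<Rightarrow> 'l \<Rightarrow> 'l) \<Rightarrow> ('l \<Rightarrow> 'l) \<Rightarrow>
   ('k, 'a, 'n) module_scheme \<Rightarrow> ('a \<Rightarrow> 'k) \<Rightarrow>
   (('a \<times> 'l \<Rightarrow> 'k) set \<Rightarrow> ('a \<times> 'l \<Rightarrow> 'k) set \<Rightarrow> ('a \<times> 'l \<Rightarrow> 'k) set) \<Rightarrow>
   ('k, 'b, 'q) module_scheme \<Rightarrow> ('b \<Rightarrow> 'k) \<Rightarrow> ('a \<Rightarrow> 'b) \<Rightarrow>
   (('b \<times> 'l \<Rightarrow> 'k) set \<Rightarrow> ('b \<times> 'l \<Rightarrow> 'k) set \<Rightarrow> ('b \<times> 'l \<Rightarrow> 'k) set) \<Rightarrow> bool" where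
  "is_pushout K L br \<alpha> A \<epsilon> lam B \<epsilon>' \<phi> lam' \<longleftrightarrow>
     deformation K L br \<alpha> B \<epsilon>' lam' \<and>
     (\<forall>l1\<in>carrier L. \<forall>l2\<in>carrier L. \<forall>n::nat.
        \<forall>c\<in>{..<n} \<rightarrow> aug_ideal K A \<epsilon>. \<forall>y\<in>{..<n} \<rightarrow> carrier L.
          lam (tens K A L \<one>\<^bsub>A\<^esub> l1) (tens K A L \<one>\<^bsub>A\<^esub> l2) =
            tens K A L \<one>\<^bsub>A\<^esub> (br l1 l2) \<oplus>\<^bsub>tensor K A L\<^esub>
              (\<Oplus>\<^bsub>tensor K A L\<^esub>j\<in>{..<n}. tens K A L (c j) (y j)) \<longrightarrow>
          lam' (tens K B L \<one>\<^bsub>B\<^esub> l1) (tens K B L \<one>\<^bsub>B\<^esub> l2) =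
            tens K B L \<one>\<^bsub>B\<^esub> (br l1 l2) \<oplus>\<^bsub>tensor K B L\<^esub>
              (\<Oplus>\<^bsub>tensor K B L\<^esub>j\<in>{..<n}. tens K B L (\<phi> (c j)) (y j)))"


section \<open>The infinitesimal deformation with base \<open>K \<oplus> H'\<close>\<close>

text \<open>The algebra \<open>K \<oplus> M\<close> in which \<open>M\<close> squares to zero; its augmentation is \<^const>\<open>fst\<close>.\<close>

definition square_zero_ext ::
  "('k, 'm) ring_scheme \<Rightarrow> ('k, 'v, 'n) module_scheme \<Rightarrow> ('k, 'k \<times> 'v) module" where
  "square_zero_ext K M =
     \<lparr>carrier = carrier K \<times> carrier M,
      monoid.mult = (\<lambda>(k1, h1) (k2, h2). (k1 \<otimes>\<^bsub>K\<^esub> k2, k1 \<odot>\<^bsub>M\<^esub> h2 \<oplus>\<^bsub>M\<^esub> k2 \<odot>\<^bsub>M\<^esub> h1)),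
      one = (\<one>\<^bsub>K\<^esub>, \<zero>\<^bsub>M\<^esub>),
      zero = (\<zero>\<^bsub>K\<^esub>, \<zero>\<^bsub>M\<^esub>),
      add = (\<lambda>(k1, h1) (k2, h2). (k1 \<oplus>\<^bsub>K\<^esub> k2, h1 \<oplus>\<^bsub>M\<^esub> h2)),
      smult = (\<lambda>c (k, h). (c \<otimes>\<^bsub>K\<^esub> k, c \<odot>\<^bsub>M\<^esub> h))\<rparr>"

definition base1 ::
  "('k, 'm) ring_scheme \<Rightarrow> ('k, 'l, 'p) module_scheme \<Rightarrow> ('l \<Rightarrow> 'l \<Rightarrow> 'l) \<Rightarrow> ('l \<Rightarrow> 'l) \<Rightarrow>
   ('k, 'k \<times> (('l \<times> 'l \<Rightarrow> 'l) set \<Rightarrow> 'k)) module" where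
  "base1 K L br \<alpha> = square_zero_ext K (dual_space K (cohomology2 K L br \<alpha>))"

text \<open>
  \<open>\<mu>\<close> chooses cocycle representatives (a class is the set of its representatives), and \<open>h\<close>, \<open>g\<close>
  are dual bases of the cohomology space and of its dual, both indexed by \<open>1, \<dots>, r\<close>.
\<close>

definition representative_map ::
  "('k, 'm) ring_scheme \<Rightarrow> ('k, 'l, 'p) module_scheme \<Rightarrow> ('l \<Rightarrow> 'l \<Rightarrow> 'l) \<Rightarrow> ('l \<Rightarrow> 'l) \<Rightarrow>
   (('l \<times> 'l \<Rightarrow> 'l) set \<Rightarrow> 'l \<times> 'l \<Rightarrow> 'l) \<Rightarrow> bool" where
  "representative_map K L br \<alpha> \<mu> \<longleftrightarrow>
     \<mu> \<in> module_hom K (cohomology2 K L br \<alpha>) (cochains2 K L \<alpha>) \<and>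
     (\<forall>c\<in>carrier (cohomology2 K L br \<alpha>). \<mu> c \<in> c)"

definition dual_bases ::
  "('k, 'm) ring_scheme \<Rightarrow> ('k, 'v, 'n) module_scheme \<Rightarrow> nat \<Rightarrow>
   (nat \<Rightarrow> 'v) \<Rightarrow> (nat \<Rightarrow> 'v \<Rightarrow> 'k) \<Rightarrow> bool" where
  "dual_bases K V r h g \<longleftrightarrow>
     inj_on h {1..r} \<and> vectorspace.basis K V (h ` {1..r}) \<and>
     (\<forall>i\<in>{1..r}. g i \<in> carrier (dual_space K V) \<and>
        (\<forall>j\<in>{1..r}. g i (h j) = (if i = j then \<one>\<^bsub>K\<^esub> else \<zero>\<^bsub>K\<^esub>)))"

definition eta1 ::
  "('k, 'm) ring_scheme \<Rightarrow> ('k, 'l, 'p) module_scheme \<Rightarrow> ('l \<Rightarrow> 'l \<Rightarrow> 'l) \<Rightarrow> ('l \<Rightarrow> 'l) \<Rightarrow>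
   (('l \<times> 'l \<Rightarrow> 'l) set \<Rightarrow> 'l \<times> 'l \<Rightarrow> 'l) \<Rightarrow> nat \<Rightarrow> (nat \<Rightarrow> ('l \<times> 'l \<Rightarrow> 'l) set) \<Rightarrow>
   (nat \<Rightarrow> ('l \<times> 'l \<Rightarrow> 'l) set \<Rightarrow> 'k) \<Rightarrow>
   (('k \<times> (('l \<times> 'l \<Rightarrow> 'l) set \<Rightarrow> 'k)) \<times> 'l \<Rightarrow> 'k) set \<Rightarrow>
   (('k \<times> (('l \<times> 'l \<Rightarrow> 'l) set \<Rightarrow> 'k)) \<times> 'l \<Rightarrow> 'k) set \<Rightarrow>
   (('k \<times> (('l \<times> 'l \<Rightarrow> 'l) set \<Rightarrow> 'k)) \<times> 'l \<Rightarrow> 'k) set" where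
  "eta1 K L br \<alpha> \<mu> r h g =
     (let C = base1 K L br \<alpha> in
        bilinear_ext K C L
          (\<lambda>x y. tens K C L \<one>\<^bsub>C\<^esub> (br x y) \<oplus>\<^bsub>tensor K C L\<^esub>
             (\<Oplus>\<^bsub>tensor K C L\<^esub>i\<in>{1..r}. tens K C L (\<zero>\<^bsub>K\<^esub>, g i) (\<mu> (h i) (x, y)))))"

end

theory Submission
  imports Defs
begin

text \<open>
  Infinitesimal deformations are first-order data. Let \<open>\<mm>\<close> be the augmentation ideal of \<open>A\<close>, \<open>B\<close> a
  basis of \<open>\<mm>\<close>, and \<open>\<xi> b\<close>, for \<open>b \<in> B\<close>, the functional on \<open>A\<close> that vanishes at \<open>1\<close> and is the coordinate
  of \<open>b\<close> on \<open>\<mm>\<close>. A tensor \<open>t \<in> A \<otimes> L\<close> amounts to its coordinates \<open>t\<^sub>0 = (\<epsilon> \<otimes> id) t\<close> and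
  \<open>t\<^sub>b = (\<xi> b \<otimes> id) t\<close> in \<open>L\<close> (\<open>of_coords_coords\<close>). Because \<open>\<mm>\<^sup>2 = 0\<close>, every \<open>\<xi> b\<close> is a derivation along
  \<open>\<epsilon>\<close>, so the bracket of a deformation has the coordinates
  \<open>[s,t]\<^sub>0 = [s\<^sub>0,t\<^sub>0]\<close> and \<open>[s,t]\<^sub>b = [s\<^sub>b,t\<^sub>0] + [s\<^sub>0,t\<^sub>b] + \<psi>\<^sub>b(s\<^sub>0,t\<^sub>0)\<close>
  (\<open>deformation_coordinates\<close>). The coordinate of \<open>b\<close> of the Hom-Leibniz identity is then the cocycle
  condition for \<open>\<psi>\<^sub>b\<close>, and a deformation is the same as a family of 2-cocycles indexed by \<open>B\<close>
  (\<open>deformation_cocycle\<close>, \<open>deformation_of_cocycles\<close>).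

  An \<open>A\<close>-linear map that is the identity modulo \<open>\<mm>\<close> has the form \<open>t\<^sub>0 \<mapsto> t\<^sub>0\<close>, \<open>t\<^sub>b \<mapsto> t\<^sub>b + f\<^sub>b(t\<^sub>0)\<close>, and it is
  always bijective. It commutes with the twisting maps iff each \<open>f\<^sub>b\<close> is a 1-cochain, and it carries
  one bracket to the other iff their cocycles differ by \<open>\<delta>\<^sup>1 f\<^sub>b\<close> (\<open>equivalent_deformations_iff\<close>). Up to
  equivalence, a deformation is therefore a family of classes \<open>c\<^sub>b\<close> in \<open>H\<^sup>2\<close>.

  The push-out of \<open>\<eta>\<^sub>1\<close> along \<open>id + a\<close> has the cocycles \<open>\<Sum>\<^sub>i \<xi>\<^sub>b(a(g\<^sub>i)) \<mu>\<^sub>i\<close>, which by linearity of \<open>\<mu>\<close> represent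
  the classes \<open>\<Sum>\<^sub>i \<xi>\<^sub>b(a(g\<^sub>i)) h\<^sub>i\<close>. They agree with the \<open>c\<^sub>b\<close> iff \<open>\<xi>\<^sub>b(a(g\<^sub>i)) = g\<^sub>i(c\<^sub>b)\<close> for all \<open>b\<close> and \<open>i\<close>,
  that is, iff \<open>a(g\<^sub>i) = \<Sum>\<^sub>b g\<^sub>i(c\<^sub>b) b\<close> (\<open>pushout_equivalent_iff\<close>). As the \<open>g\<^sub>i\<close> form a basis of the dual,
  exactly one linear map \<open>a\<close> satisfies this, namely \<open>f \<mapsto> \<Sum>\<^sub>b f(c\<^sub>b) b\<close>.

  All of this rests on the universal property of the tensor product, which is a quotient of a free
  space: bilinear maps factor through it (\<open>tensor_lift_hom\<close>, \<open>tensor_lift_tens\<close>), and linear maps on it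
  are determined by their values on pure tensors (\<open>tensor_hom_eqI\<close>).
\<close>

section \<open>Linear maps, function spaces and quotients\<close>

lemma module_homI:
  assumes "\<And>x. x \<in> carrier M \<Longrightarrow> f x \<in> carrier N"
    and "\<And>x y. \<lbrakk>x \<in> carrier M; y \<in> carrier M\<rbrakk> \<Longrightarrow> f (x \<oplus>\<^bsub>M\<^esub> y) = f x \<oplus>\<^bsub>N\<^esub> f y"
    and "\<And>k x. \<lbrakk>k \<in> carrier R; x \<in> carrier M\<rbrakk> \<Longrightarrow> f (k \<odot>\<^bsub>M\<^esub> x) = k \<odot>\<^bsub>N\<^esub> f x"
  shows "f \<in> module_hom R M N"
  using assms by (auto simp: module_hom_def)

lemma module_hom_carrier: "\<lbrakk>f \<in> module_hom R M N; x \<in> carrier M\<rbrakk> \<Longrightarrow> f x \<in> carrier N"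
  by (auto simp: module_hom_def)

lemma module_hom_zero:
  "\<lbrakk>f \<in> module_hom R M N; module R M; module R N\<rbrakk> \<Longrightarrow> f \<zero>\<^bsub>M\<^esub> = \<zero>\<^bsub>N\<^esub>"
  by (intro mod_hom.f0_is_0[of R M N f] mod_hom.intro mod_hom_axioms.intro)

lemma module_hom_finsum:
  assumes f: "f \<in> module_hom R M N" and M: "module R M" and N: "module R N"
    and g: "\<And>i. i \<in> I \<Longrightarrow> g i \<in> carrier M"
  shows "f (\<Oplus>\<^bsub>M\<^esub>i\<in>I. g i) = (\<Oplus>\<^bsub>N\<^esub>i\<in>I. f (g i))"
  using g
proof (induction I rule: infinite_finite_induct)
  case (insert i I)
  interpret M: module R M by (fact M)
  interpret N: module R N by (fact N)
  have "f (g j) \<in> carrier N" if "j \<in> insert i I" for j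
    using module_hom_carrier[OF f] insert.prems that by blast
  with insert show ?case
    by (subst M.finsum_insert N.finsum_insert; auto simp: module_hom_add[OF f])+
next
  case (infinite I)
  interpret M: module R M by (fact M)
  interpret N: module R N by (fact N)
  from infinite show ?case
    by (simp add: M.finsum_infinite N.finsum_infinite module_hom_zero[OF f M N])
next
  case empty
  interpret M: module R M by (fact M)
  interpret N: module R N by (fact N)
  show ?case by (simp add: module_hom_zero[OF f M N])
qed

lemma module_hom_comp:
  "\<lbrakk>f \<in> module_hom R M N; g \<in> module_hom R N P\<rbrakk> \<Longrightarrow> (\<lambda>x. g (f x)) \<in> module_hom R M P"
  unfolding module_hom_def by (auto simp: Pi_iff)

lemma module_hom_plus:
  assumes "module R N" "f \<in> module_hom R M N" "g \<in> module_hom R M N"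
  shows "(\<lambda>x. f x \<oplus>\<^bsub>N\<^esub> g x) \<in> module_hom R M N"
proof -
  interpret module R N by (fact assms)
  show ?thesis
    using assms(2,3) by (intro module_homI)
      (auto simp: module_hom_add module_hom_smult module_hom_carrier smult_r_distr M.a_ac)
qed

lemma module_hom_smult_fun:
  assumes "module R N" "f \<in> module_hom R M N" "k \<in> carrier R"
  shows "(\<lambda>x. k \<odot>\<^bsub>N\<^esub> f x) \<in> module_hom R M N"
proof -
  interpret module R N by (fact assms)
  show ?thesis
    using assms(2,3) by (intro module_homI)
      (auto simp: module_hom_add module_hom_smult module_hom_carrier smult_r_distr
         smult_assoc1[symmetric] R.m_comm)
qed

lemma module_hom_sum:
  assumes N: "module R N" and f: "\<And>i. i \<in> I \<Longrightarrow> f i \<in> module_hom R M N"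
  shows "(\<lambda>x. \<Oplus>\<^bsub>N\<^esub>i\<in>I. f i x) \<in> module_hom R M N"
proof -
  interpret module R N by (fact N)
  note fs = module_hom_carrier[OF f] module_hom_add[OF f] module_hom_smult[OF f]
  show ?thesis
  proof (rule module_homI)
    fix x y assume xy: "x \<in> carrier M" "y \<in> carrier M"
    have "(\<Oplus>\<^bsub>N\<^esub>i\<in>I. f i (x \<oplus>\<^bsub>M\<^esub> y)) = (\<Oplus>\<^bsub>N\<^esub>i\<in>I. f i x \<oplus>\<^bsub>N\<^esub> f i y)"
      using xy fs by (intro M.finsum_cong') auto
    then show "(\<Oplus>\<^bsub>N\<^esub>i\<in>I. f i (x \<oplus>\<^bsub>M\<^esub> y)) = (\<Oplus>\<^bsub>N\<^esub>i\<in>I. f i x) \<oplus>\<^bsub>N\<^esub> (\<Oplus>\<^bsub>N\<^esub>i\<in>I. f i y)"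
      using xy fs by (simp add: M.finsum_addf Pi_iff)
  next
    fix k x assume kx: "k \<in> carrier R" "x \<in> carrier M"
    have "(\<Oplus>\<^bsub>N\<^esub>i\<in>I. f i (k \<odot>\<^bsub>M\<^esub> x)) = (\<Oplus>\<^bsub>N\<^esub>i\<in>I. k \<odot>\<^bsub>N\<^esub> f i x)"
      using kx fs by (intro M.finsum_cong') auto
    then show "(\<Oplus>\<^bsub>N\<^esub>i\<in>I. f i (k \<odot>\<^bsub>M\<^esub> x)) = k \<odot>\<^bsub>N\<^esub> (\<Oplus>\<^bsub>N\<^esub>i\<in>I. f i x)"
      using kx fs by (simp add: finsum_smult Pi_iff)
  qed (use fs in \<open>auto intro!: M.finsum_closed\<close>)
qed

lemma module_hom_restrict_carrier:
  "\<lbrakk>f \<in> module_hom R M N; W \<subseteq> carrier M\<rbrakk> \<Longrightarrow> f \<in> module_hom R (M\<lparr>carrier := W\<rparr>) N"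
  unfolding module_hom_def by (auto simp: Pi_iff subset_iff)

lemma bilinear_mapD:
  assumes "bilinear_map R U V W b"
  shows "\<lbrakk>u \<in> carrier U; v \<in> carrier V\<rbrakk> \<Longrightarrow> b u v \<in> carrier W"
    and "\<lbrakk>u \<in> carrier U; v \<in> carrier V; v' \<in> carrier V\<rbrakk> \<Longrightarrow> b u (v \<oplus>\<^bsub>V\<^esub> v') = b u v \<oplus>\<^bsub>W\<^esub> b u v'"
    and "\<lbrakk>u \<in> carrier U; u' \<in> carrier U; v \<in> carrier V\<rbrakk> \<Longrightarrow> b (u \<oplus>\<^bsub>U\<^esub> u') v = b u v \<oplus>\<^bsub>W\<^esub> b u' v"
    and "\<lbrakk>k \<in> carrier R; u \<in> carrier U; v \<in> carrier V\<rbrakk> \<Longrightarrow> b u (k \<odot>\<^bsub>V\<^esub> v) = k \<odot>\<^bsub>W\<^esub> b u v"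
    and "\<lbrakk>k \<in> carrier R; u \<in> carrier U; v \<in> carrier V\<rbrakk> \<Longrightarrow> b (k \<odot>\<^bsub>U\<^esub> u) v = k \<odot>\<^bsub>W\<^esub> b u v"
  using assms unfolding bilinear_map_def module_hom_def by (auto simp: Pi_iff)

lemma bilinear_mapI:
  assumes "\<And>u v. \<lbrakk>u \<in> carrier U; v \<in> carrier V\<rbrakk> \<Longrightarrow> b u v \<in> carrier W"
    and "\<And>u v v'. \<lbrakk>u \<in> carrier U; v \<in> carrier V; v' \<in> carrier V\<rbrakk> \<Longrightarrow> b u (v \<oplus>\<^bsub>V\<^esub> v') = b u v \<oplus>\<^bsub>W\<^esub> b u v'"
    and "\<And>u u' v. \<lbrakk>u \<in> carrier U; u' \<in> carrier U; v \<in> carrier V\<rbrakk> \<Longrightarrow> b (u \<oplus>\<^bsub>U\<^esub> u') v = b u v \<oplus>\<^bsub>W\<^esub> b u' v"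
    and "\<And>k u v. \<lbrakk>k \<in> carrier R; u \<in> carrier U; v \<in> carrier V\<rbrakk> \<Longrightarrow> b u (k \<odot>\<^bsub>V\<^esub> v) = k \<odot>\<^bsub>W\<^esub> b u v"
    and "\<And>k u v. \<lbrakk>k \<in> carrier R; u \<in> carrier U; v \<in> carrier V\<rbrakk> \<Longrightarrow> b (k \<odot>\<^bsub>U\<^esub> u) v = k \<odot>\<^bsub>W\<^esub> b u v"
  shows "bilinear_map R U V W b"
  using assms unfolding bilinear_map_def module_hom_def by (auto simp: Pi_iff)

lemma scalars_simps [simp]:
  "carrier (scalars K) = carrier K" "monoid.mult (scalars K) = monoid.mult K"
  "\<one>\<^bsub>scalars K\<^esub> = \<one>\<^bsub>K\<^esub>" "\<zero>\<^bsub>scalars K\<^esub> = \<zero>\<^bsub>K\<^esub>" "add (scalars K) = add K"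
  "smult (scalars K) = monoid.mult K"
  by (simp_all add: scalars_def)

lemma scalars_module: "cring K \<Longrightarrow> module K (scalars K)"
proof -
  assume "cring K"
  then interpret cring K .
  show ?thesis
  proof (rule module_criteria, goal_cases)
    case 4
    show ?case using r_neg by force
  qed (auto simp: a_ac m_assoc l_distr r_distr cring_axioms)
qed

lemma finsum_scalars: "finsum (scalars K) f S = finsum K f S"
  by (simp add: finsum_def finprod_def)

lemma fun_space_simps [simp]:
  "carrier (fun_space S V) = S \<rightarrow>\<^sub>E carrier V"
  "\<zero>\<^bsub>fun_space S V\<^esub> = (\<lambda>s\<in>S. \<zero>\<^bsub>V\<^esub>)"
  "f \<oplus>\<^bsub>fun_space S V\<^esub> g = (\<lambda>s\<in>S. f s \<oplus>\<^bsub>V\<^esub> g s)"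
  "k \<odot>\<^bsub>fun_space S V\<^esub> f = (\<lambda>s\<in>S. k \<odot>\<^bsub>V\<^esub> f s)"
  by (simp_all add: fun_space_def)

lemma fun_space_module:
  assumes "module K V"
  shows "module K (fun_space S V)"
proof -
  interpret module K V by (fact assms)
  show ?thesis
  proof (rule module_criteria, goal_cases)
    case 4
    show ?case
    proof
      fix f assume f: "f \<in> carrier (fun_space S V)"
      show "\<exists>g\<in>carrier (fun_space S V). f \<oplus>\<^bsub>fun_space S V\<^esub> g = \<zero>\<^bsub>fun_space S V\<^esub>"
        by (rule bexI[of _ "\<lambda>s\<in>S. \<ominus>\<^bsub>V\<^esub> f s"]) (use f in \<open>auto simp: PiE_iff M.r_neg intro!: restrict_ext\<close>)
    qed
  qed (use R.is_cring in \<open>simp_all add: PiE_iff M.a_ac smult_assoc1 smult_l_distr smult_r_distr fun_eq_iff extensional_def\<close>)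
qed

lemma eval_hom: "s \<in> S \<Longrightarrow> (\<lambda>f. f s) \<in> module_hom K (fun_space S V) V"
  by (auto simp: module_hom_def)

text \<open>
  Each axiom in \<open>N\<close> is the image of the same axiom in \<open>M\<close>; the lemma is meant for coset maps.
\<close>

lemma module_surj_image:
  assumes M: "module R M"
    and surj: "p ` carrier M = carrier N"
    and p_zero: "p \<zero>\<^bsub>M\<^esub> = \<zero>\<^bsub>N\<^esub>"
    and p_add: "\<And>x y. \<lbrakk>x \<in> carrier M; y \<in> carrier M\<rbrakk> \<Longrightarrow> p x \<oplus>\<^bsub>N\<^esub> p y = p (x \<oplus>\<^bsub>M\<^esub> y)"
    and p_smult: "\<And>k x. \<lbrakk>k \<in> carrier R; x \<in> carrier M\<rbrakk> \<Longrightarrow> k \<odot>\<^bsub>N\<^esub> p x = p (k \<odot>\<^bsub>M\<^esub> x)"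
  shows "module R N"
proof -
  interpret module R M by (fact M)
  note simps = p_add p_smult p_zero[symmetric] M.a_ac smult_assoc1 smult_l_distr smult_r_distr
  have neg: "p x \<oplus>\<^bsub>N\<^esub> p (\<ominus>\<^bsub>M\<^esub> x) = p \<zero>\<^bsub>M\<^esub>" if "x \<in> carrier M" for x
    using that by (simp add: p_add M.r_neg)
  show ?thesis
  proof (rule module_criteria, unfold surj[symmetric] p_zero[symmetric], goal_cases)
    case 4
    show ?case using neg by auto
  qed (auto simp: simps R.is_cring)
qed

lemma submodule_abelian_subgroup:
  assumes "submodule R W V"
  shows "abelian_subgroup W V"
proof -
  interpret W: submodule R W V by (fact assms)
  interpret module R V by (fact W.module)
  have "\<ominus>\<^bsub>V\<^esub> x \<in> W" if "x \<in> W" for x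
  proof -
    have "(\<ominus>\<^bsub>R\<^esub> \<one>\<^bsub>R\<^esub>) \<odot>\<^bsub>V\<^esub> x \<in> W" using that by (intro W.smult_closed) auto
    then show ?thesis by (subst smult_minus_1[symmetric]) (use that W.subset in auto)
  qed
  then have "subgroup W (add_monoid V)"
    using W.subset by (intro add.subgroupI) (auto simp: a_inv_def[symmetric] intro: W.zero_closed)
  then show ?thesis
    by (intro abelian_subgroupI3 additive_subgroupI M.abelian_group_axioms)
qed

locale quotient_module =
  fixes R (structure) and W and V (structure)
  assumes sub: "submodule R W V"
begin

sublocale module R V using sub by (rule submodule.module)
sublocale W: abelian_subgroup W V using sub by (rule submodule_abelian_subgroup)

abbreviation (input) coset where "coset v \<equiv> W +>\<^bsub>V\<^esub> v"

lemma mem_coset: "v \<in> carrier V \<Longrightarrow> y \<in> coset v \<longleftrightarrow> y \<in> carrier V \<and> y \<ominus>\<^bsub>V\<^esub> v \<in> W"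
proof
  assume v: "v \<in> carrier V" and "y \<in> coset v"
  then obtain w where w: "w \<in> W" "y = w \<oplus>\<^bsub>V\<^esub> v" by (auto simp: a_r_coset_def')
  then have "w \<in> carrier V" using W.a_subset by blast
  with v w show "y \<in> carrier V \<and> y \<ominus>\<^bsub>V\<^esub> v \<in> W" by (simp add: a_minus_def M.a_assoc M.r_neg)
next
  assume v: "v \<in> carrier V" and y: "y \<in> carrier V \<and> y \<ominus>\<^bsub>V\<^esub> v \<in> W"
  then have "y = (y \<ominus>\<^bsub>V\<^esub> v) \<oplus>\<^bsub>V\<^esub> v" by (simp add: a_minus_def M.a_assoc M.l_neg)
  with y show "y \<in> coset v" unfolding a_r_coset_def' by blast
qed

lemma coset_eq_iff:
  assumes "u \<in> carrier V" "v \<in> carrier V"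
  shows "coset u = coset v \<longleftrightarrow> u \<ominus>\<^bsub>V\<^esub> v \<in> W"
proof
  assume "coset u = coset v"
  with assms show "u \<ominus>\<^bsub>V\<^esub> v \<in> W" using W.a_rcos_self[of u] mem_coset by blast
next
  assume "u \<ominus>\<^bsub>V\<^esub> v \<in> W"
  with assms have "u \<in> coset v" using mem_coset by blast
  then show "coset u = coset v" using M.a_repr_independence[of u W v] assms W.a_subgroup by simp
qed

lemma quot_carrier: "carrier (quot_space V W) = coset ` carrier V"
  by (auto simp: quot_space_def A_RCOSETS_def')

text \<open>
  Another representative of the coset of \<open>v\<close> differs from \<open>v\<close> by some \<open>w \<in> W\<close>, and \<open>k w \<in> W\<close>. So all the
  cosets in the union that defines the scalar multiplication of \<^const>\<open>quot_space\<close> coincide.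
\<close>

lemma coset_hom: "coset \<in> module_hom R V (quot_space V W)"
proof (rule module_homI)
  fix k v assume k: "k \<in> carrier R" and v: "v \<in> carrier V"
  have eq: "coset (k \<odot>\<^bsub>V\<^esub> x) = coset (k \<odot>\<^bsub>V\<^esub> v)" if "x \<in> coset v" for x
  proof -
    from that v have x: "x \<in> carrier V" "x \<ominus>\<^bsub>V\<^esub> v \<in> W" by (auto simp: mem_coset)
    have "k \<odot>\<^bsub>V\<^esub> x \<ominus>\<^bsub>V\<^esub> k \<odot>\<^bsub>V\<^esub> v = k \<odot>\<^bsub>V\<^esub> (x \<ominus>\<^bsub>V\<^esub> v)"
      using k v x by (simp add: a_minus_def smult_r_distr smult_r_minus)
    with k v x show ?thesis using submodule.smult_closed[OF sub] by (simp add: coset_eq_iff)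
  qed
  have "(\<Union>x\<in>coset v. coset (k \<odot>\<^bsub>V\<^esub> x)) = (\<Union>x\<in>coset v. coset (k \<odot>\<^bsub>V\<^esub> v))"
    using eq by (rule SUP_cong[OF refl])
  also have "\<dots> = coset (k \<odot>\<^bsub>V\<^esub> v)" using W.a_rcos_self[OF v] by blast
  finally show "coset (k \<odot>\<^bsub>V\<^esub> v) = k \<odot>\<^bsub>quot_space V W\<^esub> coset v"
    by (simp add: quot_space_def)
next
  fix u v assume "u \<in> carrier V" "v \<in> carrier V"
  then show "coset (u \<oplus>\<^bsub>V\<^esub> v) = coset u \<oplus>\<^bsub>quot_space V W\<^esub> coset v"
    by (simp add: quot_space_def W.a_rcos_sum)
qed (simp add: quot_carrier)

lemma quot_module: "module R (quot_space V W)"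
proof (rule module_surj_image[OF module_axioms])
  show "coset ` carrier V = carrier (quot_space V W)" by (simp add: quot_carrier)
  show "coset \<zero>\<^bsub>V\<^esub> = \<zero>\<^bsub>quot_space V W\<^esub>"
    using W.a_subset by (simp add: quot_space_def)
qed (simp_all only: module_hom_add[OF coset_hom] module_hom_smult[OF coset_hom])

end

section \<open>The universal property of the tensor product\<close>

subsection \<open>Free modules\<close>

lemma free_space_submodule:
  assumes "cring K"
  shows "submodule K (carrier (free_space K S)) (fun_space S (scalars K))"
proof -
  interpret cring K by (fact assms)
  show ?thesis
  proof (rule submodule.intro)
    show "module K (fun_space S (scalars K))" by (intro fun_space_module scalars_module assms)
    show "f \<oplus>\<^bsub>fun_space S (scalars K)\<^esub> g \<in> carrier (free_space K S)"
      if "f \<in> carrier (free_space K S)" "g \<in> carrier (free_space K S)" for f g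
      using that by (auto simp: free_space_def PiE_iff 
        intro!: rev_finite_subset[OF finite_UnI[of "{s \<in> S. f s \<noteq> \<zero>\<^bsub>K\<^esub>}" "{s \<in> S. g s \<noteq> \<zero>\<^bsub>K\<^esub>}"]])
    show "k \<odot>\<^bsub>fun_space S (scalars K)\<^esub> f \<in> carrier (free_space K S)"
      if "k \<in> carrier K" "f \<in> carrier (free_space K S)" for k f
      using that by (auto simp: free_space_def PiE_iff 
        intro!: rev_finite_subset[of "{s \<in> S. f s \<noteq> \<zero>\<^bsub>K\<^esub>}"])
  qed (auto simp: free_space_def)
qed

lemma free_space_eq:
  "free_space K S = (fun_space S (scalars K))\<lparr>carrier := carrier (free_space K S)\<rparr>"
  by (simp add: free_space_def)

lemma free_space_ops:
  "add (free_space K S) = add (fun_space S (scalars K))"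
  "smult (free_space K S) = smult (fun_space S (scalars K))"
  "\<zero>\<^bsub>free_space K S\<^esub> = \<zero>\<^bsub>fun_space S (scalars K)\<^esub>"
  by (simp_all add: free_space_def)

lemma free_space_module: "cring K \<Longrightarrow> module K (free_space K S)"
  by (subst free_space_eq)
     (intro module.submodule_is_module fun_space_module scalars_module free_space_submodule)

lemma free_gen_closed: "\<lbrakk>cring K; s \<in> S\<rbrakk> \<Longrightarrow> free_gen K S s \<in> carrier (free_space K S)"
  by (auto simp: free_space_def free_gen_def cring.cring_simprules intro: finite_subset[of _ "{s}"])

text \<open>
  Evaluated at a point \<open>t\<close>, all summands except the one for \<open>t\<close> vanish.
\<close>

lemma free_space_decomp:
  assumes "cring K" and f: "f \<in> carrier (free_space K S)"
  shows "f = (\<Oplus>\<^bsub>free_space K S\<^esub>s\<in>{s \<in> S. f s \<noteq> \<zero>\<^bsub>K\<^esub>}. f s \<odot>\<^bsub>free_space K S\<^esub> free_gen K S s)"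
    (is "f = ?rhs")
proof
  interpret K: cring K by (fact assms)
  interpret F: module K "free_space K S" by (intro free_space_module assms)
  let ?T = "{s \<in> S. f s \<noteq> \<zero>\<^bsub>K\<^esub>}"
  have fS: "f \<in> S \<rightarrow>\<^sub>E carrier K" and fin: "finite ?T" using f by (auto simp: free_space_def)
  have mem: "f s \<odot>\<^bsub>free_space K S\<^esub> free_gen K S s \<in> carrier (free_space K S)" if "s \<in> ?T" for s
    using that fS by (intro F.smult_closed free_gen_closed assms) auto
  fix t
  show "f t = ?rhs t"
  proof (cases "t \<in> S")
    case False
    have "?rhs \<in> carrier (free_space K S)" using mem by (intro F.finsum_closed) auto
    then show ?thesis using fS False by (auto simp: free_space_def PiE_iff extensional_def)
  next
    case True
    have "?rhs t = (\<Oplus>\<^bsub>scalars K\<^esub>s\<in>?T. (f s \<odot>\<^bsub>free_space K S\<^esub> free_gen K S s) t)"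
    proof (rule module_hom_finsum[where f = "\<lambda>f. f t" and R = K])
      show "(\<lambda>f. f t) \<in> module_hom K (free_space K S) (scalars K)"
        by (subst free_space_eq)
          (auto intro!: module_hom_restrict_carrier eval_hom True simp: free_space_def)
    qed (use mem in \<open>auto intro: F.module_axioms scalars_module assms\<close>)
    also have "\<dots> = (\<Oplus>\<^bsub>K\<^esub>s\<in>?T. if s = t then f s else \<zero>\<^bsub>K\<^esub>)"
      unfolding finsum_scalars
      by (rule K.finsum_cong') (use True fS in \<open>auto simp: free_gen_def PiE_iff free_space_ops\<close>)
    also have "\<dots> = f t"
    proof (cases "t \<in> ?T")
      case True
      then show ?thesis using fin fS by (subst K.add.finprod_singleton_swap) auto
    next
      case False
      then have "(\<Oplus>\<^bsub>K\<^esub>s\<in>?T. if s = t then f s else \<zero>\<^bsub>K\<^esub>) = (\<Oplus>\<^bsub>K\<^esub>s\<in>?T. \<zero>\<^bsub>K\<^esub>)"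
        by (intro K.finsum_cong') auto
      with False \<open>t \<in> S\<close> show ?thesis by simp
    qed
    finally show ?thesis by simp
  qed
qed

text \<open>
  The linear extension of the family \<open>g\<close> to the free space, written with exactly the sum that
  \<^const>\<open>tensor_lift\<close> forms from a representative.
\<close>

definition linear_ext ::
  "('k, 'm) ring_scheme \<Rightarrow> 's set \<Rightarrow> ('k, 'w, 'n) module_scheme \<Rightarrow> ('s \<Rightarrow> 'w) \<Rightarrow> ('s \<Rightarrow> 'k) \<Rightarrow> 'w" where
  "linear_ext K S M g f = (\<Oplus>\<^bsub>M\<^esub>s\<in>{s \<in> S. f s \<noteq> \<zero>\<^bsub>K\<^esub>}. f s \<odot>\<^bsub>M\<^esub> g s)"

text \<open>
  Sums over the supports of different functions become comparable over a common finite superset.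
\<close>

lemma linear_ext_superset:
  assumes "module K M" and g: "g \<in> S \<rightarrow> carrier M" and f: "f \<in> S \<rightarrow>\<^sub>E carrier K"
    and T: "finite T" "T \<subseteq> S" "{s \<in> S. f s \<noteq> \<zero>\<^bsub>K\<^esub>} \<subseteq> T"
  shows "linear_ext K S M g f = (\<Oplus>\<^bsub>M\<^esub>s\<in>T. f s \<odot>\<^bsub>M\<^esub> g s)"
proof -
  interpret module K M by (fact assms)
  have "g s \<in> carrier M" if "s \<in> S" for s using g that by auto
  with f T show ?thesis unfolding linear_ext_def
    by (intro M.add.finprod_mono_neutral_cong_left)
       (auto simp: PiE_iff subset_iff intro!: lmult_0)
qed

lemma linear_ext_hom:
  assumes "module K M" and g: "g \<in> S \<rightarrow> carrier M"
  shows "linear_ext K S M g \<in> module_hom K (free_space K S) M"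
proof (rule module_homI)
  interpret module K M by (fact assms)
  have gM: "g s \<in> carrier M" if "s \<in> S" for s using g that by auto
  let ?supp = "\<lambda>f. {s \<in> S. f s \<noteq> \<zero>\<^bsub>K\<^esub>}"
  fix f assume "f \<in> carrier (free_space K S)"
  then have f: "f \<in> S \<rightarrow>\<^sub>E carrier K" and fin: "finite (?supp f)" by (auto simp: free_space_def)
  show "linear_ext K S M g f \<in> carrier M"
    unfolding linear_ext_def using f gM by (intro M.finsum_closed) auto
  {
    fix f' assume "f' \<in> carrier (free_space K S)"
    then have f': "f' \<in> S \<rightarrow>\<^sub>E carrier K" and fin': "finite (?supp f')" by (auto simp: free_space_def)
    let ?T = "?supp f \<union> ?supp f'"
    have "linear_ext K S M g (f \<oplus>\<^bsub>free_space K S\<^esub> f')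
        = (\<Oplus>\<^bsub>M\<^esub>s\<in>?T. (f \<oplus>\<^bsub>free_space K S\<^esub> f') s \<odot>\<^bsub>M\<^esub> g s)"
      using f f' fin fin' by (intro linear_ext_superset assms) (auto simp: PiE_iff free_space_ops)
    also have "\<dots> = (\<Oplus>\<^bsub>M\<^esub>s\<in>?T. f s \<odot>\<^bsub>M\<^esub> g s \<oplus>\<^bsub>M\<^esub> f' s \<odot>\<^bsub>M\<^esub> g s)"
      using f f' gM by (intro M.finsum_cong') (auto simp: PiE_iff smult_l_distr free_space_ops)
    also have "\<dots> = (\<Oplus>\<^bsub>M\<^esub>s\<in>?T. f s \<odot>\<^bsub>M\<^esub> g s) \<oplus>\<^bsub>M\<^esub> (\<Oplus>\<^bsub>M\<^esub>s\<in>?T. f' s \<odot>\<^bsub>M\<^esub> g s)"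
      using f f' gM by (intro M.finsum_addf) auto
    also have "(\<Oplus>\<^bsub>M\<^esub>s\<in>?T. f s \<odot>\<^bsub>M\<^esub> g s) = linear_ext K S M g f"
      using f fin fin' by (intro linear_ext_superset[symmetric] assms) auto
    also have "(\<Oplus>\<^bsub>M\<^esub>s\<in>?T. f' s \<odot>\<^bsub>M\<^esub> g s) = linear_ext K S M g f'"
      using f' fin fin' by (intro linear_ext_superset[symmetric] assms) auto
    finally show "linear_ext K S M g (f \<oplus>\<^bsub>free_space K S\<^esub> f')
        = linear_ext K S M g f \<oplus>\<^bsub>M\<^esub> linear_ext K S M g f'" .
  }
  fix k assume k: "k \<in> carrier K"
  have "linear_ext K S M g (k \<odot>\<^bsub>free_space K S\<^esub> f)
      = (\<Oplus>\<^bsub>M\<^esub>s\<in>?supp f. (k \<odot>\<^bsub>free_space K S\<^esub> f) s \<odot>\<^bsub>M\<^esub> g s)"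
    using f fin k by (intro linear_ext_superset assms) (auto simp: PiE_iff free_space_ops)
  also have "\<dots> = (\<Oplus>\<^bsub>M\<^esub>s\<in>?supp f. k \<odot>\<^bsub>M\<^esub> (f s \<odot>\<^bsub>M\<^esub> g s))"
    using f k gM by (intro M.finsum_cong') (auto simp: PiE_iff smult_assoc1 free_space_ops)
  also have "\<dots> = k \<odot>\<^bsub>M\<^esub> linear_ext K S M g f"
    unfolding linear_ext_def using f k gM by (intro finsum_smult[symmetric]) auto
  finally show "linear_ext K S M g (k \<odot>\<^bsub>free_space K S\<^esub> f) = k \<odot>\<^bsub>M\<^esub> linear_ext K S M g f" .
qed

lemma linear_ext_gen:
  assumes "module K M" and g: "g \<in> S \<rightarrow> carrier M" and s: "s \<in> S"
  shows "linear_ext K S M g (free_gen K S s) = g s"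
proof -
  interpret module K M by (fact assms)
  have "linear_ext K S M g (free_gen K S s) = (\<Oplus>\<^bsub>M\<^esub>t\<in>{s}. free_gen K S s t \<odot>\<^bsub>M\<^esub> g t)"
    using s by (intro linear_ext_superset assms) (auto simp: free_gen_def)
  also have "\<dots> = g s" using g s by (subst M.finsum_insert) (auto simp: free_gen_def Pi_iff)
  finally show ?thesis .
qed

subsection \<open>Tensor products\<close>

locale tensor_product = A: module K A + L: module K L
  for K :: "('k, 'm) ring_scheme" and A :: "('k, 'a, 'n) module_scheme"
    and L :: "('k, 'l, 'p) module_scheme"
begin

abbreviation (input) "S \<equiv> carrier A \<times> carrier L"
abbreviation (input) "F \<equiv> free_space K S"
abbreviation T where "T \<equiv> tensor K A L"
abbreviation tn where "tn a l \<equiv> tens K A L a l"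

sublocale F: module K F by (rule free_space_module) (rule A.R.is_cring)

lemma gen_closed: "\<lbrakk>a \<in> carrier A; l \<in> carrier L\<rbrakk> \<Longrightarrow> free_gen K S (a, l) \<in> carrier F"
  by (intro free_gen_closed A.R.is_cring) auto

lemma tensor_rels_closed: "tensor_rels K A L \<subseteq> carrier F"
  unfolding tensor_rels_def Let_def by (auto intro!: F.minus_closed F.add.m_closed F.smult_closed gen_closed)

sublocale N: quotient_module K "tensor_null K A L" F
  by (rule quotient_module.intro) (unfold tensor_null_def, rule F.span_is_submodule[OF tensor_rels_closed])

lemma tensor_module: "module K T"
  unfolding tensor_def by (rule N.quot_module)

sublocale T: module K T by (rule tensor_module)

lemma tens_closed [simp, intro]: "\<lbrakk>a \<in> carrier A; l \<in> carrier L\<rbrakk> \<Longrightarrow> tn a l \<in> carrier T"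
  unfolding tens_def tensor_def using N.coset_hom by (rule module_hom_carrier) (rule gen_closed)

lemma rel_in_null: "x \<in> tensor_rels K A L \<Longrightarrow> x \<in> tensor_null K A L"
  unfolding tensor_null_def using F.in_own_span[OF tensor_rels_closed] by blast

text \<open>
  Each of the four laws of bilinearity holds because one of the four families of relations becomes
  zero in the quotient.
\<close>

lemma tens_add_left:
  assumes "a \<in> carrier A" "b \<in> carrier A" "l \<in> carrier L"
  shows "tn (a \<oplus>\<^bsub>A\<^esub> b) l = tn a l \<oplus>\<^bsub>T\<^esub> tn b l"
proof -
  have "tn (a \<oplus>\<^bsub>A\<^esub> b) l = N.coset (free_gen K S (a, l) \<oplus>\<^bsub>F\<^esub> free_gen K S (b, l))"
    unfolding tens_def
  proof (subst N.coset_eq_iff)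
    show "free_gen K S (a \<oplus>\<^bsub>A\<^esub> b, l) \<ominus>\<^bsub>F\<^esub> (free_gen K S (a, l) \<oplus>\<^bsub>F\<^esub> free_gen K S (b, l))
        \<in> tensor_null K A L"
      using assms by (intro rel_in_null) (auto simp: tensor_rels_def Let_def)
  qed (use assms in \<open>auto intro!: gen_closed F.add.m_closed\<close>)
  also have "\<dots> = tn a l \<oplus>\<^bsub>T\<^esub> tn b l"
    unfolding tens_def tensor_def
    using assms by (intro module_hom_add[OF N.coset_hom] gen_closed)
  finally show ?thesis .
qed

lemma tens_add_right:
  assumes "a \<in> carrier A" "l \<in> carrier L" "m \<in> carrier L"
  shows "tn a (l \<oplus>\<^bsub>L\<^esub> m) = tn a l \<oplus>\<^bsub>T\<^esub> tn a m"
proof -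
  have "tn a (l \<oplus>\<^bsub>L\<^esub> m) = N.coset (free_gen K S (a, l) \<oplus>\<^bsub>F\<^esub> free_gen K S (a, m))"
    unfolding tens_def
  proof (subst N.coset_eq_iff)
    show "free_gen K S (a, l \<oplus>\<^bsub>L\<^esub> m) \<ominus>\<^bsub>F\<^esub> (free_gen K S (a, l) \<oplus>\<^bsub>F\<^esub> free_gen K S (a, m))
        \<in> tensor_null K A L"
      using assms by (intro rel_in_null) (auto simp: tensor_rels_def Let_def)
  qed (use assms in \<open>auto intro!: gen_closed F.add.m_closed\<close>)
  also have "\<dots> = tn a l \<oplus>\<^bsub>T\<^esub> tn a m"
    unfolding tens_def tensor_def
    using assms by (intro module_hom_add[OF N.coset_hom] gen_closed)
  finally show ?thesis .
qed

lemma tens_smult_left: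
  assumes "k \<in> carrier K" "a \<in> carrier A" "l \<in> carrier L"
  shows "tn (k \<odot>\<^bsub>A\<^esub> a) l = k \<odot>\<^bsub>T\<^esub> tn a l"
proof -
  have "tn (k \<odot>\<^bsub>A\<^esub> a) l = N.coset (k \<odot>\<^bsub>F\<^esub> free_gen K S (a, l))"
    unfolding tens_def
  proof (subst N.coset_eq_iff)
    show "free_gen K S (k \<odot>\<^bsub>A\<^esub> a, l) \<ominus>\<^bsub>F\<^esub> k \<odot>\<^bsub>F\<^esub> free_gen K S (a, l) \<in> tensor_null K A L"
      using assms by (intro rel_in_null) (unfold tensor_rels_def Let_def, blast)
  qed (use assms in \<open>auto intro!: gen_closed F.smult_closed\<close>)
  also have "\<dots> = k \<odot>\<^bsub>T\<^esub> tn a l"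
    unfolding tens_def tensor_def
    using assms by (intro module_hom_smult[OF N.coset_hom] gen_closed)
  finally show ?thesis .
qed

lemma tens_smult_right:
  assumes "k \<in> carrier K" "a \<in> carrier A" "l \<in> carrier L"
  shows "tn a (k \<odot>\<^bsub>L\<^esub> l) = k \<odot>\<^bsub>T\<^esub> tn a l"
proof -
  have "tn a (k \<odot>\<^bsub>L\<^esub> l) = N.coset (k \<odot>\<^bsub>F\<^esub> free_gen K S (a, l))"
    unfolding tens_def
  proof (subst N.coset_eq_iff)
    show "free_gen K S (a, k \<odot>\<^bsub>L\<^esub> l) \<ominus>\<^bsub>F\<^esub> k \<odot>\<^bsub>F\<^esub> free_gen K S (a, l) \<in> tensor_null K A L"
      using assms by (intro rel_in_null) (unfold tensor_rels_def Let_def, blast)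
  qed (use assms in \<open>auto intro!: gen_closed F.smult_closed\<close>)
  also have "\<dots> = k \<odot>\<^bsub>T\<^esub> tn a l"
    unfolding tens_def tensor_def
    using assms by (intro module_hom_smult[OF N.coset_hom] gen_closed)
  finally show ?thesis .
qed

lemma tens_bilinear: "bilinear_map K A L T (tens K A L)"
  by (intro bilinear_mapI tens_closed tens_add_left tens_add_right tens_smult_left tens_smult_right)

lemma tens_hom:
  shows "a \<in> carrier A \<Longrightarrow> tens K A L a \<in> module_hom K L T"
    and "l \<in> carrier L \<Longrightarrow> (\<lambda>a. tn a l) \<in> module_hom K A T"
  using tens_bilinear by (simp_all add: bilinear_map_def)

context
  fixes M :: "('k, 'w, 'q) module_scheme" and g :: "'a \<Rightarrow> 'l \<Rightarrow> 'w"
  assumes M: "module K M" and g: "bilinear_map K A L M g"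
begin

abbreviation (input) "ext_g \<equiv> linear_ext K S M (\<lambda>p. g (fst p) (snd p))"

lemma ext_hom: "ext_g \<in> module_hom K F M"
  using bilinear_mapD(1)[OF g] by (intro linear_ext_hom M) auto

lemma ext_gen: "\<lbrakk>a \<in> carrier A; l \<in> carrier L\<rbrakk> \<Longrightarrow> ext_g (free_gen K S (a, l)) = g a l"
  using bilinear_mapD(1)[OF g] by (subst linear_ext_gen[OF M]) auto

text \<open>
  The kernel of the linear extension is a submodule, and it contains the relations because \<open>g\<close> is
  bilinear; hence it contains their span.
\<close>

lemma ext_null:
  assumes "x \<in> tensor_null K A L"
  shows "ext_g x = \<zero>\<^bsub>M\<^esub>"
proof -
  interpret M: module K M by (fact M)
  interpret h: mod_hom K F M ext_g
    by (intro mod_hom.intro mod_hom_axioms.intro ext_hom F.module_axioms M)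
  note gD = bilinear_mapD[OF g]
  have "tensor_rels K A L \<subseteq> h.ker"
    unfolding tensor_rels_def Let_def h.ker_def
    by (auto intro!: gen_closed F.add.m_closed F.smult_closed F.minus_closed
         simp: gen_closed ext_gen gD M.M.minus_other_side)
  then have "tensor_null K A L \<subseteq> h.ker"
    unfolding tensor_null_def by (rule F.span_is_subset[OF _ h.ker_is_submodule])
  with assms show ?thesis by (auto simp: h.ker_def)
qed

text \<open>
  The linear extension is constant on cosets, so the image that \<^const>\<open>the_elem\<close> is applied to is a
  singleton.
\<close>

lemma tensor_lift_coset:
  assumes f: "f \<in> carrier F"
  shows "tensor_lift K A L M g (N.coset f) = ext_g f"
proof -
  interpret h: mod_hom K F M ext_g
    by (intro mod_hom.intro mod_hom_axioms.intro ext_hom F.module_axioms M)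
  have "ext_g x = ext_g f" if "x \<in> N.coset f" for x
  proof -
    have x: "x \<in> carrier F" "x \<ominus>\<^bsub>F\<^esub> f \<in> tensor_null K A L"
      using that f N.mem_coset by blast+
    have "ext_g x \<ominus>\<^bsub>M\<^esub> ext_g f = \<zero>\<^bsub>M\<^esub>"
      using ext_null[OF x(2)] x(1) f by simp
    with x(1) f show ?thesis by simp
  qed
  then have "ext_g ` N.coset f = {ext_g f}" using N.W.a_rcos_self[OF f] by blast
  then show ?thesis unfolding tensor_lift_def linear_ext_def by simp
qed

lemma tensor_lift_tens [simp]:
  "\<lbrakk>a \<in> carrier A; l \<in> carrier L\<rbrakk> \<Longrightarrow> tensor_lift K A L M g (tn a l) = g a l"
  unfolding tens_def by (simp only: tensor_lift_coset gen_closed ext_gen)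

lemma tensor_lift_hom: "tensor_lift K A L M g \<in> module_hom K T M"
proof (rule module_homI)
  have ex: "\<exists>f\<in>carrier F. t = N.coset f" if "t \<in> carrier T" for t
    using that by (auto simp: tensor_def N.quot_carrier)
  fix t assume "t \<in> carrier T"
  then obtain f where f: "f \<in> carrier F" "t = N.coset f" using ex by blast
  then show "tensor_lift K A L M g t \<in> carrier M"
    by (simp only: tensor_lift_coset module_hom_carrier[OF ext_hom])
  {
    fix t' assume "t' \<in> carrier T"
    then obtain f' where f': "f' \<in> carrier F" "t' = N.coset f'" using ex by blast
    show "tensor_lift K A L M g (t \<oplus>\<^bsub>T\<^esub> t') = tensor_lift K A L M g t \<oplus>\<^bsub>M\<^esub> tensor_lift K A L M g t'"
      using f f' unfolding tensor_def
      by (simp only: module_hom_add[OF N.coset_hom, symmetric] tensor_lift_coset F.M.add.m_closed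
            module_hom_add[OF ext_hom])
  }
  fix k assume "k \<in> carrier K"
  with f show "tensor_lift K A L M g (k \<odot>\<^bsub>T\<^esub> t) = k \<odot>\<^bsub>M\<^esub> tensor_lift K A L M g t"
    unfolding tensor_def
    by (simp only: module_hom_smult[OF N.coset_hom, symmetric] tensor_lift_coset F.smult_closed
          module_hom_smult[OF ext_hom])
qed

end

text \<open>
  Every tensor is a finite sum of multiples of pure tensors: decompose a representative in the free
  space and project.
\<close>

lemma tensor_hom_eqI:
  assumes M: "module K M" and f: "f \<in> module_hom K T M" and g: "g \<in> module_hom K T M"
    and eq: "\<And>a l. \<lbrakk>a \<in> carrier A; l \<in> carrier L\<rbrakk> \<Longrightarrow> f (tn a l) = g (tn a l)"
    and t: "t \<in> carrier T"
  shows "f t = g t"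
proof -
  obtain x where x: "x \<in> carrier F" "t = N.coset x"
    using t by (auto simp: tensor_def N.quot_carrier)
  let ?supp = "{s \<in> S. x s \<noteq> \<zero>\<^bsub>K\<^esub>}"
  have xK: "x s \<in> carrier K" if "s \<in> ?supp" for s
    using that x(1) by (auto simp: free_space_def PiE_iff)
  have gen: "free_gen K S s \<in> carrier F" if "s \<in> ?supp" for s
    using that gen_closed by auto
  have "t = N.coset (\<Oplus>\<^bsub>F\<^esub>s\<in>?supp. x s \<odot>\<^bsub>F\<^esub> free_gen K S s)"
    using free_space_decomp[OF A.R.is_cring x(1)] x(2) by simp
  also have "\<dots> = (\<Oplus>\<^bsub>T\<^esub>s\<in>?supp. N.coset (x s \<odot>\<^bsub>F\<^esub> free_gen K S s))"
    unfolding tensor_def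
    by (rule module_hom_finsum[OF N.coset_hom F.module_axioms N.quot_module])
       (rule F.smult_closed[OF xK gen])
  also have "\<dots> = (\<Oplus>\<^bsub>T\<^esub>s\<in>?supp. x s \<odot>\<^bsub>T\<^esub> tn (fst s) (snd s))"
    using gen xK unfolding tensor_def tens_def
    by (intro F.finsum_cong' T.finsum_cong'[unfolded tensor_def])
       (auto simp: module_hom_smult[OF N.coset_hom]
          intro!: module.smult_closed[OF N.quot_module] module_hom_carrier[OF N.coset_hom])
  finally have t_eq: "t = (\<Oplus>\<^bsub>T\<^esub>s\<in>?supp. x s \<odot>\<^bsub>T\<^esub> tn (fst s) (snd s))" .
  have fT: "h t = (\<Oplus>\<^bsub>M\<^esub>s\<in>?supp. x s \<odot>\<^bsub>M\<^esub> h (tn (fst s) (snd s)))" if h: "h \<in> module_hom K T M" for h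
  proof -
    have "h t = (\<Oplus>\<^bsub>M\<^esub>s\<in>?supp. h (x s \<odot>\<^bsub>T\<^esub> tn (fst s) (snd s)))"
      unfolding t_eq using xK by (intro module_hom_finsum[OF h T.module_axioms M]) auto
    also have "\<dots> = (\<Oplus>\<^bsub>M\<^esub>s\<in>?supp. x s \<odot>\<^bsub>M\<^esub> h (tn (fst s) (snd s)))"
    proof -
      interpret M: module K M by (fact M)
      show ?thesis using xK
        by (intro M.finsum_cong') (auto simp: module_hom_smult[OF h] module_hom_carrier[OF h])
    qed
    finally show ?thesis .
  qed
  interpret M: module K M by (fact M)
  show ?thesis unfolding fT[OF f] fT[OF g] using xK eq
    by (intro M.finsum_cong') (auto simp: module_hom_carrier[OF g])
qed

end

subsection \<open>Extension of scalars\<close>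

locale algebra_tensor = tensor_product K A L + Alg: algebra K A
  for K :: "('k, 'm) ring_scheme" and A :: "('k, 'a, 'n) module_scheme"
    and L :: "('k, 'l, 'p) module_scheme"
begin

abbreviation TM where "TM \<equiv> tensor_mod K A L"

lemma tensor_mod_simps [simp]:
  "carrier TM = carrier T" "add TM = add T" "\<zero>\<^bsub>TM\<^esub> = \<zero>\<^bsub>T\<^esub>"
  by (simp_all add: tensor_mod_def)

lemma mult_smult_right:
  assumes "k \<in> carrier K" "a \<in> carrier A" "b \<in> carrier A"
  shows "a \<otimes>\<^bsub>A\<^esub> (k \<odot>\<^bsub>A\<^esub> b) = k \<odot>\<^bsub>A\<^esub> (a \<otimes>\<^bsub>A\<^esub> b)"
  using assms Alg.smult_assoc2[of k b a] by (simp add: Alg.m_comm)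

lemma mult_tens_bilinear: "a \<in> carrier A \<Longrightarrow> bilinear_map K A L T (\<lambda>b l. tn (a \<otimes>\<^bsub>A\<^esub> b) l)"
  by (rule bilinear_mapI)
     (auto simp: Alg.r_distr tens_add_left tens_add_right tens_smult_left tens_smult_right
        mult_smult_right)

lemma scal_def: "a \<odot>\<^bsub>TM\<^esub> t = tensor_lift K A L T (\<lambda>b l. tn (a \<otimes>\<^bsub>A\<^esub> b) l) t"
  by (simp add: tensor_mod_def)

lemma scal_hom: "a \<in> carrier A \<Longrightarrow> (\<lambda>t. a \<odot>\<^bsub>TM\<^esub> t) \<in> module_hom K T T"
  unfolding scal_def by (intro tensor_lift_hom mult_tens_bilinear tensor_module)

lemma scal_tens [simp]:
  "\<lbrakk>a \<in> carrier A; b \<in> carrier A; l \<in> carrier L\<rbrakk> \<Longrightarrow> a \<odot>\<^bsub>TM\<^esub> tn b l = tn (a \<otimes>\<^bsub>A\<^esub> b) l"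
  unfolding scal_def by (intro tensor_lift_tens mult_tens_bilinear tensor_module)

lemma scal_closed [simp, intro]: "\<lbrakk>a \<in> carrier A; t \<in> carrier T\<rbrakk> \<Longrightarrow> a \<odot>\<^bsub>TM\<^esub> t \<in> carrier T"
  by (rule module_hom_carrier[OF scal_hom])

lemma scal_add_left:
  assumes "a \<in> carrier A" "b \<in> carrier A" "t \<in> carrier T"
  shows "(a \<oplus>\<^bsub>A\<^esub> b) \<odot>\<^bsub>TM\<^esub> t = a \<odot>\<^bsub>TM\<^esub> t \<oplus>\<^bsub>T\<^esub> b \<odot>\<^bsub>TM\<^esub> t"
  using assms(3)
  by (rule tensor_hom_eqI[OF tensor_module, rotated -1])
     (use assms in \<open>auto intro!: scal_hom module_hom_plus tensor_module simp: Alg.l_distr tens_add_left\<close>)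

lemma scal_smult_left:
  assumes "k \<in> carrier K" "a \<in> carrier A" "t \<in> carrier T"
  shows "(k \<odot>\<^bsub>A\<^esub> a) \<odot>\<^bsub>TM\<^esub> t = k \<odot>\<^bsub>T\<^esub> (a \<odot>\<^bsub>TM\<^esub> t)"
  using assms(3)
  by (rule tensor_hom_eqI[OF tensor_module, rotated -1])
     (use assms in \<open>auto intro!: scal_hom module_hom_smult_fun tensor_module
        simp: Alg.smult_assoc2 tens_smult_left\<close>)

lemma scal_one [simp]: "t \<in> carrier T \<Longrightarrow> \<one>\<^bsub>A\<^esub> \<odot>\<^bsub>TM\<^esub> t = t"
  by (rule tensor_hom_eqI[OF tensor_module, rotated -1])
     (auto intro!: scal_hom intro: module_homI)

text \<open>
  The inner lift has to be evaluated first: the bilinearity that the outer lift requires is that of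
  the values of the inner one.
\<close>

lemma bilinear_ext_tens:
  assumes Q: "bilinear_map K L L T Q"
    and a: "a \<in> carrier A" "x \<in> carrier L" and b: "b \<in> carrier A" "y \<in> carrier L"
  shows "bilinear_ext K A L Q (tn a x) (tn b y) = (a \<otimes>\<^bsub>A\<^esub> b) \<odot>\<^bsub>TM\<^esub> Q x y"
proof -
  note FD = bilinear_mapD[OF Q]
  have inner: "tensor_lift K A L T (\<lambda>b y. (a \<otimes>\<^bsub>A\<^esub> b) \<odot>\<^bsub>TM\<^esub> Q x y) (tn b y)
      = (a \<otimes>\<^bsub>A\<^esub> b) \<odot>\<^bsub>TM\<^esub> Q x y" if "a \<in> carrier A" "x \<in> carrier L" for a x
  proof (rule tensor_lift_tens[OF tensor_module _ b])
    show "bilinear_map K A L T (\<lambda>b y. (a \<otimes>\<^bsub>A\<^esub> b) \<odot>\<^bsub>TM\<^esub> Q x y)"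
      using that
      by (intro bilinear_mapI)
         (auto simp: FD Alg.r_distr scal_add_left module_hom_add[OF scal_hom]
            module_hom_smult[OF scal_hom] scal_smult_left mult_smult_right)
  qed
  let ?g = "\<lambda>a x. tensor_lift K A L T (\<lambda>b y. (a \<otimes>\<^bsub>A\<^esub> b) \<odot>\<^bsub>TM\<^esub> Q x y) (tn b y)"
  have "bilinear_map K A L T ?g"
    by (intro bilinear_mapI)
       (use b in \<open>auto simp: inner FD Alg.l_distr scal_add_left module_hom_add[OF scal_hom]
          module_hom_smult[OF scal_hom] scal_smult_left Alg.smult_assoc2\<close>)
  then show ?thesis
    unfolding bilinear_ext_def by (subst tensor_lift_tens[OF tensor_module _ a]) (auto simp: inner a)
qed

text \<open>
  With a coordinate functional in place of an augmentation, \<^const>\<open>aug_tensor\<close> reads off a coordinate of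
  a tensor.
\<close>

context
  fixes \<zeta> assumes \<zeta>: "\<zeta> \<in> module_hom K A (scalars K)"
begin

lemma functional_bilinear: "bilinear_map K A L L (\<lambda>a l. \<zeta> a \<odot>\<^bsub>L\<^esub> l)"
  using module_hom_carrier[OF \<zeta>] module_hom_add[OF \<zeta>] module_hom_smult[OF \<zeta>]
  by (intro bilinear_mapI)
     (auto simp: L.smult_l_distr L.smult_r_distr L.smult_assoc1[symmetric] A.R.m_comm)

lemma aug_tensor_hom: "aug_tensor K A L \<zeta> \<in> module_hom K T L"
  unfolding aug_tensor_def by (intro tensor_lift_hom functional_bilinear L.module_axioms)

lemma aug_tensor_tens [simp]:
  "\<lbrakk>a \<in> carrier A; l \<in> carrier L\<rbrakk> \<Longrightarrow> aug_tensor K A L \<zeta> (tn a l) = \<zeta> a \<odot>\<^bsub>L\<^esub> l"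
  unfolding aug_tensor_def by (intro tensor_lift_tens functional_bilinear L.module_axioms)

end

context
  fixes \<alpha> assumes \<alpha>: "\<alpha> \<in> module_hom K L L"
begin

lemma tens_twist_bilinear: "bilinear_map K A L T (\<lambda>a l. tn a (\<alpha> l))"
  using module_hom_carrier[OF \<alpha>] module_hom_add[OF \<alpha>] module_hom_smult[OF \<alpha>]
  by (intro bilinear_mapI) (auto simp: tens_add_left tens_add_right tens_smult_left tens_smult_right)

lemma id_tensor_hom: "id_tensor K A L \<alpha> \<in> module_hom K T T"
  unfolding id_tensor_def by (intro tensor_lift_hom tens_twist_bilinear tensor_module)

lemma id_tensor_tens [simp]:
  "\<lbrakk>a \<in> carrier A; l \<in> carrier L\<rbrakk> \<Longrightarrow> id_tensor K A L \<alpha> (tn a l) = tn a (\<alpha> l)"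
  unfolding id_tensor_def by (intro tensor_lift_tens tens_twist_bilinear tensor_module)

lemma aug_tensor_id_tensor:
  assumes \<zeta>: "\<zeta> \<in> module_hom K A (scalars K)" and t: "t \<in> carrier T"
  shows "aug_tensor K A L \<zeta> (id_tensor K A L \<alpha> t) = \<alpha> (aug_tensor K A L \<zeta> t)"
  using t
  by (rule tensor_hom_eqI[OF L.module_axioms, rotated -1])
     (auto intro!: module_hom_comp[OF id_tensor_hom] module_hom_comp[OF _ \<alpha>] aug_tensor_hom[OF \<zeta>]
        simp: aug_tensor_tens[OF \<zeta>] module_hom_carrier[OF \<alpha>] module_hom_smult[OF \<alpha>]
          module_hom_carrier[OF \<zeta>, simplified])

end

end

section \<open>Coordinates over an infinitesimal base\<close>

text \<open>
  Over an augmented algebra \<open>A\<close> with \<open>\<mm>\<^sup>2 = 0\<close>, a basis \<open>B\<close> of the augmentation ideal and the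
  functionals \<open>\<xi> b\<close> reading off its coordinates.
\<close>

locale infinitesimal_tensor = algebra_tensor K A L
  for K :: "('k, 'm) ring_scheme" and A :: "('k, 'a, 'n) module_scheme"
    and L :: "('k, 'l, 'p) module_scheme" +
  fixes \<epsilon> :: "'a \<Rightarrow> 'k" and B :: "'a set" and \<xi> :: "'a \<Rightarrow> 'a \<Rightarrow> 'k"
  assumes aug: "\<epsilon> \<in> alg_hom K A (scalars K)"
    and inf: "infinitesimal_base K A \<epsilon>"
    and finite_B [simp]: "finite B"
    and B_ideal: "B \<subseteq> aug_ideal K A \<epsilon>"
    and xi_hom: "b \<in> B \<Longrightarrow> \<xi> b \<in> module_hom K A (scalars K)"
    and xi_one [simp]: "b \<in> B \<Longrightarrow> \<xi> b \<one>\<^bsub>A\<^esub> = \<zero>\<^bsub>K\<^esub>"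
    and xi_B: "\<lbrakk>b \<in> B; c \<in> B\<rbrakk> \<Longrightarrow> \<xi> b c = (if c = b then \<one>\<^bsub>K\<^esub> else \<zero>\<^bsub>K\<^esub>)"
    and decomp: "a \<in> carrier A \<Longrightarrow>
      a = \<epsilon> a \<odot>\<^bsub>A\<^esub> \<one>\<^bsub>A\<^esub> \<oplus>\<^bsub>A\<^esub> (\<Oplus>\<^bsub>A\<^esub>b\<in>B. \<xi> b a \<odot>\<^bsub>A\<^esub> b)"
begin

abbreviation E where "E \<equiv> aug_tensor K A L \<epsilon>"
abbreviation Xi where "Xi b \<equiv> aug_tensor K A L (\<xi> b)"

lemma eps_hom: "\<epsilon> \<in> module_hom K A (scalars K)"
  using aug by (auto simp: alg_hom_def)

lemma eps_simps [simp]: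
  "a \<in> carrier A \<Longrightarrow> \<epsilon> a \<in> carrier K"
  "\<lbrakk>a \<in> carrier A; b \<in> carrier A\<rbrakk> \<Longrightarrow> \<epsilon> (a \<otimes>\<^bsub>A\<^esub> b) = \<epsilon> a \<otimes>\<^bsub>K\<^esub> \<epsilon> b"
  "\<epsilon> \<one>\<^bsub>A\<^esub> = \<one>\<^bsub>K\<^esub>"
  using aug by (auto simp: alg_hom_def ring_hom_def)

lemma ideal_iff: "a \<in> aug_ideal K A \<epsilon> \<longleftrightarrow> a \<in> carrier A \<and> \<epsilon> a = \<zero>\<^bsub>K\<^esub>"
  by (auto simp: aug_ideal_def a_kernel_def')

lemma B_simps [simp]: "b \<in> B \<Longrightarrow> b \<in> carrier A" "b \<in> B \<Longrightarrow> \<epsilon> b = \<zero>\<^bsub>K\<^esub>"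
  using B_ideal ideal_iff by auto

lemma xi_closed [simp]: "\<lbrakk>b \<in> B; a \<in> carrier A\<rbrakk> \<Longrightarrow> \<xi> b a \<in> carrier K"
  using module_hom_carrier[OF xi_hom] by auto

lemmas E_hom = aug_tensor_hom[OF eps_hom]
lemmas Xi_hom = aug_tensor_hom[OF xi_hom]

lemma E_simps [simp]:
  "t \<in> carrier T \<Longrightarrow> E t \<in> carrier L"
  "\<lbrakk>s \<in> carrier T; t \<in> carrier T\<rbrakk> \<Longrightarrow> E (s \<oplus>\<^bsub>T\<^esub> t) = E s \<oplus>\<^bsub>L\<^esub> E t"
  "\<lbrakk>k \<in> carrier K; t \<in> carrier T\<rbrakk> \<Longrightarrow> E (k \<odot>\<^bsub>T\<^esub> t) = k \<odot>\<^bsub>L\<^esub> E t"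
  "\<lbrakk>a \<in> carrier A; l \<in> carrier L\<rbrakk> \<Longrightarrow> E (tn a l) = \<epsilon> a \<odot>\<^bsub>L\<^esub> l"
  using module_hom_carrier[OF E_hom] module_hom_add[OF E_hom] module_hom_smult[OF E_hom]
  by (auto simp: aug_tensor_tens[OF eps_hom])

lemma Xi_simps [simp]:
  assumes "b \<in> B"
  shows "t \<in> carrier T \<Longrightarrow> Xi b t \<in> carrier L"
    and "\<lbrakk>s \<in> carrier T; t \<in> carrier T\<rbrakk> \<Longrightarrow> Xi b (s \<oplus>\<^bsub>T\<^esub> t) = Xi b s \<oplus>\<^bsub>L\<^esub> Xi b t"
    and "\<lbrakk>k \<in> carrier K; t \<in> carrier T\<rbrakk> \<Longrightarrow> Xi b (k \<odot>\<^bsub>T\<^esub> t) = k \<odot>\<^bsub>L\<^esub> Xi b t"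
    and "\<lbrakk>a \<in> carrier A; l \<in> carrier L\<rbrakk> \<Longrightarrow> Xi b (tn a l) = \<xi> b a \<odot>\<^bsub>L\<^esub> l"
  using module_hom_carrier[OF Xi_hom[OF assms]] module_hom_add[OF Xi_hom[OF assms]]
    module_hom_smult[OF Xi_hom[OF assms]]
  by (auto simp: aug_tensor_tens[OF xi_hom[OF assms]])

text \<open>
  \<open>\<xi> b\<close> is a derivation along \<open>\<epsilon>\<close>. Put \<open>n(a) = a - \<epsilon>(a) 1 \<in> \<mm>\<close>. Then \<open>a c = \<epsilon>(a) c + n(a) c\<close>, where
  \<open>n(a) c = \<epsilon>(c) n(a)\<close> because \<open>n(a) n(c) = 0\<close>, and \<open>\<xi> b (n(a)) = \<xi> b a\<close> because \<open>\<xi> b\<close> vanishes at \<open>1\<close>.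
\<close>

lemma xi_mult:
  assumes b: "b \<in> B" and a: "a \<in> carrier A" and c: "c \<in> carrier A"
  shows "\<xi> b (a \<otimes>\<^bsub>A\<^esub> c) = \<epsilon> a \<otimes>\<^bsub>K\<^esub> \<xi> b c \<oplus>\<^bsub>K\<^esub> \<epsilon> c \<otimes>\<^bsub>K\<^esub> \<xi> b a"
proof -
  define n where "n a = a \<ominus>\<^bsub>A\<^esub> \<epsilon> a \<odot>\<^bsub>A\<^esub> \<one>\<^bsub>A\<^esub>" for a
  interpret sc: module K "scalars K" by (rule scalars_module[OF A.R.is_cring])
  interpret h: mod_hom K A "scalars K" "\<xi> b"
    by (intro mod_hom.intro mod_hom_axioms.intro xi_hom b A.module_axioms sc.module_axioms)
  interpret e: mod_hom K A "scalars K" \<epsilon>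
    by (intro mod_hom.intro mod_hom_axioms.intro eps_hom b A.module_axioms sc.module_axioms)
  have split: "a = \<epsilon> a \<odot>\<^bsub>A\<^esub> \<one>\<^bsub>A\<^esub> \<oplus>\<^bsub>A\<^esub> n a" and n: "n a \<in> carrier A" if "a \<in> carrier A" for a
    using that by (simp_all add: n_def a_minus_def A.M.a_comm A.M.r_neg1 A.M.a_assoc A.M.l_neg A.M.r_neg A.M.a_lcomm[of _ a])
  have xi_n: "\<xi> b (n a) = \<xi> b a" if "a \<in> carrier A" for a
    using that b h.f_smult[of "\<epsilon> a" "\<one>\<^bsub>A\<^esub>"]
    by (subst (2) split[OF that], subst h.f_add) (auto simp: n)
  have eps_n: "\<epsilon> (n a) = \<zero>\<^bsub>K\<^esub>" if "a \<in> carrier A" for a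
  proof -
    have "\<epsilon> a = \<epsilon> a \<otimes>\<^bsub>K\<^esub> \<one>\<^bsub>K\<^esub> \<oplus>\<^bsub>K\<^esub> \<epsilon> (n a)"
      using that e.f_smult[of "\<epsilon> a" "\<one>\<^bsub>A\<^esub>"]
      by (subst split[OF that], subst e.f_add) (auto simp: n)
    then show ?thesis using that n by simp
  qed
  have nn: "n a \<otimes>\<^bsub>A\<^esub> n c = \<zero>\<^bsub>A\<^esub>"
    using inf eps_n n a c by (auto simp: infinitesimal_base_def ideal_iff)
  have "a \<otimes>\<^bsub>A\<^esub> c = \<epsilon> a \<odot>\<^bsub>A\<^esub> c \<oplus>\<^bsub>A\<^esub> n a \<otimes>\<^bsub>A\<^esub> c"
    by (subst split[OF a]) (use a c n in \<open>simp add: Alg.l_distr Alg.smult_assoc2\<close>)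
  also have "n a \<otimes>\<^bsub>A\<^esub> c = \<epsilon> c \<odot>\<^bsub>A\<^esub> n a"
    by (subst split[OF c])
      (use a c n nn Alg.smult_assoc2[of "\<epsilon> c" "\<one>\<^bsub>A\<^esub>" "n a"] in
        \<open>simp add: Alg.r_distr Alg.m_comm[of "n a" "\<epsilon> c \<odot>\<^bsub>A\<^esub> \<one>\<^bsub>A\<^esub>"]\<close>)
  finally have "\<xi> b (a \<otimes>\<^bsub>A\<^esub> c) = \<xi> b (\<epsilon> a \<odot>\<^bsub>A\<^esub> c) \<oplus>\<^bsub>K\<^esub> \<xi> b (\<epsilon> c \<odot>\<^bsub>A\<^esub> n a)"
    using a c n by simp
  then show ?thesis using a c n by (simp add: xi_n)
qed

lemma scal_coords:
  assumes a: "a \<in> carrier A" and t: "t \<in> carrier T"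
  shows "E (a \<odot>\<^bsub>TM\<^esub> t) = \<epsilon> a \<odot>\<^bsub>L\<^esub> E t"
    and "b \<in> B \<Longrightarrow> Xi b (a \<odot>\<^bsub>TM\<^esub> t) = \<epsilon> a \<odot>\<^bsub>L\<^esub> Xi b t \<oplus>\<^bsub>L\<^esub> \<xi> b a \<odot>\<^bsub>L\<^esub> E t"
proof -
  show "E (a \<odot>\<^bsub>TM\<^esub> t) = \<epsilon> a \<odot>\<^bsub>L\<^esub> E t"
    using t
    by (rule tensor_hom_eqI[OF L.module_axioms, rotated -1])
       (use a in \<open>auto intro!: module_hom_comp[OF scal_hom E_hom] module_hom_smult_fun E_hom L.module_axioms
          simp: L.smult_assoc1\<close>)
  assume b: "b \<in> B"
  show "Xi b (a \<odot>\<^bsub>TM\<^esub> t) = \<epsilon> a \<odot>\<^bsub>L\<^esub> Xi b t \<oplus>\<^bsub>L\<^esub> \<xi> b a \<odot>\<^bsub>L\<^esub> E t"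
    using t
    by (rule tensor_hom_eqI[OF L.module_axioms, rotated -1])
       (use a b in \<open>auto intro!: module_hom_comp[OF scal_hom Xi_hom] module_hom_plus module_hom_smult_fun
          E_hom Xi_hom L.module_axioms
          simp: L.smult_assoc1[symmetric] L.smult_l_distr[symmetric] xi_mult A.R.m_comm\<close>)
qed

definition of_coords where "of_coords u v = tn \<one>\<^bsub>A\<^esub> u \<oplus>\<^bsub>T\<^esub> (\<Oplus>\<^bsub>T\<^esub>b\<in>B. tn b (v b))"

lemma of_coords_closed [simp]:
  assumes "u \<in> carrier L" "\<And>b. b \<in> B \<Longrightarrow> v b \<in> carrier L"
  shows "of_coords u v \<in> carrier T"
  unfolding of_coords_def using assms by (intro T.M.add.m_closed T.finsum_closed) auto

lemma coords_of_coords [simp]: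
  assumes u: "u \<in> carrier L" and v: "\<And>b. b \<in> B \<Longrightarrow> v b \<in> carrier L"
  shows "E (of_coords u v) = u" and "b \<in> B \<Longrightarrow> Xi b (of_coords u v) = v b"
proof -
  have cl: "(\<Oplus>\<^bsub>T\<^esub>b\<in>B. tn b (v b)) \<in> carrier T" using v by (intro T.finsum_closed) auto
  have "E (\<Oplus>\<^bsub>T\<^esub>b\<in>B. tn b (v b)) = (\<Oplus>\<^bsub>L\<^esub>b\<in>B. E (tn b (v b)))"
    using v by (intro module_hom_finsum[OF E_hom tensor_module L.module_axioms]) auto
  also have "\<dots> = (\<Oplus>\<^bsub>L\<^esub>b\<in>B. \<zero>\<^bsub>L\<^esub>)" using v by (intro L.finsum_cong') auto
  finally show "E (of_coords u v) = u" using u cl by (simp add: of_coords_def)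
  assume b: "b \<in> B"
  have "Xi b (\<Oplus>\<^bsub>T\<^esub>c\<in>B. tn c (v c)) = (\<Oplus>\<^bsub>L\<^esub>c\<in>B. Xi b (tn c (v c)))"
    using v b by (intro module_hom_finsum[OF Xi_hom tensor_module L.module_axioms]) auto
  also have "\<dots> = (\<Oplus>\<^bsub>L\<^esub>c\<in>B. if c = b then v c else \<zero>\<^bsub>L\<^esub>)"
    using v b by (intro L.finsum_cong') (auto simp: xi_B)
  also have "\<dots> = v b" using v b by (subst L.add.finprod_singleton_swap) auto
  finally show "Xi b (of_coords u v) = v b" using u v b cl by (simp add: of_coords_def)
qed

text \<open>
  Both sides are linear in \<open>t\<close>, and for \<open>t = a \<otimes> l\<close> the equation is the expansion of \<open>a\<close> in \<open>1\<close> and \<open>B\<close>.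
\<close>

lemma of_coords_coords:
  assumes t: "t \<in> carrier T"
  shows "of_coords (E t) (\<lambda>b. Xi b t) = t"
  unfolding of_coords_def using t
proof (rule tensor_hom_eqI[OF tensor_module, rotated -1])
  show "(\<lambda>t. tn \<one>\<^bsub>A\<^esub> (E t) \<oplus>\<^bsub>T\<^esub> (\<Oplus>\<^bsub>T\<^esub>b\<in>B. tn b (Xi b t))) \<in> module_hom K T T"
    by (intro module_hom_plus module_hom_sum tensor_module module_hom_comp[OF E_hom tens_hom(1)]
          module_hom_comp[OF Xi_hom tens_hom(1)]) auto
  show "(\<lambda>t. t) \<in> module_hom K T T" by (auto intro: module_homI)
  fix a l assume al: "a \<in> carrier A" "l \<in> carrier L"
  note tl = tens_hom(2)[OF al(2)]
  have sum_cl: "(\<Oplus>\<^bsub>A\<^esub>b\<in>B. \<xi> b a \<odot>\<^bsub>A\<^esub> b) \<in> carrier A"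
    using al by (intro A.finsum_closed) auto
  have "(\<Oplus>\<^bsub>T\<^esub>b\<in>B. tn b (Xi b (tn a l))) = (\<Oplus>\<^bsub>T\<^esub>b\<in>B. tn (\<xi> b a \<odot>\<^bsub>A\<^esub> b) l)"
    using al by (intro T.finsum_cong') (auto simp: tens_smult_left tens_smult_right)
  also have "\<dots> = tn (\<Oplus>\<^bsub>A\<^esub>b\<in>B. \<xi> b a \<odot>\<^bsub>A\<^esub> b) l"
    using al by (intro module_hom_finsum[OF tl A.module_axioms tensor_module, symmetric]) auto
  finally have "tn \<one>\<^bsub>A\<^esub> (E (tn a l)) \<oplus>\<^bsub>T\<^esub> (\<Oplus>\<^bsub>T\<^esub>b\<in>B. tn b (Xi b (tn a l)))
      = tn (\<epsilon> a \<odot>\<^bsub>A\<^esub> \<one>\<^bsub>A\<^esub> \<oplus>\<^bsub>A\<^esub> (\<Oplus>\<^bsub>A\<^esub>b\<in>B. \<xi> b a \<odot>\<^bsub>A\<^esub> b)) l"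
    using al sum_cl by (simp add: tens_add_left tens_smult_left tens_smult_right)
  then show "tn \<one>\<^bsub>A\<^esub> (E (tn a l)) \<oplus>\<^bsub>T\<^esub> (\<Oplus>\<^bsub>T\<^esub>b\<in>B. tn b (Xi b (tn a l))) = tn a l"
    using decomp[OF al(1)] by simp
qed

lemma coords_eqI:
  assumes s: "s \<in> carrier T" and t: "t \<in> carrier T"
    and E: "E s = E t" and Xi: "\<And>b. b \<in> B \<Longrightarrow> Xi b s = Xi b t"
  shows "s = t"
proof -
  have "of_coords (E s) (\<lambda>b. Xi b s) = of_coords (E t) (\<lambda>b. Xi b t)"
    unfolding of_coords_def E using Xi t by (intro arg_cong2[of _ _ _ _ "add T"] refl T.finsum_cong') auto
  then show ?thesis by (simp only: of_coords_coords s t)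
qed

end

text \<open>
  The coefficients in a linear combination of \<open>B\<close> depend linearly on the vector because they are unique.
\<close>

lemma (in vectorspace) basis_coordinates:
  assumes fin: "finite B" and basis: "basis B"
  obtains \<xi> where "\<And>b. b \<in> B \<Longrightarrow> \<xi> b \<in> module_hom K V (scalars K)"
    and "\<And>b c. \<lbrakk>b \<in> B; c \<in> B\<rbrakk> \<Longrightarrow> \<xi> b c = (if c = b then \<one>\<^bsub>K\<^esub> else \<zero>\<^bsub>K\<^esub>)"
    and "\<And>v. v \<in> carrier V \<Longrightarrow> v = (\<Oplus>\<^bsub>V\<^esub>b\<in>B. \<xi> b v \<odot>\<^bsub>V\<^esub> b)"
proof -
  have BV: "B \<subseteq> carrier V" using basis by (simp add: basis_def)
  have ex1: "\<exists>!a. a \<in> B \<rightarrow>\<^sub>E carrier K \<and> lincomb a B = v" if "v \<in> carrier V" for v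
    using basis_criterion[OF fin BV] basis that by blast
  define co where "co v = (THE a. a \<in> B \<rightarrow>\<^sub>E carrier K \<and> lincomb a B = v)" for v
  have co: "co v \<in> B \<rightarrow>\<^sub>E carrier K" "lincomb (co v) B = v" if "v \<in> carrier V" for v
    using theI'[OF ex1[OF that]] by (simp_all add: co_def)
  have co_unique: "co v b = a b" if "a \<in> B \<rightarrow> carrier K" "lincomb a B = v" "v \<in> carrier V" "b \<in> B" for a v b
  proof -
    have "lincomb (restrict a B) B = v"
      using that(1,2) BV by (subst lincomb_cong[OF refl BV, of _ a]) auto
    then have "co v = restrict a B"
      using ex1[OF that(3)] co[OF that(3)] that(1) by (auto simp: restrict_PiE_iff)
    then show ?thesis using that(4) by simp
  qed
  have coK: "co v b \<in> carrier K" if "v \<in> carrier V" "b \<in> B" for v b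
    using co(1)[OF that(1)] that(2) by auto
  show ?thesis
  proof (rule that[of "\<lambda>b v. co v b"])
    fix b assume b: "b \<in> B"
    show "(\<lambda>v. co v b) \<in> module_hom K V (scalars K)"
    proof (rule module_homI)
      fix v w assume vw: "v \<in> carrier V" "w \<in> carrier V"
      show "co (v \<oplus>\<^bsub>V\<^esub> w) b = co v b \<oplus>\<^bsub>scalars K\<^esub> co w b"
        using vw b coK co
        by (subst co_unique[of "\<lambda>b. co v b \<oplus>\<^bsub>K\<^esub> co w b"])
           (auto simp: lincomb_sum[OF fin BV] PiE_iff)
    next
      fix k v assume kv: "k \<in> carrier K" "v \<in> carrier V"
      show "co (k \<odot>\<^bsub>V\<^esub> v) b = k \<odot>\<^bsub>scalars K\<^esub> co v b"
        using kv b coK co BV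
        by (subst co_unique[of "\<lambda>b. k \<otimes>\<^bsub>K\<^esub> co v b"]) (auto simp: lincomb_smult PiE_iff)
    qed (use coK b in auto)
    fix c assume c: "c \<in> B"
    have "lincomb (\<lambda>b. if c = b then \<one>\<^bsub>K\<^esub> else \<zero>\<^bsub>K\<^esub>) B = (\<Oplus>\<^bsub>V\<^esub>b\<in>B. if b = c then b else \<zero>\<^bsub>V\<^esub>)"
      unfolding lincomb_def using BV by (intro M.finsum_cong') auto
    also have "\<dots> = c" using c fin BV by (subst M.add.finprod_singleton_swap) auto
    finally show "co c b = (if c = b then \<one>\<^bsub>K\<^esub> else \<zero>\<^bsub>K\<^esub>)"
      using b c BV by (subst co_unique[of "\<lambda>b. if c = b then \<one>\<^bsub>K\<^esub> else \<zero>\<^bsub>K\<^esub>"]) auto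
  next
    fix v assume "v \<in> carrier V"
    then show "v = (\<Oplus>\<^bsub>V\<^esub>b\<in>B. co v b \<odot>\<^bsub>V\<^esub> b)"
      using co(2) by (simp add: lincomb_def)
  qed
qed

text \<open>
  The augmentation ideal is the image of the projection \<open>a \<mapsto> a - \<epsilon>(a) 1\<close>, hence finite-dimensional;
  composing its coordinates with this projection gives functionals vanishing at \<open>1\<close>.
\<close>

lemma infinitesimal_tensor_exists:
  assumes field: "field K" and aug: "augmented_algebra K A \<epsilon>" and inf: "infinitesimal_base K A \<epsilon>"
    and fin: "vectorspace.fin_dim K A" and L: "module K L"
  obtains B \<xi> where "infinitesimal_tensor K A L \<epsilon> B \<xi>"
proof -
  have alg: "algebra K A" and eps: "\<epsilon> \<in> alg_hom K A (scalars K)"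
    using aug by (auto simp: augmented_algebra_def)
  interpret algebra K A by (fact alg)
  interpret V: vectorspace K A by (intro vectorspace.intro module field)
  interpret sc: module K "scalars K" by (rule scalars_module[OF R.is_cring])
  have eps_hom: "\<epsilon> \<in> module_hom K A (scalars K)" using eps by (simp add: alg_hom_def)
  interpret e: mod_hom K A "scalars K" \<epsilon>
    by (intro mod_hom.intro mod_hom_axioms.intro eps_hom module sc.module_axioms)
  have eps1: "\<epsilon> \<one>\<^bsub>A\<^esub> = \<one>\<^bsub>K\<^esub>" using eps by (auto simp: alg_hom_def ring_hom_def)
  have epsK: "\<epsilon> a \<in> carrier K" if "a \<in> carrier A" for a using e.f_im[OF that] by simp
  define I where "I = aug_ideal K A \<epsilon>"
  have I: "a \<in> I \<longleftrightarrow> a \<in> carrier A \<and> \<epsilon> a = \<zero>\<^bsub>K\<^esub>" for a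
    by (auto simp: I_def aug_ideal_def a_kernel_def')
  have "I = e.ker" by (auto simp: I e.ker_def)
  then have subm: "submodule K I A" using e.ker_is_submodule by simp
  let ?AI = "A\<lparr>carrier := I\<rparr>"
  interpret W: vectorspace K "A\<lparr>carrier := I\<rparr>"
    by (intro V.subspace_is_vs) (simp add: subspace_def subm V.vectorspace_axioms)
  define p where "p a = a \<ominus>\<^bsub>A\<^esub> \<epsilon> a \<odot>\<^bsub>A\<^esub> \<one>\<^bsub>A\<^esub>" for a
  have minus_plus: "(a \<oplus>\<^bsub>A\<^esub> b) \<ominus>\<^bsub>A\<^esub> (c \<oplus>\<^bsub>A\<^esub> d) = (a \<ominus>\<^bsub>A\<^esub> c) \<oplus>\<^bsub>A\<^esub> (b \<ominus>\<^bsub>A\<^esub> d)"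
    if "a \<in> carrier A" "b \<in> carrier A" "c \<in> carrier A" "d \<in> carrier A" for a b c d
    using that by (simp add: a_minus_def M.minus_add M.a_ac)
  have pI: "p a \<in> I" if "a \<in> carrier A" for a
    using that epsK e.f_minus[of a "\<epsilon> a \<odot>\<^bsub>A\<^esub> \<one>\<^bsub>A\<^esub>"] sc.minus_other_side[of "\<epsilon> a" "\<epsilon> a"]
    by (simp add: I p_def eps1)
  have p_hom: "p \<in> module_hom K A ?AI"
  proof (rule module_homI)
    fix a b assume "a \<in> carrier A" "b \<in> carrier A"
    then show "p (a \<oplus>\<^bsub>A\<^esub> b) = p a \<oplus>\<^bsub>?AI\<^esub> p b"
      using epsK by (simp add: p_def smult_l_distr minus_plus)
  next
    fix k a assume "k \<in> carrier K" "a \<in> carrier A"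
    then show "p (k \<odot>\<^bsub>A\<^esub> a) = k \<odot>\<^bsub>?AI\<^esub> p a"
      using epsK by (simp add: p_def a_minus_def smult_r_distr smult_r_minus smult_assoc1)
  qed (use pI in auto)
  have p_id: "p a = a" if "a \<in> I" for a using that by (simp add: I p_def a_minus_def)
  interpret P: linear_map K A "A\<lparr>carrier := I\<rparr>" p
    by (intro linear_map.intro mod_hom.intro mod_hom_axioms.intro p_hom
          V.vectorspace_axioms W.vectorspace_axioms module W.module_axioms)
  have "p ` carrier A = carrier ?AI"
    using pI p_id by (auto simp: I image_iff) (metis I)
  then have "W.fin_dim" using P.rank_nullity_main(2)[OF fin] by simp
  then obtain B where B: "finite B" "W.basis B" using W.finite_basis_exists by blast
  have BI: "B \<subseteq> I" using B(2) by (simp add: W.basis_def)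
  obtain \<zeta> where z_hom: "\<And>b. b \<in> B \<Longrightarrow> \<zeta> b \<in> module_hom K ?AI (scalars K)"
    and z_B: "\<And>b c. \<lbrakk>b \<in> B; c \<in> B\<rbrakk> \<Longrightarrow> \<zeta> b c = (if c = b then \<one>\<^bsub>K\<^esub> else \<zero>\<^bsub>K\<^esub>)"
    and z_sum: "\<And>v. v \<in> carrier ?AI \<Longrightarrow> v = (\<Oplus>\<^bsub>?AI\<^esub>b\<in>B. \<zeta> b v \<odot>\<^bsub>?AI\<^esub> b)"
    by (rule W.basis_coordinates[OF B]) (rule that; assumption)
  define \<xi> where "\<xi> b a = \<zeta> b (p a)" for b a
  have xi_hom: "\<xi> b \<in> module_hom K A (scalars K)" if "b \<in> B" for b
    unfolding \<xi>_def by (rule module_hom_comp[OF p_hom z_hom[OF that]])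
  have "infinitesimal_tensor K A L \<epsilon> B \<xi>"
  proof (intro infinitesimal_tensor.intro algebra_tensor.intro tensor_product.intro
      infinitesimal_tensor_axioms.intro)
    fix b assume b: "b \<in> B"
    show "\<xi> b \<in> module_hom K A (scalars K)" by (rule xi_hom[OF b])
    have "p \<one>\<^bsub>A\<^esub> = \<zero>\<^bsub>A\<^esub>" by (simp add: p_def eps1)
    then show "\<xi> b \<one>\<^bsub>A\<^esub> = \<zero>\<^bsub>K\<^esub>"
      using module_hom_zero[OF z_hom[OF b] W.module_axioms sc.module_axioms] by (simp add: \<xi>_def)
    fix c assume "c \<in> B"
    then show "\<xi> b c = (if c = b then \<one>\<^bsub>K\<^esub> else \<zero>\<^bsub>K\<^esub>)"
      using b BI p_id[of c] z_B by (auto simp: \<xi>_def)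
  next
    fix a assume a: "a \<in> carrier A"
    have cl: "\<zeta> b (p a) \<odot>\<^bsub>A\<^esub> b \<in> I" if "b \<in> B" for b
      using that BI submodule.smult_closed[OF subm] module_hom_carrier[OF z_hom[OF that]] pI[OF a] by auto
    have "p a = (\<Oplus>\<^bsub>?AI\<^esub>b\<in>B. \<zeta> b (p a) \<odot>\<^bsub>A\<^esub> b)" using z_sum[of "p a"] pI[OF a] by simp
    also have "\<dots> = (\<Oplus>\<^bsub>A\<^esub>b\<in>B. \<xi> b a \<odot>\<^bsub>A\<^esub> b)"
      unfolding \<xi>_def using cl by (intro finsum_not_depend B BI subm) auto
    finally have "p a = (\<Oplus>\<^bsub>A\<^esub>b\<in>B. \<xi> b a \<odot>\<^bsub>A\<^esub> b)" .
    moreover have "a = \<epsilon> a \<odot>\<^bsub>A\<^esub> \<one>\<^bsub>A\<^esub> \<oplus>\<^bsub>A\<^esub> p a"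
      using a epsK by (simp add: p_def a_minus_def M.a_comm[of a] M.a_assoc[symmetric] M.r_neg)
    ultimately show "a = \<epsilon> a \<odot>\<^bsub>A\<^esub> \<one>\<^bsub>A\<^esub> \<oplus>\<^bsub>A\<^esub> (\<Oplus>\<^bsub>A\<^esub>b\<in>B. \<xi> b a \<odot>\<^bsub>A\<^esub> b)" by simp
  qed (use L alg eps inf B BI in \<open>auto simp: I_def intro: module\<close>)
  then show thesis by (rule that)
qed

section \<open>Deformations and cocycles\<close>

lemma (in abelian_group) eq_minus_iff:
  assumes "a \<in> carrier G" "b \<in> carrier G" "c \<in> carrier G"
  shows "a = b \<ominus> c \<longleftrightarrow> a \<oplus> c = b"
  using assms by (auto simp: a_minus_def a_assoc l_neg r_neg)

text \<open>
  The left-hand side has the shape of \<^const>\<open>delta2\<close>. Once the minus signs are gone, cocycle conditions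
  can be compared by associativity and commutativity alone.
\<close>

lemma (in abelian_group) delta2_sum_zero_iff:
  assumes "a \<in> carrier G" "b \<in> carrier G" "c \<in> carrier G" "d \<in> carrier G" "e \<in> carrier G" "f \<in> carrier G"
  shows "a \<oplus> b \<ominus> c \<ominus> d \<oplus> e \<oplus> f = \<zero> \<longleftrightarrow> a \<oplus> f \<oplus> (b \<oplus> e) = c \<oplus> d"
proof -
  have "a \<oplus> b \<ominus> c \<ominus> d \<oplus> e \<oplus> f = (a \<oplus> f \<oplus> (b \<oplus> e)) \<ominus> (c \<oplus> d)"
    using assms by (simp add: a_minus_def minus_add a_ac)
  then show ?thesis using assms by simp
qed

lemma restrict_eq_iff: "(\<lambda>s\<in>S. f s) = (\<lambda>s\<in>S. g s) \<longleftrightarrow> (\<forall>s\<in>S. f s = g s)"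
  by (auto simp: fun_eq_iff restrict_def)

subsection \<open>Cochains of a Hom-Leibniz algebra\<close>

context hom_leibniz_algebra
begin

lemmas br_simps [simp] = bilinear_mapD[OF br_bilinear]

lemma alpha_simps [simp]:
  "x \<in> carrier L \<Longrightarrow> \<alpha> x \<in> carrier L"
  "\<lbrakk>x \<in> carrier L; y \<in> carrier L\<rbrakk> \<Longrightarrow> \<alpha> (x \<oplus>\<^bsub>L\<^esub> y) = \<alpha> x \<oplus>\<^bsub>L\<^esub> \<alpha> y"
  "\<lbrakk>k \<in> carrier K; x \<in> carrier L\<rbrakk> \<Longrightarrow> \<alpha> (k \<odot>\<^bsub>L\<^esub> x) = k \<odot>\<^bsub>L\<^esub> \<alpha> x"
  using module_hom_carrier[OF alpha_linear] module_hom_add[OF alpha_linear]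
    module_hom_smult[OF alpha_linear] by auto

lemma br_hom:
  assumes "x \<in> carrier L"
  shows "br x \<in> module_hom K L L" "(\<lambda>y. br y x) \<in> module_hom K L L"
  using assms br_bilinear by (simp_all add: bilinear_map_def)

lemma br_zero [simp]:
  assumes "x \<in> carrier L"
  shows "br \<zero>\<^bsub>L\<^esub> x = \<zero>\<^bsub>L\<^esub>" "br x \<zero>\<^bsub>L\<^esub> = \<zero>\<^bsub>L\<^esub>"
  using module_hom_zero[OF br_hom(1)[OF assms]] module_hom_zero[OF br_hom(2)[OF assms]]
  by (simp_all add: module_axioms)

lemma leibniz_sum:
  "\<lbrakk>x \<in> carrier L; y \<in> carrier L; z \<in> carrier L\<rbrakk> \<Longrightarrow>
    br (\<alpha> x) (br y z) \<oplus>\<^bsub>L\<^esub> br (br x z) (\<alpha> y) = br (br x y) (\<alpha> z)"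
  using hom_leibniz[of x y z] M.eq_minus_iff[of "br (\<alpha> x) (br y z)" "br (br x y) (\<alpha> z)" "br (br x z) (\<alpha> y)"]
  by simp

abbreviation cocycle where "cocycle \<phi> \<equiv> \<phi> \<in> cocycles2 K L br \<alpha>"

lemma cocycle_iff:
  "cocycle \<phi> \<longleftrightarrow> \<phi> \<in> extensional (carrier L \<times> carrier L) \<and>
     bilinear_map K L L L (\<lambda>x y. \<phi> (x, y)) \<and>
     (\<forall>x\<in>carrier L. \<forall>y\<in>carrier L. \<alpha> (\<phi> (x, y)) = \<phi> (\<alpha> x, \<alpha> y)) \<and>
     (\<forall>x\<in>carrier L. \<forall>y\<in>carrier L. \<forall>z\<in>carrier L.
        br (\<alpha> x) (\<phi> (y, z)) \<oplus>\<^bsub>L\<^esub> \<phi> (\<alpha> x, br y z) \<oplus>\<^bsub>L\<^esub> (br (\<phi> (x, z)) (\<alpha> y) \<oplus>\<^bsub>L\<^esub> \<phi> (br x z, \<alpha> y))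
        = br (\<phi> (x, y)) (\<alpha> z) \<oplus>\<^bsub>L\<^esub> \<phi> (br x y, \<alpha> z))"
proof -
  have delta: "delta2 L br \<alpha> \<phi> = \<zero>\<^bsub>fun_space (carrier L \<times> carrier L \<times> carrier L) L\<^esub> \<longleftrightarrow>
     (\<forall>x\<in>carrier L. \<forall>y\<in>carrier L. \<forall>z\<in>carrier L.
        br (\<alpha> x) (\<phi> (y, z)) \<oplus>\<^bsub>L\<^esub> \<phi> (\<alpha> x, br y z) \<oplus>\<^bsub>L\<^esub> (br (\<phi> (x, z)) (\<alpha> y) \<oplus>\<^bsub>L\<^esub> \<phi> (br x z, \<alpha> y))
        = br (\<phi> (x, y)) (\<alpha> z) \<oplus>\<^bsub>L\<^esub> \<phi> (br x y, \<alpha> z))" (is "_ = ?R")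
    if "bilinear_map K L L L (\<lambda>x y. \<phi> (x, y))"
  proof -
    note c = bilinear_mapD(1)[OF that]
    have "delta2 L br \<alpha> \<phi> = \<zero>\<^bsub>fun_space (carrier L \<times> carrier L \<times> carrier L) L\<^esub> \<longleftrightarrow>
      (\<forall>x\<in>carrier L. \<forall>y\<in>carrier L. \<forall>z\<in>carrier L.
        br (\<alpha> x) (\<phi> (y, z)) \<oplus>\<^bsub>L\<^esub> br (\<phi> (x, z)) (\<alpha> y) \<ominus>\<^bsub>L\<^esub> br (\<phi> (x, y)) (\<alpha> z)
        \<ominus>\<^bsub>L\<^esub> \<phi> (br x y, \<alpha> z) \<oplus>\<^bsub>L\<^esub> \<phi> (br x z, \<alpha> y) \<oplus>\<^bsub>L\<^esub> \<phi> (\<alpha> x, br y z) = \<zero>\<^bsub>L\<^esub>)"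
      unfolding delta2_def fun_space_simps restrict_eq_iff by simp
    also have "\<dots> \<longleftrightarrow> ?R" by (simp add: M.delta2_sum_zero_iff c)
    finally show ?thesis .
  qed
  show ?thesis
    using delta bilinear_mapD(1)[of K L L L "\<lambda>x y. \<phi> (x, y)"]
    by (auto simp: cocycles2_def cochains2_def PiE_iff)
qed

lemma cocycle_simps:
  assumes "cocycle \<phi>"
  shows "\<lbrakk>x \<in> carrier L; y \<in> carrier L\<rbrakk> \<Longrightarrow> \<phi> (x, y) \<in> carrier L"
    and "\<lbrakk>x \<in> carrier L; y \<in> carrier L; z \<in> carrier L\<rbrakk> \<Longrightarrow> \<phi> (x, y \<oplus>\<^bsub>L\<^esub> z) = \<phi> (x, y) \<oplus>\<^bsub>L\<^esub> \<phi> (x, z)"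
    and "\<lbrakk>x \<in> carrier L; y \<in> carrier L; z \<in> carrier L\<rbrakk> \<Longrightarrow> \<phi> (x \<oplus>\<^bsub>L\<^esub> y, z) = \<phi> (x, z) \<oplus>\<^bsub>L\<^esub> \<phi> (y, z)"
    and "\<lbrakk>k \<in> carrier K; x \<in> carrier L; y \<in> carrier L\<rbrakk> \<Longrightarrow> \<phi> (x, k \<odot>\<^bsub>L\<^esub> y) = k \<odot>\<^bsub>L\<^esub> \<phi> (x, y)"
    and "\<lbrakk>k \<in> carrier K; x \<in> carrier L; y \<in> carrier L\<rbrakk> \<Longrightarrow> \<phi> (k \<odot>\<^bsub>L\<^esub> x, y) = k \<odot>\<^bsub>L\<^esub> \<phi> (x, y)"
    and "\<lbrakk>x \<in> carrier L; y \<in> carrier L\<rbrakk> \<Longrightarrow> \<alpha> (\<phi> (x, y)) = \<phi> (\<alpha> x, \<alpha> y)"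
    and "\<lbrakk>x \<in> carrier L; y \<in> carrier L; z \<in> carrier L\<rbrakk> \<Longrightarrow>
        br (\<alpha> x) (\<phi> (y, z)) \<oplus>\<^bsub>L\<^esub> \<phi> (\<alpha> x, br y z) \<oplus>\<^bsub>L\<^esub> (br (\<phi> (x, z)) (\<alpha> y) \<oplus>\<^bsub>L\<^esub> \<phi> (br x z, \<alpha> y))
        = br (\<phi> (x, y)) (\<alpha> z) \<oplus>\<^bsub>L\<^esub> \<phi> (br x y, \<alpha> z)"
proof -
  have bil: "bilinear_map K L L L (\<lambda>x y. \<phi> (x, y))" using assms by (simp add: cocycle_iff)
  note D = bilinear_mapD[OF bil]
  show "\<lbrakk>x \<in> carrier L; y \<in> carrier L\<rbrakk> \<Longrightarrow> \<phi> (x, y) \<in> carrier L"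
    and "\<lbrakk>x \<in> carrier L; y \<in> carrier L; z \<in> carrier L\<rbrakk> \<Longrightarrow> \<phi> (x, y \<oplus>\<^bsub>L\<^esub> z) = \<phi> (x, y) \<oplus>\<^bsub>L\<^esub> \<phi> (x, z)"
    and "\<lbrakk>x \<in> carrier L; y \<in> carrier L; z \<in> carrier L\<rbrakk> \<Longrightarrow> \<phi> (x \<oplus>\<^bsub>L\<^esub> y, z) = \<phi> (x, z) \<oplus>\<^bsub>L\<^esub> \<phi> (y, z)"
    and "\<lbrakk>k \<in> carrier K; x \<in> carrier L; y \<in> carrier L\<rbrakk> \<Longrightarrow> \<phi> (x, k \<odot>\<^bsub>L\<^esub> y) = k \<odot>\<^bsub>L\<^esub> \<phi> (x, y)"
    and "\<lbrakk>k \<in> carrier K; x \<in> carrier L; y \<in> carrier L\<rbrakk> \<Longrightarrow> \<phi> (k \<odot>\<^bsub>L\<^esub> x, y) = k \<odot>\<^bsub>L\<^esub> \<phi> (x, y)"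
    by (simp_all add: D)
qed (use assms in \<open>unfold cocycle_iff, blast+\<close>)

end

subsection \<open>The twisting map in coordinates\<close>

locale infinitesimal_deformation_setting =
  infinitesimal_tensor K A L \<epsilon> B \<xi> + hom_leibniz_algebra K L br \<alpha>
  for K :: "('k, 'm) ring_scheme" and A :: "('k, 'a, 'n) module_scheme"
    and L :: "('k, 'l, 'p) module_scheme" and \<epsilon> B \<xi> br \<alpha>
begin

abbreviation \<alpha>T where "\<alpha>T \<equiv> id_tensor K A L \<alpha>"

lemma alphaT_simps [simp]:
  "t \<in> carrier T \<Longrightarrow> \<alpha>T t \<in> carrier T"
  "\<lbrakk>a \<in> carrier A; l \<in> carrier L\<rbrakk> \<Longrightarrow> \<alpha>T (tn a l) = tn a (\<alpha> l)"
  "t \<in> carrier T \<Longrightarrow> E (\<alpha>T t) = \<alpha> (E t)"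
  "\<lbrakk>b \<in> B; t \<in> carrier T\<rbrakk> \<Longrightarrow> Xi b (\<alpha>T t) = \<alpha> (Xi b t)"
  using module_hom_carrier[OF id_tensor_hom[OF alpha_linear]] id_tensor_tens[OF alpha_linear]
    aug_tensor_id_tensor[OF alpha_linear eps_hom] aug_tensor_id_tensor[OF alpha_linear xi_hom]
  by auto

subsection \<open>From a deformation to cocycles\<close>

text \<open>
  The first-order term of \<open>lam\<close> in the direction of \<open>b\<close>.
\<close>

definition \<psi> where
  "\<psi> lam b = (\<lambda>(x, y)\<in>carrier L \<times> carrier L. Xi b (lam (tn \<one>\<^bsub>A\<^esub> x) (tn \<one>\<^bsub>A\<^esub> y)))"

text \<open>The coordinates of a bracket on \<open>A \<otimes> L\<close> that reduces to \<open>br\<close> and has first-order terms \<open>\<phi> b\<close>.\<close>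

definition coordinate_bracket where
  "coordinate_bracket lam \<phi> \<longleftrightarrow> (\<forall>s\<in>carrier T. \<forall>t\<in>carrier T. lam s t \<in> carrier T \<and>
     E (lam s t) = br (E s) (E t) \<and>
     (\<forall>b\<in>B. Xi b (lam s t) = br (Xi b s) (E t) \<oplus>\<^bsub>L\<^esub> br (E s) (Xi b t) \<oplus>\<^bsub>L\<^esub> \<phi> b (E s, E t)))"

context
  fixes lam assumes lam: "deformation K L br \<alpha> A \<epsilon> lam"
begin

lemma lam_facts:
  shows lam_hl: "hom_leibniz_algebra K T lam \<alpha>T"
    and lam_A: "bilinear_map A TM TM TM lam"
    and lam_E: "\<lbrakk>s \<in> carrier T; t \<in> carrier T\<rbrakk> \<Longrightarrow> E (lam s t) = br (E s) (E t)"
  using lam by (auto simp: deformation_def hom_leibniz_morphisms_def)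

lemmas lam_K = hom_leibniz_algebra.br_bilinear[OF lam_hl]
lemmas lam_simps = bilinear_mapD[OF lam_K]

lemma psi_eq: "\<lbrakk>x \<in> carrier L; y \<in> carrier L\<rbrakk> \<Longrightarrow> \<psi> lam b (x, y) = Xi b (lam (tn \<one>\<^bsub>A\<^esub> x) (tn \<one>\<^bsub>A\<^esub> y))"
  by (simp add: \<psi>_def)

lemma psi_bilinear:
  assumes b: "b \<in> B"
  shows "bilinear_map K L L L (\<lambda>x y. \<psi> lam b (x, y))"
  using b by (intro bilinear_mapI)
    (simp_all add: psi_eq lam_simps tens_add_right tens_smult_right)

text \<open>
  \<open>a \<otimes> x = a (1 \<otimes> x)\<close>, so by \<open>A\<close>-bilinearity the bracket of two pure tensors is a multiple of the bracket
  of \<open>1 \<otimes> x\<close> and \<open>1 \<otimes> y\<close>, and its coordinates follow from the derivation property of \<open>\<xi> b\<close>.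
\<close>

lemma deformation_tens:
  assumes b: "b \<in> B" and a: "a \<in> carrier A" "x \<in> carrier L" and c: "c \<in> carrier A" "y \<in> carrier L"
  shows "Xi b (lam (tn a x) (tn c y)) =
    br (Xi b (tn a x)) (E (tn c y)) \<oplus>\<^bsub>L\<^esub> br (E (tn a x)) (Xi b (tn c y)) \<oplus>\<^bsub>L\<^esub> \<psi> lam b (E (tn a x), E (tn c y))"
proof -
  let ?u = "lam (tn \<one>\<^bsub>A\<^esub> x) (tn \<one>\<^bsub>A\<^esub> y)"
  note AD = bilinear_mapD[OF lam_A, simplified]
  have u: "?u \<in> carrier T" using a c by (simp add: lam_simps)
  have "lam (tn a x) (tn c y) = lam (a \<odot>\<^bsub>TM\<^esub> tn \<one>\<^bsub>A\<^esub> x) (c \<odot>\<^bsub>TM\<^esub> tn \<one>\<^bsub>A\<^esub> y)"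
    using a c by simp
  also have "\<dots> = c \<odot>\<^bsub>TM\<^esub> (a \<odot>\<^bsub>TM\<^esub> ?u)"
    using a c u by (simp only: AD tens_closed scal_closed Alg.one_closed)
  finally have "Xi b (lam (tn a x) (tn c y)) =
      \<epsilon> c \<odot>\<^bsub>L\<^esub> (\<epsilon> a \<odot>\<^bsub>L\<^esub> \<psi> lam b (x, y) \<oplus>\<^bsub>L\<^esub> \<xi> b a \<odot>\<^bsub>L\<^esub> br x y)
        \<oplus>\<^bsub>L\<^esub> \<xi> b c \<odot>\<^bsub>L\<^esub> (\<epsilon> a \<odot>\<^bsub>L\<^esub> br x y)"
    using a b c u by (simp add: scal_coords psi_eq lam_E)
  also have "\<dots> = br (Xi b (tn a x)) (E (tn c y)) \<oplus>\<^bsub>L\<^esub> br (E (tn a x)) (Xi b (tn c y))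
      \<oplus>\<^bsub>L\<^esub> \<psi> lam b (E (tn a x), E (tn c y))"
    using a b c bilinear_mapD[OF psi_bilinear[OF b]]
    by (simp add: L.smult_r_distr L.M.a_ac L.smult_assoc1[symmetric] A.R.m_comm)
  finally show ?thesis .
qed

text \<open>
  Both sides are linear in each of the two arguments, which reduces the claim to pure tensors.
\<close>

lemma deformation_coordinates:
  "coordinate_bracket lam (\<psi> lam)"
proof -
  have lamL: "lam s \<in> module_hom K T T" and lamR: "(\<lambda>s. lam s t) \<in> module_hom K T T"
    if "s \<in> carrier T" "t \<in> carrier T" for s t
    using that lam_K by (simp_all add: bilinear_map_def)
  note homs = module_hom_plus[OF L.module_axioms] module_hom_comp[OF E_hom] module_hom_comp[OF Xi_hom]
  have "Xi b (lam s t) = br (Xi b s) (E t) \<oplus>\<^bsub>L\<^esub> br (E s) (Xi b t) \<oplus>\<^bsub>L\<^esub> \<psi> lam b (E s, E t)"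
    if b: "b \<in> B" and s: "s \<in> carrier T" and t: "t \<in> carrier T" for b s t
  proof -
    have ps: "(\<lambda>y. \<psi> lam b (x, y)) \<in> module_hom K L L" "(\<lambda>y. \<psi> lam b (y, x)) \<in> module_hom K L L"
      if "x \<in> carrier L" for x
      using that psi_bilinear[OF b] by (simp_all add: bilinear_map_def)
    have step: "Xi b (lam s (tn c y)) = br (Xi b s) (E (tn c y)) \<oplus>\<^bsub>L\<^esub> br (E s) (Xi b (tn c y))
        \<oplus>\<^bsub>L\<^esub> \<psi> lam b (E s, E (tn c y))" if cy: "c \<in> carrier A" "y \<in> carrier L" for c y
      using s
    proof (rule tensor_hom_eqI[OF L.module_axioms, rotated -1])
      show "(\<lambda>s. Xi b (lam s (tn c y))) \<in> module_hom K T L"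
        using cy b by (intro module_hom_comp[OF lamR Xi_hom]) auto
      show "(\<lambda>s. br (Xi b s) (E (tn c y)) \<oplus>\<^bsub>L\<^esub> br (E s) (Xi b (tn c y)) \<oplus>\<^bsub>L\<^esub> \<psi> lam b (E s, E (tn c y)))
          \<in> module_hom K T L"
        using b E_simps(1)[OF tens_closed[OF cy]] Xi_simps(1)[OF b tens_closed[OF cy]]
        by (intro homs br_hom ps)
    qed (rule deformation_tens[OF b _ _ cy])
    show ?thesis
      using t
    proof (rule tensor_hom_eqI[OF L.module_axioms, rotated -1])
      show "(\<lambda>t. Xi b (lam s t)) \<in> module_hom K T L"
        using s b by (intro module_hom_comp[OF lamL Xi_hom]) auto
      show "(\<lambda>t. br (Xi b s) (E t) \<oplus>\<^bsub>L\<^esub> br (E s) (Xi b t) \<oplus>\<^bsub>L\<^esub> \<psi> lam b (E s, E t)) \<in> module_hom K T L"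
        using b E_simps(1)[OF s] Xi_simps(1)[OF b s] by (intro homs br_hom ps)
    qed (rule step)
  qed
  then show ?thesis by (simp add: coordinate_bracket_def lam_simps lam_E)
qed

text \<open>
  The coordinates of \<open>1 \<otimes> x\<close> are \<open>x\<close> and, in all directions \<open>b\<close>, zero. For such elements the coordinate of \<open>b\<close>
  of the Hom-Leibniz identity consists of the terms of the cocycle condition.
\<close>

lemma deformation_cocycle:
  assumes b: "b \<in> B"
  shows "cocycle (\<psi> lam b)"
  unfolding cocycle_iff
proof (intro conjI ballI)
  interpret HT: hom_leibniz_algebra K T lam \<alpha>T by (fact lam_hl)
  note c = deformation_coordinates[unfolded coordinate_bracket_def, rule_format]
  note p = bilinear_mapD[OF psi_bilinear[OF b]]
  let ?i = "\<lambda>x. tn \<one>\<^bsub>A\<^esub> x"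
  show "\<psi> lam b \<in> extensional (carrier L \<times> carrier L)" by (simp add: \<psi>_def)
  show "bilinear_map K L L L (\<lambda>x y. \<psi> lam b (x, y))" by (rule psi_bilinear[OF b])
  {
    fix x y assume xy: "x \<in> carrier L" "y \<in> carrier L"
    have "\<alpha>T (lam (?i x) (?i y)) = lam (\<alpha>T (?i x)) (\<alpha>T (?i y))"
      using xy by (intro HT.alpha_mult) auto
    then have "Xi b (\<alpha>T (lam (?i x) (?i y))) = Xi b (lam (?i (\<alpha> x)) (?i (\<alpha> y)))"
      using xy by simp
    then show "\<alpha> (\<psi> lam b (x, y)) = \<psi> lam b (\<alpha> x, \<alpha> y)"
      using xy b lam_simps(1) by (simp add: psi_eq)
  }
  fix x y z assume xyz: "x \<in> carrier L" "y \<in> carrier L" "z \<in> carrier L"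
  have "lam (\<alpha>T (?i x)) (lam (?i y) (?i z)) =
      lam (lam (?i x) (?i y)) (\<alpha>T (?i z)) \<ominus>\<^bsub>T\<^esub> lam (lam (?i x) (?i z)) (\<alpha>T (?i y))"
    using xyz by (intro HT.hom_leibniz) auto
  then have "lam (\<alpha>T (?i x)) (lam (?i y) (?i z)) \<oplus>\<^bsub>T\<^esub> lam (lam (?i x) (?i z)) (\<alpha>T (?i y)) =
      lam (lam (?i x) (?i y)) (\<alpha>T (?i z))"
    using xyz lam_simps(1) by (subst (asm) T.M.eq_minus_iff) auto
  then have "Xi b (lam (\<alpha>T (?i x)) (lam (?i y) (?i z)) \<oplus>\<^bsub>T\<^esub> lam (lam (?i x) (?i z)) (\<alpha>T (?i y))) =
      Xi b (lam (lam (?i x) (?i y)) (\<alpha>T (?i z)))" by simp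
  then show "br (\<alpha> x) (\<psi> lam b (y, z)) \<oplus>\<^bsub>L\<^esub> \<psi> lam b (\<alpha> x, br y z) \<oplus>\<^bsub>L\<^esub>
        (br (\<psi> lam b (x, z)) (\<alpha> y) \<oplus>\<^bsub>L\<^esub> \<psi> lam b (br x z, \<alpha> y))
      = br (\<psi> lam b (x, y)) (\<alpha> z) \<oplus>\<^bsub>L\<^esub> \<psi> lam b (br x y, \<alpha> z)"
    using xyz b by (simp add: c p lam_simps(1))
qed

end

subsection \<open>From cocycles to a deformation\<close>

text \<open>
  The Hom-Leibniz identity for the bracket with these first-order terms holds in the \<open>E\<close>-coordinate because it holds in \<open>L\<close>.
  In the coordinate of \<open>b\<close> it is the sum of three instances of the identity in \<open>L\<close>, one for each
  argument carrying the first-order term, and of the cocycle condition.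
\<close>

lemma deformation_of_cocycles:
  assumes coc: "\<And>b. b \<in> B \<Longrightarrow> cocycle (\<phi> b)"
  obtains lam where "deformation K L br \<alpha> A \<epsilon> lam" "\<And>b. b \<in> B \<Longrightarrow> \<psi> lam b = \<phi> b"
proof -
  define lam where "lam s t = of_coords (br (E s) (E t))
    (\<lambda>b. br (Xi b s) (E t) \<oplus>\<^bsub>L\<^esub> br (E s) (Xi b t) \<oplus>\<^bsub>L\<^esub> \<phi> b (E s, E t))" for s t
  note f = cocycle_simps[OF coc]
  have cl: "lam s t \<in> carrier T" "E (lam s t) = br (E s) (E t)"
    "b \<in> B \<Longrightarrow> Xi b (lam s t) = br (Xi b s) (E t) \<oplus>\<^bsub>L\<^esub> br (E s) (Xi b t) \<oplus>\<^bsub>L\<^esub> \<phi> b (E s, E t)"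
    if "s \<in> carrier T" "t \<in> carrier T" for s t b
    using that f(1) by (simp_all add: lam_def)
  have KT: "bilinear_map K T T T lam"
    by (intro bilinear_mapI coords_eqI) (simp_all add: cl f L.M.a_ac L.smult_r_distr)
  have AT: "bilinear_map A TM TM TM lam"
    by (intro bilinear_mapI; unfold tensor_mod_simps; (intro coords_eqI)?)
       (simp_all add: cl f L.M.a_ac L.smult_r_distr scal_coords)
  have leib: "lam (\<alpha>T s) (lam t u) = lam (lam s t) (\<alpha>T u) \<ominus>\<^bsub>T\<^esub> lam (lam s u) (\<alpha>T t)"
    if s: "s \<in> carrier T" and t: "t \<in> carrier T" and u: "u \<in> carrier T" for s t u
  proof -
    have "lam (\<alpha>T s) (lam t u) \<oplus>\<^bsub>T\<^esub> lam (lam s u) (\<alpha>T t) = lam (lam s t) (\<alpha>T u)"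
    proof (rule coords_eqI)
      fix b assume b: "b \<in> B"
      let ?s = "E s" and ?t = "E t" and ?u = "E u" and ?s' = "Xi b s" and ?t' = "Xi b t" and ?u' = "Xi b u"
      note in_L = E_simps(1)[OF s] E_simps(1)[OF t] E_simps(1)[OF u]
        Xi_simps(1)[OF b s] Xi_simps(1)[OF b t] Xi_simps(1)[OF b u]
      have "Xi b (lam (\<alpha>T s) (lam t u) \<oplus>\<^bsub>T\<^esub> lam (lam s u) (\<alpha>T t)) =
          (br (\<alpha> ?s') (br ?t ?u) \<oplus>\<^bsub>L\<^esub> br (br ?s' ?u) (\<alpha> ?t)) \<oplus>\<^bsub>L\<^esub>
          (br (\<alpha> ?s) (br ?t' ?u) \<oplus>\<^bsub>L\<^esub> br (br ?s ?u) (\<alpha> ?t')) \<oplus>\<^bsub>L\<^esub>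
          (br (\<alpha> ?s) (br ?t ?u') \<oplus>\<^bsub>L\<^esub> br (br ?s ?u') (\<alpha> ?t)) \<oplus>\<^bsub>L\<^esub>
          (br (\<alpha> ?s) (\<phi> b (?t, ?u)) \<oplus>\<^bsub>L\<^esub> \<phi> b (\<alpha> ?s, br ?t ?u) \<oplus>\<^bsub>L\<^esub>
            (br (\<phi> b (?s, ?u)) (\<alpha> ?t) \<oplus>\<^bsub>L\<^esub> \<phi> b (br ?s ?u, \<alpha> ?t)))"
        using s t u b by (simp add: cl f L.M.a_ac)
      also have "\<dots> = br (br ?s' ?t) (\<alpha> ?u) \<oplus>\<^bsub>L\<^esub> br (br ?s ?t') (\<alpha> ?u) \<oplus>\<^bsub>L\<^esub> br (br ?s ?t) (\<alpha> ?u')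
          \<oplus>\<^bsub>L\<^esub> (br (\<phi> b (?s, ?t)) (\<alpha> ?u) \<oplus>\<^bsub>L\<^esub> \<phi> b (br ?s ?t, \<alpha> ?u))"
        by (simp only: leibniz_sum in_L f(7)[OF b])
      also have "\<dots> = Xi b (lam (lam s t) (\<alpha>T u))"
        using s t u b by (simp add: cl f L.M.a_ac)
      finally show "Xi b (lam (\<alpha>T s) (lam t u) \<oplus>\<^bsub>T\<^esub> lam (lam s u) (\<alpha>T t)) = Xi b (lam (lam s t) (\<alpha>T u))" .
    qed (use s t u in \<open>simp_all add: cl leibniz_sum\<close>)
    then show ?thesis using s t u by (simp add: T.M.eq_minus_iff cl)
  qed
  have "hom_leibniz_algebra K T lam \<alpha>T"
  proof (intro hom_leibniz_algebra.intro hom_leibniz_algebra_axioms.intro KT leib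
      id_tensor_hom alpha_linear vectorspace.intro tensor_module field_axioms)
    fix s t assume "s \<in> carrier T" "t \<in> carrier T"
    then show "\<alpha>T (lam s t) = lam (\<alpha>T s) (\<alpha>T t)"
      by (intro coords_eqI) (simp_all add: cl f alpha_mult)
  qed
  moreover have "E \<in> hom_leibniz_morphisms K T lam \<alpha>T L br \<alpha>"
    by (simp add: hom_leibniz_morphisms_def E_hom cl)
  ultimately have "deformation K L br \<alpha> A \<epsilon> lam"
    using AT aug by (simp add: deformation_def augmented_algebra_def Alg.algebra_axioms)
  moreover have "\<psi> lam b = \<phi> b" if b: "b \<in> B" for b
  proof (rule extensionalityI[of _ "carrier L \<times> carrier L"])
    show "\<phi> b \<in> extensional (carrier L \<times> carrier L)" using coc[OF b] by (simp add: cocycle_iff)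
    show "\<psi> lam b p = \<phi> b p" if "p \<in> carrier L \<times> carrier L" for p
      using that b by (auto simp: \<psi>_def cl f)
  qed (simp add: \<psi>_def)
  ultimately show thesis by (rule that)
qed

subsection \<open>Equivalent deformations\<close>

text \<open>
  An \<open>A\<close>-linear \<open>\<rho>\<close> that is the identity modulo the augmentation ideal adds \<open>f(E t)\<close> to the coordinate of \<open>b\<close>,
  where \<open>f(x)\<close> is the coordinate of \<open>b\<close> of \<open>\<rho>(1 \<otimes> x)\<close>. In the coordinate of \<open>b\<close> of the equation
  \<open>\<rho>(lam1 s t) = lam2 (\<rho> s) (\<rho> t)\<close> the terms with \<open>\<xi> b\<close>-coordinates of \<open>s\<close> and \<open>t\<close> cancel, and what remains is
  that the cocycles differ by \<open>\<delta>\<^sup>1 f\<close>. Conversely, given the cochains \<open>f\<close>, this formula defines \<open>\<rho>\<close>.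
\<close>

lemma equivalent_deformations_iff:
  assumes lam1: "deformation K L br \<alpha> A \<epsilon> lam1" and lam2: "deformation K L br \<alpha> A \<epsilon> lam2"
  shows "equivalent_deformations K L \<alpha> A \<epsilon> lam1 lam2 \<longleftrightarrow>
    (\<forall>b\<in>B. \<exists>f\<in>carrier (cochains1 K L \<alpha>). \<forall>x\<in>carrier L. \<forall>y\<in>carrier L.
       \<psi> lam1 b (x, y) = \<psi> lam2 b (x, y) \<oplus>\<^bsub>L\<^esub> delta1 L br f (x, y))"
    (is "?equiv \<longleftrightarrow> ?cob")
proof
  note c1 = deformation_coordinates[OF lam1, unfolded coordinate_bracket_def, rule_format]
  note c2 = deformation_coordinates[OF lam2, unfolded coordinate_bracket_def, rule_format]
  note p1 = cocycle_simps[OF deformation_cocycle[OF lam1]]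
  note p2 = cocycle_simps[OF deformation_cocycle[OF lam2]]
  {
    assume ?equiv
    then obtain \<rho> where rA: "\<rho> \<in> module_hom A TM TM"
      and rm: "\<rho> \<in> hom_leibniz_morphisms K T lam1 \<alpha>T T lam2 \<alpha>T"
      and rE: "\<And>t. t \<in> carrier T \<Longrightarrow> E (\<rho> t) = E t"
      unfolding equivalent_deformations_def by auto
    have rK: "\<rho> \<in> module_hom K T T"
      and rbr: "\<And>s t. \<lbrakk>s \<in> carrier T; t \<in> carrier T\<rbrakk> \<Longrightarrow> \<rho> (lam1 s t) = lam2 (\<rho> s) (\<rho> t)"
      and ra: "\<And>t. t \<in> carrier T \<Longrightarrow> \<rho> (\<alpha>T t) = \<alpha>T (\<rho> t)"
      using rm by (auto simp: hom_leibniz_morphisms_def)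
    note r = module_hom_carrier[OF rK] module_hom_add[OF rK] module_hom_smult[OF rK]
    show ?cob
    proof
      fix b assume b: "b \<in> B"
      define f where "f = (\<lambda>x\<in>carrier L. Xi b (\<rho> (tn \<one>\<^bsub>A\<^esub> x)))"
      have f_hom: "f \<in> module_hom K L L"
        using b by (intro module_homI) (simp_all add: f_def r tens_add_right tens_smult_right)
      have f_alpha: "\<alpha> (f x) = f (\<alpha> x)" if "x \<in> carrier L" for x
        using that b r ra[of "tn \<one>\<^bsub>A\<^esub> x"] alphaT_simps(4)[OF b, of "\<rho> (tn \<one>\<^bsub>A\<^esub> x)"] by (simp add: f_def)
      note fs = module_hom_carrier[OF f_hom] module_hom_add[OF f_hom] module_hom_smult[OF f_hom]
      have r_coord: "Xi b (\<rho> t) = Xi b t \<oplus>\<^bsub>L\<^esub> f (E t)" if "t \<in> carrier T" for t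
        using that
      proof (rule tensor_hom_eqI[OF L.module_axioms, rotated -1])
        show "(\<lambda>t. Xi b (\<rho> t)) \<in> module_hom K T L" by (intro module_hom_comp[OF rK Xi_hom] b)
        show "(\<lambda>t. Xi b t \<oplus>\<^bsub>L\<^esub> f (E t)) \<in> module_hom K T L"
          by (intro module_hom_plus L.module_axioms Xi_hom b module_hom_comp[OF E_hom f_hom])
        fix a x assume a: "a \<in> carrier A" and x: "x \<in> carrier L"
        have "\<rho> (tn a x) = \<rho> (a \<odot>\<^bsub>TM\<^esub> tn \<one>\<^bsub>A\<^esub> x)" using a x by simp
        also have "\<dots> = a \<odot>\<^bsub>TM\<^esub> \<rho> (tn \<one>\<^bsub>A\<^esub> x)" using a x by (intro module_hom_smult[OF rA]) auto
        finally show "Xi b (\<rho> (tn a x)) = Xi b (tn a x) \<oplus>\<^bsub>L\<^esub> f (E (tn a x))"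
          using a x b fs r rE[of "tn \<one>\<^bsub>A\<^esub> x"] by (simp add: scal_coords f_def L.M.a_comm)
      qed
      show "\<exists>f\<in>carrier (cochains1 K L \<alpha>). \<forall>x\<in>carrier L. \<forall>y\<in>carrier L.
          \<psi> lam1 b (x, y) = \<psi> lam2 b (x, y) \<oplus>\<^bsub>L\<^esub> delta1 L br f (x, y)"
      proof (intro bexI ballI)
        show "f \<in> carrier (cochains1 K L \<alpha>)"
          using f_hom f_alpha fs(1) by (auto simp: cochains1_def f_def)
        fix x y assume xy: "x \<in> carrier L" "y \<in> carrier L"
        let ?x = "tn \<one>\<^bsub>A\<^esub> x" and ?y = "tn \<one>\<^bsub>A\<^esub> y"
        have "Xi b (\<rho> (lam1 ?x ?y)) = Xi b (lam2 (\<rho> ?x) (\<rho> ?y))" using xy by (simp add: rbr)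
        then have "\<psi> lam1 b (x, y) \<oplus>\<^bsub>L\<^esub> f (br x y) = br (f x) y \<oplus>\<^bsub>L\<^esub> br x (f y) \<oplus>\<^bsub>L\<^esub> \<psi> lam2 b (x, y)"
          using xy b by (simp add: r_coord c1 c2 r rE fs p1 p2)
        then have "\<psi> lam1 b (x, y) = br (f x) y \<oplus>\<^bsub>L\<^esub> br x (f y) \<oplus>\<^bsub>L\<^esub> \<psi> lam2 b (x, y) \<ominus>\<^bsub>L\<^esub> f (br x y)"
          using xy b by (subst L.eq_minus_iff) (simp_all add: fs p1 p2)
        then show "\<psi> lam1 b (x, y) = \<psi> lam2 b (x, y) \<oplus>\<^bsub>L\<^esub> delta1 L br f (x, y)"
          using xy b by (simp add: delta1_def fs p2 L.M.a_ac a_minus_def)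
      qed
    qed
  }
  assume ?cob
  then obtain f where f: "\<And>b. b \<in> B \<Longrightarrow> f b \<in> carrier (cochains1 K L \<alpha>)"
    and cob: "\<And>b x y. \<lbrakk>b \<in> B; x \<in> carrier L; y \<in> carrier L\<rbrakk> \<Longrightarrow>
      \<psi> lam1 b (x, y) = \<psi> lam2 b (x, y) \<oplus>\<^bsub>L\<^esub> delta1 L br (f b) (x, y)" by metis
  have f_hom: "f b \<in> module_hom K L L" if "b \<in> B" for b using f[OF that] by (simp add: cochains1_def)
  have fa: "\<alpha> (f b x) = f b (\<alpha> x)" if "b \<in> B" "x \<in> carrier L" for b x
    using f[OF that(1)] that(2) by (simp add: cochains1_def)
  note fs = module_hom_carrier[OF f_hom] module_hom_add[OF f_hom] module_hom_smult[OF f_hom]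
  have cob': "\<psi> lam1 b (x, y) \<oplus>\<^bsub>L\<^esub> f b (br x y) = br (f b x) y \<oplus>\<^bsub>L\<^esub> (br x (f b y) \<oplus>\<^bsub>L\<^esub> \<psi> lam2 b (x, y))"
    if "b \<in> B" "x \<in> carrier L" "y \<in> carrier L" for b x y
  proof (subst L.eq_minus_iff[symmetric])
    show "\<psi> lam1 b (x, y) = br (f b x) y \<oplus>\<^bsub>L\<^esub> (br x (f b y) \<oplus>\<^bsub>L\<^esub> \<psi> lam2 b (x, y)) \<ominus>\<^bsub>L\<^esub> f b (br x y)"
      using that by (simp add: cob delta1_def a_minus_def L.M.a_ac fs p2)
  qed (use that in \<open>simp_all add: p1 p2 fs\<close>)
  define \<rho> where "\<rho> t = of_coords (E t) (\<lambda>b. Xi b t \<oplus>\<^bsub>L\<^esub> f b (E t))" for t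
  \<comment> \<open>The inverse of \<open>\<rho>\<close>.\<close>
  define \<sigma> where "\<sigma> t = of_coords (E t) (\<lambda>b. Xi b t \<ominus>\<^bsub>L\<^esub> f b (E t))" for t
  have r: "\<rho> t \<in> carrier T" "E (\<rho> t) = E t" "b \<in> B \<Longrightarrow> Xi b (\<rho> t) = Xi b t \<oplus>\<^bsub>L\<^esub> f b (E t)"
    if "t \<in> carrier T" for t b using that fs by (simp_all add: \<rho>_def)
  have s: "\<sigma> t \<in> carrier T" "E (\<sigma> t) = E t" "b \<in> B \<Longrightarrow> Xi b (\<sigma> t) = Xi b t \<ominus>\<^bsub>L\<^esub> f b (E t)"
    if "t \<in> carrier T" for t b using that fs by (simp_all add: \<sigma>_def)
  have cancel: "x \<oplus>\<^bsub>L\<^esub> y \<ominus>\<^bsub>L\<^esub> y = x" "x \<ominus>\<^bsub>L\<^esub> y \<oplus>\<^bsub>L\<^esub> y = x" if "x \<in> carrier L" "y \<in> carrier L" for x y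
    using that by (simp_all add: a_minus_def L.M.a_assoc L.M.r_neg L.M.l_neg)
  have rK: "\<rho> \<in> module_hom K T T"
    by (intro module_homI coords_eqI) (simp_all add: r fs L.M.a_ac L.smult_r_distr)
  have rA: "\<rho> \<in> module_hom A TM TM"
    by (intro module_homI; unfold tensor_mod_simps; (intro coords_eqI)?)
       (simp_all add: r fs L.M.a_ac L.smult_r_distr scal_coords)
  have "\<sigma> (\<rho> t) = t" "\<rho> (\<sigma> t) = t" if "t \<in> carrier T" for t
    using that by (intro coords_eqI; simp add: r s fs cancel)+
  then have bij: "bij_betw \<rho> (carrier T) (carrier T)"
    by (intro bij_betw_byWitness[of _ \<sigma>]) (auto simp: r s)
  have rbr: "\<rho> (lam1 x y) = lam2 (\<rho> x) (\<rho> y)" if "x \<in> carrier T" "y \<in> carrier T" for x y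
  proof (rule coords_eqI)
    fix b assume b: "b \<in> B"
    have "Xi b (\<rho> (lam1 x y)) = br (Xi b x) (E y) \<oplus>\<^bsub>L\<^esub> br (E x) (Xi b y) \<oplus>\<^bsub>L\<^esub>
        (\<psi> lam1 b (E x, E y) \<oplus>\<^bsub>L\<^esub> f b (br (E x) (E y)))"
      using that b by (simp add: r c1 fs p1 L.M.a_ac)
    also have "\<dots> = Xi b (lam2 (\<rho> x) (\<rho> y))"
      using that b by (subst cob') (simp_all add: r c2 fs p2 L.M.a_ac)
    finally show "Xi b (\<rho> (lam1 x y)) = Xi b (lam2 (\<rho> x) (\<rho> y))" .
  qed (use that in \<open>simp_all add: r c1 c2\<close>)
  have ra: "\<rho> (\<alpha>T x) = \<alpha>T (\<rho> x)" if "x \<in> carrier T" for x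
    using that by (intro coords_eqI) (simp_all add: r fs fa)
  show ?equiv
    unfolding equivalent_deformations_def hom_leibniz_morphisms_def
    using rK rA bij rbr ra r by (intro exI[of _ \<rho>]) auto
qed

end

section \<open>The second cohomology space\<close>

context hom_leibniz_algebra
begin

abbreviation cocycle_space where
  "cocycle_space \<equiv> (cochains2 K L \<alpha>)\<lparr>carrier := cocycles2 K L br \<alpha>\<rparr>"

lemma cocycle_space_eq:
  "cocycle_space = (fun_space (carrier L \<times> carrier L) L)\<lparr>carrier := cocycles2 K L br \<alpha>\<rparr>"
  by (simp add: cochains2_def)

lemma cocycle_space_ops:
  "add cocycle_space = add (fun_space (carrier L \<times> carrier L) L)"
  "smult cocycle_space = smult (fun_space (carrier L \<times> carrier L) L)"
  "\<zero>\<^bsub>cocycle_space\<^esub> = \<zero>\<^bsub>fun_space (carrier L \<times> carrier L) L\<^esub>"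
  by (simp_all add: cocycle_space_eq)

lemma cocycles_submodule:
  "submodule K (cocycles2 K L br \<alpha>) (fun_space (carrier L \<times> carrier L) L)"
proof (rule submodule.intro)
  let ?F = "fun_space (carrier L \<times> carrier L) L"
  show "module K ?F" by (rule fun_space_module[OF module_axioms])
  show "cocycles2 K L br \<alpha> \<subseteq> carrier ?F" by (auto simp: cocycles2_def cochains2_def)
  show "\<zero>\<^bsub>?F\<^esub> \<in> cocycles2 K L br \<alpha>"
    unfolding cocycle_iff
    using module_hom_zero[OF alpha_linear module_axioms module_axioms]
    by (auto intro!: bilinear_mapI)
  fix v assume v: "cocycle v"
  note vs = cocycle_simps[OF v]
  {
    fix w assume w: "cocycle w"
    note ws = cocycle_simps[OF w]
    show "cocycle (v \<oplus>\<^bsub>?F\<^esub> w)"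
      unfolding cocycle_iff
    proof (intro conjI ballI)
      show "bilinear_map K L L L (\<lambda>x y. (v \<oplus>\<^bsub>?F\<^esub> w) (x, y))"
        by (rule bilinear_mapI) (simp_all add: vs ws smult_r_distr M.a_ac)
      fix x y z assume xyz: "x \<in> carrier L" "y \<in> carrier L" "z \<in> carrier L"
      have "br (\<alpha> x) ((v \<oplus>\<^bsub>?F\<^esub> w) (y, z)) \<oplus>\<^bsub>L\<^esub> (v \<oplus>\<^bsub>?F\<^esub> w) (\<alpha> x, br y z) \<oplus>\<^bsub>L\<^esub>
          (br ((v \<oplus>\<^bsub>?F\<^esub> w) (x, z)) (\<alpha> y) \<oplus>\<^bsub>L\<^esub> (v \<oplus>\<^bsub>?F\<^esub> w) (br x z, \<alpha> y)) =
        (br (\<alpha> x) (v (y, z)) \<oplus>\<^bsub>L\<^esub> v (\<alpha> x, br y z) \<oplus>\<^bsub>L\<^esub> (br (v (x, z)) (\<alpha> y) \<oplus>\<^bsub>L\<^esub> v (br x z, \<alpha> y))) \<oplus>\<^bsub>L\<^esub>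
        (br (\<alpha> x) (w (y, z)) \<oplus>\<^bsub>L\<^esub> w (\<alpha> x, br y z) \<oplus>\<^bsub>L\<^esub> (br (w (x, z)) (\<alpha> y) \<oplus>\<^bsub>L\<^esub> w (br x z, \<alpha> y)))"
        using xyz by (simp add: vs(1) ws(1) M.a_ac)
      also have "\<dots> = br (v (x, y)) (\<alpha> z) \<oplus>\<^bsub>L\<^esub> v (br x y, \<alpha> z) \<oplus>\<^bsub>L\<^esub> (br (w (x, y)) (\<alpha> z) \<oplus>\<^bsub>L\<^esub> w (br x y, \<alpha> z))"
        by (simp only: vs(7)[OF xyz] ws(7)[OF xyz])
      also have "\<dots> = br ((v \<oplus>\<^bsub>?F\<^esub> w) (x, y)) (\<alpha> z) \<oplus>\<^bsub>L\<^esub> (v \<oplus>\<^bsub>?F\<^esub> w) (br x y, \<alpha> z)"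
        using xyz by (simp add: vs(1) ws(1) M.a_ac)
      finally show "br (\<alpha> x) ((v \<oplus>\<^bsub>?F\<^esub> w) (y, z)) \<oplus>\<^bsub>L\<^esub> (v \<oplus>\<^bsub>?F\<^esub> w) (\<alpha> x, br y z) \<oplus>\<^bsub>L\<^esub>
          (br ((v \<oplus>\<^bsub>?F\<^esub> w) (x, z)) (\<alpha> y) \<oplus>\<^bsub>L\<^esub> (v \<oplus>\<^bsub>?F\<^esub> w) (br x z, \<alpha> y)) =
          br ((v \<oplus>\<^bsub>?F\<^esub> w) (x, y)) (\<alpha> z) \<oplus>\<^bsub>L\<^esub> (v \<oplus>\<^bsub>?F\<^esub> w) (br x y, \<alpha> z)" .
    qed (simp_all add: vs ws)
  }
  fix k assume k: "k \<in> carrier K"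
  show "cocycle (k \<odot>\<^bsub>?F\<^esub> v)"
    unfolding cocycle_iff
  proof (intro conjI ballI)
    show "bilinear_map K L L L (\<lambda>x y. (k \<odot>\<^bsub>?F\<^esub> v) (x, y))"
      using k by (intro bilinear_mapI) (simp_all add: vs smult_r_distr smult_assoc1[symmetric] R.m_comm)
    fix x y z assume xyz: "x \<in> carrier L" "y \<in> carrier L" "z \<in> carrier L"
    have "br (\<alpha> x) ((k \<odot>\<^bsub>?F\<^esub> v) (y, z)) \<oplus>\<^bsub>L\<^esub> (k \<odot>\<^bsub>?F\<^esub> v) (\<alpha> x, br y z) \<oplus>\<^bsub>L\<^esub>
        (br ((k \<odot>\<^bsub>?F\<^esub> v) (x, z)) (\<alpha> y) \<oplus>\<^bsub>L\<^esub> (k \<odot>\<^bsub>?F\<^esub> v) (br x z, \<alpha> y)) =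
      k \<odot>\<^bsub>L\<^esub> (br (\<alpha> x) (v (y, z)) \<oplus>\<^bsub>L\<^esub> v (\<alpha> x, br y z) \<oplus>\<^bsub>L\<^esub> (br (v (x, z)) (\<alpha> y) \<oplus>\<^bsub>L\<^esub> v (br x z, \<alpha> y)))"
      using xyz k by (simp add: vs(1) smult_r_distr)
    also have "\<dots> = k \<odot>\<^bsub>L\<^esub> (br (v (x, y)) (\<alpha> z) \<oplus>\<^bsub>L\<^esub> v (br x y, \<alpha> z))"
      by (simp only: vs(7)[OF xyz])
    also have "\<dots> = br ((k \<odot>\<^bsub>?F\<^esub> v) (x, y)) (\<alpha> z) \<oplus>\<^bsub>L\<^esub> (k \<odot>\<^bsub>?F\<^esub> v) (br x y, \<alpha> z)"
      using xyz k by (simp add: vs(1) smult_r_distr)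
    finally show "br (\<alpha> x) ((k \<odot>\<^bsub>?F\<^esub> v) (y, z)) \<oplus>\<^bsub>L\<^esub> (k \<odot>\<^bsub>?F\<^esub> v) (\<alpha> x, br y z) \<oplus>\<^bsub>L\<^esub>
        (br ((k \<odot>\<^bsub>?F\<^esub> v) (x, z)) (\<alpha> y) \<oplus>\<^bsub>L\<^esub> (k \<odot>\<^bsub>?F\<^esub> v) (br x z, \<alpha> y)) =
        br ((k \<odot>\<^bsub>?F\<^esub> v) (x, y)) (\<alpha> z) \<oplus>\<^bsub>L\<^esub> (k \<odot>\<^bsub>?F\<^esub> v) (br x y, \<alpha> z)" .
  qed (use k in \<open>simp_all add: vs\<close>)
qed

lemma cocycle_space_module: "module K cocycle_space"
  unfolding cocycle_space_eq
  by (intro LinearCombinations.module.submodule_is_module fun_space_module module_axioms cocycles_submodule)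

lemma cochain1_simps:
  assumes "f \<in> carrier (cochains1 K L \<alpha>)"
  shows "x \<in> carrier L \<Longrightarrow> f x \<in> carrier L"
    and "\<lbrakk>x \<in> carrier L; y \<in> carrier L\<rbrakk> \<Longrightarrow> f (x \<oplus>\<^bsub>L\<^esub> y) = f x \<oplus>\<^bsub>L\<^esub> f y"
    and "\<lbrakk>k \<in> carrier K; x \<in> carrier L\<rbrakk> \<Longrightarrow> f (k \<odot>\<^bsub>L\<^esub> x) = k \<odot>\<^bsub>L\<^esub> f x"
    and "x \<in> carrier L \<Longrightarrow> f (\<alpha> x) = \<alpha> (f x)"
proof -
  have hom: "f \<in> module_hom K L L" using assms by (simp add: cochains1_def)
  show "x \<in> carrier L \<Longrightarrow> f x \<in> carrier L"
    and "\<lbrakk>x \<in> carrier L; y \<in> carrier L\<rbrakk> \<Longrightarrow> f (x \<oplus>\<^bsub>L\<^esub> y) = f x \<oplus>\<^bsub>L\<^esub> f y"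
    and "\<lbrakk>k \<in> carrier K; x \<in> carrier L\<rbrakk> \<Longrightarrow> f (k \<odot>\<^bsub>L\<^esub> x) = k \<odot>\<^bsub>L\<^esub> f x"
    using module_hom_carrier[OF hom] module_hom_add[OF hom] module_hom_smult[OF hom] by simp_all
  show "x \<in> carrier L \<Longrightarrow> f (\<alpha> x) = \<alpha> (f x)" using assms by (simp add: cochains1_def)
qed

text \<open>
  Expanding the cocycle identity for \<open>\<delta>\<^sup>1 f\<close> leaves three instances of the Hom-Leibniz identity, the
  image of a fourth one under \<open>f\<close>, and pairs of terms that cancel on either side.
\<close>

lemma delta1_cocycle:
  assumes f: "f \<in> carrier (cochains1 K L \<alpha>)"
  shows "cocycle (delta1 L br f)"
  unfolding cocycle_iff
proof (intro conjI ballI)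
  note fs = cochain1_simps[OF f]
  have am: "\<alpha> (\<ominus>\<^bsub>L\<^esub> x) = \<ominus>\<^bsub>L\<^esub> \<alpha> x" if "x \<in> carrier L" for x
    using mod_hom.f_neg[of K L L \<alpha>] alpha_linear that
    by (simp add: mod_hom_def mod_hom_axioms_def module_axioms)
  have bm: "br (\<ominus>\<^bsub>L\<^esub> x) y = \<ominus>\<^bsub>L\<^esub> br x y" "br y (\<ominus>\<^bsub>L\<^esub> x) = \<ominus>\<^bsub>L\<^esub> br y x"
    if "x \<in> carrier L" "y \<in> carrier L" for x y
    using mod_hom.f_neg[of K L L "\<lambda>x. br x y"] mod_hom.f_neg[of K L L "br y"] br_hom[OF that(2)] that(1)
    by (simp_all add: mod_hom_def mod_hom_axioms_def module_axioms)
  have d: "delta1 L br f (x, y) = br x (f y) \<oplus>\<^bsub>L\<^esub> br (f x) y \<oplus>\<^bsub>L\<^esub> \<ominus>\<^bsub>L\<^esub> f (br x y)"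
    if "x \<in> carrier L" "y \<in> carrier L" for x y
    using that by (simp add: delta1_def a_minus_def)
  show "delta1 L br f \<in> extensional (carrier L \<times> carrier L)" by (simp add: delta1_def)
  show "bilinear_map K L L L (\<lambda>x y. delta1 L br f (x, y))"
    by (rule bilinear_mapI)
       (simp_all add: d fs M.minus_add M.a_ac smult_r_distr smult_r_minus)
  show "\<alpha> (delta1 L br f (x, y)) = delta1 L br f (\<alpha> x, \<alpha> y)" if "x \<in> carrier L" "y \<in> carrier L" for x y
    using that by (simp add: d fs am alpha_mult fs(4)[symmetric] del: fs(4))
  fix x y z assume xyz: "x \<in> carrier L" "y \<in> carrier L" "z \<in> carrier L"
  let ?u = "br (\<alpha> x) (f (br y z))" and ?v = "br (f (br x z)) (\<alpha> y)" and ?w = "br (f (br x y)) (\<alpha> z)"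
  have "br (\<alpha> x) (delta1 L br f (y, z)) \<oplus>\<^bsub>L\<^esub> delta1 L br f (\<alpha> x, br y z) \<oplus>\<^bsub>L\<^esub>
      (br (delta1 L br f (x, z)) (\<alpha> y) \<oplus>\<^bsub>L\<^esub> delta1 L br f (br x z, \<alpha> y)) =
    (br (\<alpha> x) (br y (f z)) \<oplus>\<^bsub>L\<^esub> br (br x (f z)) (\<alpha> y)) \<oplus>\<^bsub>L\<^esub>
    (br (\<alpha> x) (br (f y) z) \<oplus>\<^bsub>L\<^esub> br (br x z) (\<alpha> (f y))) \<oplus>\<^bsub>L\<^esub>
    (br (\<alpha> (f x)) (br y z) \<oplus>\<^bsub>L\<^esub> br (br (f x) z) (\<alpha> y)) \<oplus>\<^bsub>L\<^esub>
    \<ominus>\<^bsub>L\<^esub> f (br (\<alpha> x) (br y z) \<oplus>\<^bsub>L\<^esub> br (br x z) (\<alpha> y)) \<oplus>\<^bsub>L\<^esub>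
    (?u \<oplus>\<^bsub>L\<^esub> \<ominus>\<^bsub>L\<^esub> ?u) \<oplus>\<^bsub>L\<^esub> (?v \<oplus>\<^bsub>L\<^esub> \<ominus>\<^bsub>L\<^esub> ?v)"
    using xyz by (simp add: d fs bm M.minus_add M.a_ac del: M.r_neg M.r_neg1 M.r_neg2)
  also have "\<dots> = br (br x y) (\<alpha> (f z)) \<oplus>\<^bsub>L\<^esub> br (br x (f y)) (\<alpha> z) \<oplus>\<^bsub>L\<^esub> br (br (f x) y) (\<alpha> z) \<oplus>\<^bsub>L\<^esub>
      \<ominus>\<^bsub>L\<^esub> f (br (br x y) (\<alpha> z)) \<oplus>\<^bsub>L\<^esub> (?w \<oplus>\<^bsub>L\<^esub> \<ominus>\<^bsub>L\<^esub> ?w)"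
    using xyz by (simp add: leibniz_sum fs M.r_neg)
  also have "\<dots> = br (delta1 L br f (x, y)) (\<alpha> z) \<oplus>\<^bsub>L\<^esub> delta1 L br f (br x y, \<alpha> z)"
    using xyz by (simp add: d fs bm M.minus_add M.a_ac del: M.r_neg M.r_neg1 M.r_neg2)
  finally show "br (\<alpha> x) (delta1 L br f (y, z)) \<oplus>\<^bsub>L\<^esub> delta1 L br f (\<alpha> x, br y z) \<oplus>\<^bsub>L\<^esub>
      (br (delta1 L br f (x, z)) (\<alpha> y) \<oplus>\<^bsub>L\<^esub> delta1 L br f (br x z, \<alpha> y)) =
      br (delta1 L br f (x, y)) (\<alpha> z) \<oplus>\<^bsub>L\<^esub> delta1 L br f (br x y, \<alpha> z)" .
qed

lemma coboundaries_submodule: "submodule K (coboundaries2 K L br \<alpha>) cocycle_space"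
proof (rule submodule.intro)
  let ?Z = cocycle_space and ?F = "fun_space (carrier L) L"
  show "module K ?Z" by (rule cocycle_space_module)
  show "coboundaries2 K L br \<alpha> \<subseteq> carrier ?Z"
    using delta1_cocycle by (auto simp: coboundaries2_def)
  have f0: "\<zero>\<^bsub>?F\<^esub> \<in> carrier (cochains1 K L \<alpha>)"
    using module_hom_zero[OF alpha_linear module_axioms module_axioms]
    by (auto simp: cochains1_def intro!: module_homI)
  have "\<zero>\<^bsub>?Z\<^esub> = delta1 L br \<zero>\<^bsub>?F\<^esub>"
    unfolding cocycle_space_ops fun_space_simps delta1_def
    by (rule restrict_ext, rule sym) auto
  then show "\<zero>\<^bsub>?Z\<^esub> \<in> coboundaries2 K L br \<alpha>" using f0 by (auto simp: coboundaries2_def)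
  fix v assume "v \<in> coboundaries2 K L br \<alpha>"
  then obtain f where f: "f \<in> carrier (cochains1 K L \<alpha>)" "v = delta1 L br f" by (auto simp: coboundaries2_def)
  note fs = cochain1_simps[OF f(1)]
  {
    fix w assume "w \<in> coboundaries2 K L br \<alpha>"
    then obtain g where g: "g \<in> carrier (cochains1 K L \<alpha>)" "w = delta1 L br g" by (auto simp: coboundaries2_def)
    note gs = cochain1_simps[OF g(1)]
    have "f \<oplus>\<^bsub>?F\<^esub> g \<in> carrier (cochains1 K L \<alpha>)"
      by (auto simp: cochains1_def fs gs smult_r_distr M.a_ac intro!: module_homI)
    moreover have "v \<oplus>\<^bsub>?Z\<^esub> w = delta1 L br (f \<oplus>\<^bsub>?F\<^esub> g)"
      unfolding cocycle_space_ops fun_space_simps f(2) g(2) delta1_def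
      by (rule restrict_ext) (auto simp: fs gs a_minus_def M.minus_add M.a_ac)
    ultimately show "v \<oplus>\<^bsub>?Z\<^esub> w \<in> coboundaries2 K L br \<alpha>" by (auto simp: coboundaries2_def)
  }
  fix k assume k: "k \<in> carrier K"
  have "k \<odot>\<^bsub>?F\<^esub> f \<in> carrier (cochains1 K L \<alpha>)"
    using k by (auto simp: cochains1_def fs smult_r_distr smult_assoc1[symmetric] R.m_comm intro!: module_homI)
  moreover have "k \<odot>\<^bsub>?Z\<^esub> v = delta1 L br (k \<odot>\<^bsub>?F\<^esub> f)"
    unfolding cocycle_space_ops fun_space_simps f(2) delta1_def
    by (rule restrict_ext) (use k in \<open>auto simp: fs a_minus_def smult_r_distr smult_r_minus\<close>)
  ultimately show "k \<odot>\<^bsub>?Z\<^esub> v \<in> coboundaries2 K L br \<alpha>" by (auto simp: coboundaries2_def)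
qed

sublocale Coh: quotient_module K "coboundaries2 K L br \<alpha>" cocycle_space
  by (rule quotient_module.intro) (rule coboundaries_submodule)

abbreviation H2 where "H2 \<equiv> cohomology2 K L br \<alpha>"
abbreviation cls where "cls \<phi> \<equiv> Coh.coset \<phi>"

lemma cohomology_vectorspace: "vectorspace K H2"
  unfolding cohomology2_def by (intro vectorspace.intro Coh.quot_module field_axioms)

lemma cls_closed: "cocycle \<phi> \<Longrightarrow> cls \<phi> \<in> carrier H2"
  by (simp add: cohomology2_def Coh.quot_carrier)

lemma cocycle_of_class:
  assumes "c \<in> carrier H2" "\<phi> \<in> c"
  shows "cocycle \<phi>" "cls \<phi> = c"
proof -
  obtain v where v: "cocycle v" "c = cls v"
    using assms(1) by (auto simp: cohomology2_def Coh.quot_carrier)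
  then show "cocycle \<phi>" using assms(2) Coh.mem_coset[of v \<phi>] by simp
  then show "cls \<phi> = c" using v assms(2) Coh.mem_coset[of v \<phi>] Coh.coset_eq_iff[of \<phi> v] by simp
qed

lemma cls_eq_iff:
  assumes p: "cocycle \<phi>" and q: "cocycle \<chi>"
  shows "cls \<phi> = cls \<chi> \<longleftrightarrow> (\<exists>f\<in>carrier (cochains1 K L \<alpha>). \<forall>x\<in>carrier L. \<forall>y\<in>carrier L.
    \<phi> (x, y) = \<chi> (x, y) \<oplus>\<^bsub>L\<^esub> delta1 L br f (x, y))"
proof -
  have "\<phi> \<ominus>\<^bsub>cocycle_space\<^esub> \<chi> = delta1 L br f \<longleftrightarrow> (\<forall>x\<in>carrier L. \<forall>y\<in>carrier L.
    \<phi> (x, y) = \<chi> (x, y) \<oplus>\<^bsub>L\<^esub> delta1 L br f (x, y))" if f: "f \<in> carrier (cochains1 K L \<alpha>)" for f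
  proof -
    have "\<phi> \<ominus>\<^bsub>cocycle_space\<^esub> \<chi> = delta1 L br f \<longleftrightarrow> delta1 L br f \<oplus>\<^bsub>cocycle_space\<^esub> \<chi> = \<phi>"
      using Coh.M.eq_minus_iff[of "delta1 L br f" \<phi> \<chi>] p q delta1_cocycle[OF f] by (auto simp: eq_commute)
    also have "\<dots> \<longleftrightarrow> (\<forall>s\<in>carrier L \<times> carrier L. delta1 L br f s \<oplus>\<^bsub>L\<^esub> \<chi> s = \<phi> s)"
    proof
      assume "\<forall>s\<in>carrier L \<times> carrier L. delta1 L br f s \<oplus>\<^bsub>L\<^esub> \<chi> s = \<phi> s"
      moreover have "\<phi> \<in> extensional (carrier L \<times> carrier L)" using p by (simp add: cocycle_iff)
      ultimately show "delta1 L br f \<oplus>\<^bsub>cocycle_space\<^esub> \<chi> = \<phi>"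
        unfolding cocycle_space_ops fun_space_simps
        by (intro extensionalityI[of _ "carrier L \<times> carrier L"]) auto
    qed (auto simp: cocycle_space_ops)
    also have "\<dots> \<longleftrightarrow> (\<forall>x\<in>carrier L. \<forall>y\<in>carrier L.
        \<phi> (x, y) = \<chi> (x, y) \<oplus>\<^bsub>L\<^esub> delta1 L br f (x, y))"
      using cocycle_simps(1)[OF q] cocycle_simps(1)[OF delta1_cocycle[OF f]]
      by (auto simp: M.a_comm)
    finally show ?thesis .
  qed
  then show ?thesis
    using p q by (subst Coh.coset_eq_iff) (auto simp: coboundaries2_def image_iff eq_commute)
qed

end

section \<open>Dual bases and square-zero extensions\<close>

lemma dual_space_module:
  assumes "module K V"
  shows "module K (dual_space K V)"
proof -
  interpret module K V by (fact assms)
  have sc: "module K (scalars K)" by (rule scalars_module[OF R.is_cring])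
  have "submodule K (carrier (dual_space K V)) (fun_space (carrier V) (scalars K))"
  proof (rule submodule.intro)
    show "module K (fun_space (carrier V) (scalars K))" by (rule fun_space_module[OF sc])
    show "f \<oplus>\<^bsub>fun_space (carrier V) (scalars K)\<^esub> g \<in> carrier (dual_space K V)"
      if "f \<in> carrier (dual_space K V)" "g \<in> carrier (dual_space K V)" for f g
      using that by (auto simp: dual_space_def module_hom_def PiE_iff Pi_iff R.a_ac R.r_distr)
    show "k \<odot>\<^bsub>fun_space (carrier V) (scalars K)\<^esub> f \<in> carrier (dual_space K V)"
      if "k \<in> carrier K" "f \<in> carrier (dual_space K V)" for k f
      using that by (auto simp: dual_space_def module_hom_def PiE_iff Pi_iff R.m_ac R.r_distr)
  qed (auto simp: dual_space_def module_hom_def)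
  moreover have "dual_space K V = (fun_space (carrier V) (scalars K))\<lparr>carrier := carrier (dual_space K V)\<rparr>"
    by (simp add: dual_space_def)
  ultimately show ?thesis
    using module.submodule_is_module[OF fun_space_module[OF sc]] by metis
qed

lemma dual_space_hom: "f \<in> carrier (dual_space K V) \<Longrightarrow> f \<in> module_hom K V (scalars K)"
  by (simp add: dual_space_def)

text \<open>
  Some coordinates \<open>\<xi>\<close> with respect to the basis \<open>h\<close> exist; applying \<open>g j\<close> to the expansion of \<open>c\<close> shows that
  \<open>\<xi> (h j) c = g j c\<close>.
\<close>

lemma (in vectorspace) dual_bases_expand:
  assumes db: "dual_bases K V r h g" and c: "c \<in> carrier V"
  shows "c = (\<Oplus>\<^bsub>V\<^esub>i\<in>{1..r}. g i c \<odot>\<^bsub>V\<^esub> h i)"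
proof -
  let ?B = "h ` {1..r}"
  have inj: "inj_on h {1..r}" and bas: "basis ?B"
    and g: "\<And>i. i \<in> {1..r} \<Longrightarrow> g i \<in> module_hom K V (scalars K)"
    and gh: "\<And>i j. \<lbrakk>i \<in> {1..r}; j \<in> {1..r}\<rbrakk> \<Longrightarrow> g i (h j) = (if i = j then \<one>\<^bsub>K\<^esub> else \<zero>\<^bsub>K\<^esub>)"
    using db by (auto simp: dual_bases_def dual_space_def)
  have hV: "h i \<in> carrier V" if "i \<in> {1..r}" for i
    using bas that by (auto simp: basis_def)
  obtain \<xi> where xi: "\<And>b. b \<in> ?B \<Longrightarrow> \<xi> b \<in> module_hom K V (scalars K)"
    and dec: "\<And>v. v \<in> carrier V \<Longrightarrow> v = (\<Oplus>\<^bsub>V\<^esub>b\<in>?B. \<xi> b v \<odot>\<^bsub>V\<^esub> b)"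
    by (rule basis_coordinates[OF finite_imageI[OF finite_atLeastAtMost] bas]) (rule that; assumption)
  have xiK: "\<xi> (h i) c \<in> carrier K" if "i \<in> {1..r}" for i
    using module_hom_carrier[OF xi c] that by auto
  have "(\<Oplus>\<^bsub>V\<^esub>b\<in>?B. \<xi> b c \<odot>\<^bsub>V\<^esub> b) = (\<Oplus>\<^bsub>V\<^esub>i\<in>{1..r}. \<xi> (h i) c \<odot>\<^bsub>V\<^esub> h i)"
    using hV xiK by (intro M.finsum_reindex inj) auto
  with dec[OF c] have c_eq: "c = (\<Oplus>\<^bsub>V\<^esub>i\<in>{1..r}. \<xi> (h i) c \<odot>\<^bsub>V\<^esub> h i)" by simp
  have "g j c = \<xi> (h j) c" if j: "j \<in> {1..r}" for j
  proof -
    have "g j c = (\<Oplus>\<^bsub>scalars K\<^esub>i\<in>{1..r}. g j (\<xi> (h i) c \<odot>\<^bsub>V\<^esub> h i))"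
      by (subst c_eq, rule module_hom_finsum[OF g[OF j] module_axioms scalars_module[OF R.is_cring]])
         (use hV xiK in auto)
    also have "\<dots> = (\<Oplus>\<^bsub>K\<^esub>i\<in>{1..r}. if j = i then \<xi> (h i) c else \<zero>\<^bsub>K\<^esub>)"
      unfolding finsum_scalars using hV xiK j
      by (intro R.finsum_cong') (auto simp: module_hom_smult[OF g[OF j]] gh)
    also have "\<dots> = \<xi> (h j) c" using xiK j by (subst R.add.finprod_singleton) auto
    finally show ?thesis .
  qed
  then have "(\<Oplus>\<^bsub>V\<^esub>i\<in>{1..r}. g i c \<odot>\<^bsub>V\<^esub> h i) = (\<Oplus>\<^bsub>V\<^esub>i\<in>{1..r}. \<xi> (h i) c \<odot>\<^bsub>V\<^esub> h i)"
    using xiK hV by (intro M.finsum_cong') auto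
  with c_eq show ?thesis by simp
qed

text \<open>
  At a vector \<open>c\<close>, the right-hand side is the result of applying \<open>f\<close> to the expansion of \<open>c\<close>.
\<close>

lemma (in vectorspace) dual_bases_expand_functional:
  assumes db: "dual_bases K V r h g" and f: "f \<in> carrier (dual_space K V)"
  shows "f = (\<Oplus>\<^bsub>dual_space K V\<^esub>i\<in>{1..r}. f (h i) \<odot>\<^bsub>dual_space K V\<^esub> g i)" (is "f = ?s")
proof -
  have sc: "module K (scalars K)" by (rule scalars_module[OF R.is_cring])
  interpret D: module K "dual_space K V" by (rule dual_space_module[OF module_axioms])
  note f_hom = dual_space_hom[OF f]
  have g: "g i \<in> carrier (dual_space K V)" if "i \<in> {1..r}" for i
    using db that by (auto simp: dual_bases_def)
  have hV: "h i \<in> carrier V" if "i \<in> {1..r}" for i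
    using db that by (auto simp: dual_bases_def basis_def)
  have fh: "f (h i) \<in> carrier K" if "i \<in> {1..r}" for i
    using module_hom_carrier[OF f_hom hV[OF that]] by simp
  have gK: "g i c \<in> carrier K" if "i \<in> {1..r}" "c \<in> carrier V" for i c
    using module_hom_carrier[OF dual_space_hom[OF g[OF that(1)]] that(2)] by simp
  have s: "?s \<in> carrier (dual_space K V)" using fh g by (intro D.finsum_closed) auto
  show ?thesis
  proof (rule extensionalityI[of _ "carrier V"])
    fix c assume c: "c \<in> carrier V"
    have "?s c = (\<Oplus>\<^bsub>scalars K\<^esub>i\<in>{1..r}. (f (h i) \<odot>\<^bsub>dual_space K V\<^esub> g i) c)"
    proof (rule module_hom_finsum[where f = "\<lambda>f. f c", OF _ D.module_axioms sc])
      have "dual_space K V = (fun_space (carrier V) (scalars K))\<lparr>carrier := carrier (dual_space K V)\<rparr>"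
        by (simp add: dual_space_def)
      then show "(\<lambda>f. f c) \<in> module_hom K (dual_space K V) (scalars K)"
        using module_hom_restrict_carrier[OF eval_hom[OF c, of K "scalars K"], of "carrier (dual_space K V)"]
        by (auto simp: dual_space_def)
    qed (use fh g in auto)
    also have "\<dots> = (\<Oplus>\<^bsub>scalars K\<^esub>i\<in>{1..r}. f (g i c \<odot>\<^bsub>V\<^esub> h i))"
      unfolding finsum_scalars using fh gK hV c
      by (intro R.finsum_cong') (auto simp: dual_space_def module_hom_smult[OF f_hom] R.m_comm)
    also have "\<dots> = f (\<Oplus>\<^bsub>V\<^esub>i\<in>{1..r}. g i c \<odot>\<^bsub>V\<^esub> h i)"
      using gK hV c by (intro module_hom_finsum[OF f_hom module_axioms sc, symmetric]) auto
    also have "\<dots> = f c" using dual_bases_expand[OF db c] by simp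
    finally show "f c = ?s c" by simp
  qed (use f s in \<open>auto simp: dual_space_def PiE_iff\<close>)
qed

lemma square_zero_ext_simps [simp]:
  "carrier (square_zero_ext K M) = carrier K \<times> carrier M"
  "\<one>\<^bsub>square_zero_ext K M\<^esub> = (\<one>\<^bsub>K\<^esub>, \<zero>\<^bsub>M\<^esub>)"
  "\<zero>\<^bsub>square_zero_ext K M\<^esub> = (\<zero>\<^bsub>K\<^esub>, \<zero>\<^bsub>M\<^esub>)"
  "(a, x) \<oplus>\<^bsub>square_zero_ext K M\<^esub> (b, y) = (a \<oplus>\<^bsub>K\<^esub> b, x \<oplus>\<^bsub>M\<^esub> y)"
  "(a, x) \<otimes>\<^bsub>square_zero_ext K M\<^esub> (b, y) = (a \<otimes>\<^bsub>K\<^esub> b, a \<odot>\<^bsub>M\<^esub> y \<oplus>\<^bsub>M\<^esub> b \<odot>\<^bsub>M\<^esub> x)"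
  "c \<odot>\<^bsub>square_zero_ext K M\<^esub> (a, x) = (c \<otimes>\<^bsub>K\<^esub> a, c \<odot>\<^bsub>M\<^esub> x)"
  by (simp_all add: square_zero_ext_def)

lemma square_zero_ext_algebra:
  assumes "module K M"
  shows "algebra K (square_zero_ext K M)"
proof -
  interpret module K M by (fact assms)
  let ?C = "square_zero_ext K M"
  have ab: "abelian_group ?C"
  proof (rule abelian_groupI)
    show "\<exists>y\<in>carrier ?C. y \<oplus>\<^bsub>?C\<^esub> x = \<zero>\<^bsub>?C\<^esub>" if "x \<in> carrier ?C" for x
      using that by (intro bexI[of _ "(\<ominus>\<^bsub>K\<^esub> fst x, \<ominus>\<^bsub>M\<^esub> snd x)"]) (auto simp: R.l_neg M.l_neg)
  qed (auto simp: R.a_ac M.a_ac)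
  have mon: "comm_monoid ?C"
    by (rule comm_monoidI)
       (auto simp: R.m_ac M.a_ac smult_r_distr smult_assoc1[symmetric])
  have "cring ?C"
    by (rule cringI[OF ab mon])
       (auto simp: R.l_distr smult_l_distr smult_r_distr M.a_ac)
  then show ?thesis
    by (intro algebraI)
       (auto simp: R.is_cring R.l_distr R.r_distr R.m_ac smult_l_distr smult_r_distr smult_assoc1[symmetric] M.a_ac)
qed

section \<open>Push-outs of the universal infinitesimal deformation\<close>

locale universal_setting = hom_leibniz_algebra K L br \<alpha>
  for K :: "('k, 'm) ring_scheme" and L :: "('k, 'l, 'p) module_scheme" and br \<alpha> +
  fixes \<mu> :: "('l \<times> 'l \<Rightarrow> 'l) set \<Rightarrow> 'l \<times> 'l \<Rightarrow> 'l" and r :: nat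
    and h :: "nat \<Rightarrow> ('l \<times> 'l \<Rightarrow> 'l) set" and g :: "nat \<Rightarrow> ('l \<times> 'l \<Rightarrow> 'l) set \<Rightarrow> 'k"
  assumes mu: "representative_map K L br \<alpha> \<mu>"
    and db: "dual_bases K (cohomology2 K L br \<alpha>) r h g"
begin

abbreviation D where "D \<equiv> dual_space K H2"
abbreviation C where "C \<equiv> base1 K L br \<alpha>"

sublocale H2: vectorspace K H2 by (rule cohomology_vectorspace)
sublocale D: module K D by (rule dual_space_module[OF H2.module_axioms])

lemma C_simps [simp]:
  "carrier C = carrier K \<times> carrier D"
  "\<one>\<^bsub>C\<^esub> = (\<one>\<^bsub>K\<^esub>, \<zero>\<^bsub>D\<^esub>)"
  "\<zero>\<^bsub>C\<^esub> = (\<zero>\<^bsub>K\<^esub>, \<zero>\<^bsub>D\<^esub>)"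
  "(a, x) \<oplus>\<^bsub>C\<^esub> (b, y) = (a \<oplus>\<^bsub>K\<^esub> b, x \<oplus>\<^bsub>D\<^esub> y)"
  "(a, x) \<otimes>\<^bsub>C\<^esub> (b, y) = (a \<otimes>\<^bsub>K\<^esub> b, a \<odot>\<^bsub>D\<^esub> y \<oplus>\<^bsub>D\<^esub> b \<odot>\<^bsub>D\<^esub> x)"
  "c \<odot>\<^bsub>C\<^esub> (a, x) = (c \<otimes>\<^bsub>K\<^esub> a, c \<odot>\<^bsub>D\<^esub> x)"
  by (simp_all add: base1_def)

sublocale C: algebra_tensor K C L
  using square_zero_ext_algebra[OF D.module_axioms]
  by (intro algebra_tensor.intro tensor_product.intro module_axioms)
     (auto simp: base1_def algebra.module)

lemma g_closed [simp]: "i \<in> {1..r} \<Longrightarrow> g i \<in> carrier D"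
  using db by (auto simp: dual_bases_def)

lemma h_closed [simp]: "i \<in> {1..r} \<Longrightarrow> h i \<in> carrier H2"
  using db H2.basis_def by (auto simp: dual_bases_def)

lemma dual_closed [simp]: "\<lbrakk>f \<in> carrier D; c \<in> carrier H2\<rbrakk> \<Longrightarrow> f c \<in> carrier K"
  using module_hom_carrier[OF dual_space_hom] by fastforce

lemma dual_apply [simp]:
  "c \<in> carrier H2 \<Longrightarrow> (f \<oplus>\<^bsub>D\<^esub> f') c = f c \<oplus>\<^bsub>K\<^esub> f' c"
  "c \<in> carrier H2 \<Longrightarrow> (k \<odot>\<^bsub>D\<^esub> f) c = k \<otimes>\<^bsub>K\<^esub> f c"
  by (simp_all add: dual_space_def)

lemma mu_cocycle: "c \<in> carrier H2 \<Longrightarrow> cocycle (\<mu> c)"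
  and cls_mu: "c \<in> carrier H2 \<Longrightarrow> cls (\<mu> c) = c"
  using mu cocycle_of_class by (auto simp: representative_map_def)

lemma mu_eval_hom:
  assumes "x \<in> carrier L" "y \<in> carrier L"
  shows "(\<lambda>c. \<mu> c (x, y)) \<in> module_hom K H2 L"
proof (rule module_homI)
  have m: "\<mu> \<in> module_hom K H2 (cochains2 K L \<alpha>)" using mu by (simp add: representative_map_def)
  show "\<mu> c (x, y) \<in> carrier L" if "c \<in> carrier H2" for c
    using cocycle_simps(1)[OF mu_cocycle[OF that]] assms by simp
  show "\<mu> (c \<oplus>\<^bsub>H2\<^esub> d) (x, y) = \<mu> c (x, y) \<oplus>\<^bsub>L\<^esub> \<mu> d (x, y)" if "c \<in> carrier H2" "d \<in> carrier H2" for c d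
    using module_hom_add[OF m that] assms by (simp add: cochains2_def)
  show "\<mu> (k \<odot>\<^bsub>H2\<^esub> c) (x, y) = k \<odot>\<^bsub>L\<^esub> \<mu> c (x, y)" if "k \<in> carrier K" "c \<in> carrier H2" for k c
    using module_hom_smult[OF m that] assms by (simp add: cochains2_def)
qed

text \<open>
  \<^const>\<open>bilinear_ext\<close> can be evaluated because the values on \<open>L \<times> L\<close> depend bilinearly on \<open>x\<close> and \<open>y\<close>, each \<open>\<mu>(h i)\<close>
  being a cochain.
\<close>

lemma eta1_one:
  assumes x: "x \<in> carrier L" and y: "y \<in> carrier L"
  shows "eta1 K L br \<alpha> \<mu> r h g (C.tn \<one>\<^bsub>C\<^esub> x) (C.tn \<one>\<^bsub>C\<^esub> y) = C.tn \<one>\<^bsub>C\<^esub> (br x y) \<oplus>\<^bsub>C.T\<^esub>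
    (\<Oplus>\<^bsub>C.T\<^esub>i\<in>{1..r}. C.tn (\<zero>\<^bsub>K\<^esub>, g i) (\<mu> (h i) (x, y)))"
proof -
  let ?F = "\<lambda>x y. C.tn \<one>\<^bsub>C\<^esub> (br x y) \<oplus>\<^bsub>C.T\<^esub> (\<Oplus>\<^bsub>C.T\<^esub>i\<in>{1..r}. C.tn (\<zero>\<^bsub>K\<^esub>, g i) (\<mu> (h i) (x, y)))"
  have mu_homs: "(\<lambda>x. \<mu> (h i) (x, z)) \<in> module_hom K L L" "(\<lambda>y. \<mu> (h i) (z, y)) \<in> module_hom K L L"
    if "i \<in> {1..r}" "z \<in> carrier L" for i z
    using mu_cocycle[OF h_closed[OF that(1)]] that(2) unfolding cocycle_iff bilinear_map_def by auto
  have F: "bilinear_map K L L C.T ?F"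
    unfolding bilinear_map_def
  proof (intro conjI ballI)
    fix z assume z: "z \<in> carrier L"
    show "?F z \<in> module_hom K L C.T"
      by (intro module_hom_plus module_hom_sum C.tensor_module module_hom_comp[OF br_hom(1)[OF z] C.tens_hom(1)]
            module_hom_comp[OF mu_homs(2)[OF _ z] C.tens_hom(1)]) auto
    show "(\<lambda>x. ?F x z) \<in> module_hom K L C.T"
      by (intro module_hom_plus module_hom_sum C.tensor_module module_hom_comp[OF br_hom(2)[OF z] C.tens_hom(1)]
            module_hom_comp[OF mu_homs(1)[OF _ z] C.tens_hom(1)]) auto
  qed
  have one: "\<one>\<^bsub>C\<^esub> \<in> carrier C" by (rule C.Alg.one_closed)
  have "eta1 K L br \<alpha> \<mu> r h g (C.tn \<one>\<^bsub>C\<^esub> x) (C.tn \<one>\<^bsub>C\<^esub> y) = (\<one>\<^bsub>C\<^esub> \<otimes>\<^bsub>C\<^esub> \<one>\<^bsub>C\<^esub>) \<odot>\<^bsub>C.TM\<^esub> ?F x y"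
    unfolding eta1_def Let_def by (rule C.bilinear_ext_tens[OF F one x one y])
  also have "\<dots> = ?F x y"
    using bilinear_mapD(1)[OF F x y] C.scal_one C.Alg.l_one[OF one] by (simp only:)
  finally show ?thesis .
qed

end

locale pushout_setting = infinitesimal_deformation_setting K A L \<epsilon> B \<xi> br \<alpha> +
  universal_setting K L br \<alpha> \<mu> r h g
  for K :: "('k, 'm) ring_scheme" and A :: "('k, 'a, 'n) module_scheme"
    and L :: "('k, 'l, 'p) module_scheme" and \<epsilon> B \<xi> br \<alpha> \<mu> r h g
begin

abbreviation \<eta> where "\<eta> \<equiv> eta1 K L br \<alpha> \<mu> r h g"

definition ideal_map where
  "ideal_map a \<longleftrightarrow> a \<in> module_hom K D A \<and> a ` carrier D \<subseteq> aug_ideal K A \<epsilon>"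

definition id_plus where
  "id_plus a = (\<lambda>(k, f)\<in>carrier C. k \<odot>\<^bsub>A\<^esub> \<one>\<^bsub>A\<^esub> \<oplus>\<^bsub>A\<^esub> a f)"

lemma ideal_mapD:
  assumes "ideal_map a" "f \<in> carrier D"
  shows "a f \<in> carrier A" "\<epsilon> (a f) = \<zero>\<^bsub>K\<^esub>"
  using assms ideal_iff by (auto simp: ideal_map_def)

lemma id_plus_apply: "\<lbrakk>k \<in> carrier K; f \<in> carrier D\<rbrakk> \<Longrightarrow> id_plus a (k, f) = k \<odot>\<^bsub>A\<^esub> \<one>\<^bsub>A\<^esub> \<oplus>\<^bsub>A\<^esub> a f"
  by (simp add: id_plus_def)

lemma id_plus_zero: "\<lbrakk>ideal_map a; f \<in> carrier D\<rbrakk> \<Longrightarrow> id_plus a (\<zero>\<^bsub>K\<^esub>, f) = a f"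
  using ideal_mapD(1) by (simp add: id_plus_apply)

text \<open>
  The product of two values of \<open>a\<close> is zero, as is the product of two elements of the dual in \<open>C\<close>; so \<open>id + a\<close>
  is multiplicative.
\<close>

lemma id_plus_alg_hom:
  assumes a: "ideal_map a"
  shows "id_plus a \<in> alg_hom K C A"
proof -
  have a_hom: "a \<in> module_hom K D A" using a by (simp add: ideal_map_def)
  note as = ideal_mapD(1)[OF a] module_hom_add[OF a_hom] module_hom_smult[OF a_hom]
  have a0: "a \<zero>\<^bsub>D\<^esub> = \<zero>\<^bsub>A\<^esub>" by (rule module_hom_zero[OF a_hom D.module_axioms A.module_axioms])
  have aa: "a f \<otimes>\<^bsub>A\<^esub> a f' = \<zero>\<^bsub>A\<^esub>" if "f \<in> carrier D" "f' \<in> carrier D" for f f'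
    using inf a that by (auto simp: infinitesimal_base_def ideal_map_def)
  have add: "id_plus a (c \<oplus>\<^bsub>C\<^esub> d) = id_plus a c \<oplus>\<^bsub>A\<^esub> id_plus a d" if "c \<in> carrier C" "d \<in> carrier C" for c d
    using that by (auto simp: id_plus_apply as A.smult_l_distr A.M.a_ac)
  have smult: "id_plus a (k \<odot>\<^bsub>C\<^esub> c) = k \<odot>\<^bsub>A\<^esub> id_plus a c" if "k \<in> carrier K" "c \<in> carrier C" for k c
    using that by (auto simp: id_plus_apply as A.smult_r_distr A.smult_assoc1)
  have cl: "id_plus a c \<in> carrier A" if "c \<in> carrier C" for c
    using that by (auto simp: id_plus_apply as)
  have sc: "(k \<odot>\<^bsub>A\<^esub> \<one>\<^bsub>A\<^esub>) \<otimes>\<^bsub>A\<^esub> v = k \<odot>\<^bsub>A\<^esub> v" "v \<otimes>\<^bsub>A\<^esub> (k \<odot>\<^bsub>A\<^esub> \<one>\<^bsub>A\<^esub>) = k \<odot>\<^bsub>A\<^esub> v"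
    if "k \<in> carrier K" "v \<in> carrier A" for k v
    using that Alg.smult_assoc2[of k "\<one>\<^bsub>A\<^esub>" v] mult_smult_right[of k v "\<one>\<^bsub>A\<^esub>"] by simp_all
  have mult: "id_plus a (c \<otimes>\<^bsub>C\<^esub> d) = id_plus a c \<otimes>\<^bsub>A\<^esub> id_plus a d"
    if cd: "c \<in> carrier C" "d \<in> carrier C" for c d
  proof -
    obtain k f k' f' where eq: "c = (k, f)" "d = (k', f')" by (cases c, cases d)
    with cd have m: "k \<in> carrier K" "f \<in> carrier D" "k' \<in> carrier K" "f' \<in> carrier D" by auto
    have "id_plus a c \<otimes>\<^bsub>A\<^esub> id_plus a d =
        k \<odot>\<^bsub>A\<^esub> (k' \<odot>\<^bsub>A\<^esub> \<one>\<^bsub>A\<^esub> \<oplus>\<^bsub>A\<^esub> a f') \<oplus>\<^bsub>A\<^esub> a f \<otimes>\<^bsub>A\<^esub> (k' \<odot>\<^bsub>A\<^esub> \<one>\<^bsub>A\<^esub> \<oplus>\<^bsub>A\<^esub> a f')"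
      using m by (simp add: eq id_plus_apply as Alg.l_distr sc(1))
    also have "\<dots> = k \<odot>\<^bsub>A\<^esub> (k' \<odot>\<^bsub>A\<^esub> \<one>\<^bsub>A\<^esub>) \<oplus>\<^bsub>A\<^esub> k \<odot>\<^bsub>A\<^esub> a f' \<oplus>\<^bsub>A\<^esub> k' \<odot>\<^bsub>A\<^esub> a f"
      using m by (simp add: as A.smult_r_distr Alg.r_distr sc(2) aa)
    also have "\<dots> = id_plus a (c \<otimes>\<^bsub>C\<^esub> d)"
      using m by (simp add: eq id_plus_apply as A.smult_assoc1 A.M.a_ac)
    finally show ?thesis by simp
  qed
  have "id_plus a \<one>\<^bsub>C\<^esub> = \<one>\<^bsub>A\<^esub>" by (simp add: id_plus_apply a0)
  then show ?thesis
    using cl add smult mult unfolding alg_hom_def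
    by (auto intro!: ring_hom_memI module_homI simp del: C_simps)
qed

text \<open>
  The push-out condition quantifies over all expansions of the value of \<open>\<eta>\<close>; applying \<open>\<phi> \<otimes> id\<close>
  to any of them gives the same element of \<open>A \<otimes> L\<close>, so the defining expansion of \<open>\<eta>\<close> suffices.
\<close>

lemma is_pushout_iff:
  assumes phi: "\<phi> \<in> alg_hom K C A" and lam': "deformation K L br \<alpha> A \<epsilon> lam'"
  shows "is_pushout K L br \<alpha> C fst \<eta> A \<epsilon> \<phi> lam' \<longleftrightarrow> (\<forall>x\<in>carrier L. \<forall>y\<in>carrier L.
    lam' (tn \<one>\<^bsub>A\<^esub> x) (tn \<one>\<^bsub>A\<^esub> y) = tn \<one>\<^bsub>A\<^esub> (br x y) \<oplus>\<^bsub>T\<^esub>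
      (\<Oplus>\<^bsub>T\<^esub>i\<in>{1..r}. tn (\<phi> (\<zero>\<^bsub>K\<^esub>, g i)) (\<mu> (h i) (x, y))))" (is "?po \<longleftrightarrow> ?eq")
proof
  have p_hom: "\<phi> \<in> module_hom K C A" and p1: "\<phi> \<one>\<^bsub>C\<^esub> = \<one>\<^bsub>A\<^esub>"
    using phi by (auto simp: alg_hom_def ring_hom_def)
  have pA: "\<phi> c \<in> carrier A" if "c \<in> carrier C" for c by (rule module_hom_carrier[OF p_hom that])
  have mu_L: "\<mu> (h i) (x, y) \<in> carrier L" if "i \<in> {1..r}" "x \<in> carrier L" "y \<in> carrier L" for i x y
    using cocycle_simps(1)[OF mu_cocycle[OF h_closed[OF that(1)]] that(2,3)] .
  have gi: "(\<zero>\<^bsub>K\<^esub>, g i) \<in> carrier C" if "i \<in> {1..r}" for i using that by simp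
  {
    assume ?po
    note po = conjunct2[OF this[unfolded is_pushout_def], rule_format]
    \<comment> \<open>Expansions are indexed by \<open>{..<n}\<close>, the dual bases by \<open>{1..r}\<close>.\<close>
    have shift: "Suc ` {..<r} = {1..r}" by (simp add: image_Suc_lessThan)
    show ?eq
    proof (intro ballI)
      fix x y assume xy: "x \<in> carrier L" "y \<in> carrier L"
      let ?c = "\<lambda>j. (\<zero>\<^bsub>K\<^esub>, g (Suc j))" and ?z = "\<lambda>j. \<mu> (h (Suc j)) (x, y)"
      have c: "?c \<in> {..<r} \<rightarrow> aug_ideal K C fst" by (auto simp: aug_ideal_def a_kernel_def')
      have z: "?z \<in> {..<r} \<rightarrow> carrier L" using mu_L xy by auto
      have "(\<Oplus>\<^bsub>C.T\<^esub>j\<in>{..<r}. C.tn (?c j) (?z j)) = (\<Oplus>\<^bsub>C.T\<^esub>i\<in>{1..r}. C.tn (\<zero>\<^bsub>K\<^esub>, g i) (\<mu> (h i) (x, y)))"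
        unfolding shift[symmetric]
        by (rule C.T.M.finsum_reindex[symmetric]) (use mu_L xy gi in \<open>auto simp: shift simp del: C_simps\<close>)
      then have "\<eta> (C.tn \<one>\<^bsub>C\<^esub> x) (C.tn \<one>\<^bsub>C\<^esub> y) = C.tn \<one>\<^bsub>C\<^esub> (br x y) \<oplus>\<^bsub>C.T\<^esub> (\<Oplus>\<^bsub>C.T\<^esub>j\<in>{..<r}. C.tn (?c j) (?z j))"
        using eta1_one[OF xy] by simp
      from po[OF xy c z this]
      have "lam' (tn \<one>\<^bsub>A\<^esub> x) (tn \<one>\<^bsub>A\<^esub> y) = tn \<one>\<^bsub>A\<^esub> (br x y) \<oplus>\<^bsub>T\<^esub> (\<Oplus>\<^bsub>T\<^esub>j\<in>{..<r}. tn (\<phi> (?c j)) (?z j))" .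
      also have "(\<Oplus>\<^bsub>T\<^esub>j\<in>{..<r}. tn (\<phi> (?c j)) (?z j)) = (\<Oplus>\<^bsub>T\<^esub>i\<in>{1..r}. tn (\<phi> (\<zero>\<^bsub>K\<^esub>, g i)) (\<mu> (h i) (x, y)))"
        unfolding shift[symmetric]
        by (rule T.M.finsum_reindex[symmetric]) (use mu_L xy gi pA in \<open>auto simp: shift simp del: C_simps\<close>)
      finally show "lam' (tn \<one>\<^bsub>A\<^esub> x) (tn \<one>\<^bsub>A\<^esub> y) = tn \<one>\<^bsub>A\<^esub> (br x y) \<oplus>\<^bsub>T\<^esub>
        (\<Oplus>\<^bsub>T\<^esub>i\<in>{1..r}. tn (\<phi> (\<zero>\<^bsub>K\<^esub>, g i)) (\<mu> (h i) (x, y)))" .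
    qed
  }
  assume eq: ?eq
  let ?p = "tensor_lift K C L T (\<lambda>c l. tn (\<phi> c) l)"
  have bil: "bilinear_map K C L T (\<lambda>c l. tn (\<phi> c) l)"
    by (rule bilinear_mapI)
       (auto simp: pA module_hom_add[OF p_hom] module_hom_smult[OF p_hom] tens_add_left tens_add_right
          tens_smult_left tens_smult_right simp del: C_simps)
  note P = C.tensor_lift_hom[OF tensor_module bil] C.tensor_lift_tens[OF tensor_module bil]
  have P_expand: "?p (C.tn \<one>\<^bsub>C\<^esub> u \<oplus>\<^bsub>C.T\<^esub> (\<Oplus>\<^bsub>C.T\<^esub>i\<in>I. C.tn (c i) (z i))) =
      tn \<one>\<^bsub>A\<^esub> u \<oplus>\<^bsub>T\<^esub> (\<Oplus>\<^bsub>T\<^esub>i\<in>I. tn (\<phi> (c i)) (z i))"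
    if u: "u \<in> carrier L" and cz: "\<And>i. i \<in> I \<Longrightarrow> c i \<in> carrier C" "\<And>i. i \<in> I \<Longrightarrow> z i \<in> carrier L" for u I c and z :: "nat \<Rightarrow> 'l"
  proof -
    have "(\<Oplus>\<^bsub>C.T\<^esub>i\<in>I. C.tn (c i) (z i)) \<in> carrier C.T"
      using cz by (intro C.T.M.finsum_closed) auto
    then have "?p (C.tn \<one>\<^bsub>C\<^esub> u \<oplus>\<^bsub>C.T\<^esub> (\<Oplus>\<^bsub>C.T\<^esub>i\<in>I. C.tn (c i) (z i))) =
        ?p (C.tn \<one>\<^bsub>C\<^esub> u) \<oplus>\<^bsub>T\<^esub> ?p (\<Oplus>\<^bsub>C.T\<^esub>i\<in>I. C.tn (c i) (z i))"
      using u by (intro module_hom_add[OF P(1)] C.tens_closed C.Alg.one_closed)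
    also have "?p (C.tn \<one>\<^bsub>C\<^esub> u) = tn \<one>\<^bsub>A\<^esub> u"
      using P(2)[OF C.Alg.one_closed u] p1 by simp
    also have "?p (\<Oplus>\<^bsub>C.T\<^esub>i\<in>I. C.tn (c i) (z i)) = (\<Oplus>\<^bsub>T\<^esub>i\<in>I. ?p (C.tn (c i) (z i)))"
      using cz by (intro module_hom_finsum[OF P(1) C.tensor_module tensor_module] C.tens_closed)
    also have "\<dots> = (\<Oplus>\<^bsub>T\<^esub>i\<in>I. tn (\<phi> (c i)) (z i))"
      using cz pA P(2) by (intro T.M.finsum_cong') auto
    finally show ?thesis .
  qed
  show ?po
    unfolding is_pushout_def
  proof (intro conjI lam' ballI allI impI)
    fix x y n c z
    assume xy: "x \<in> carrier L" "y \<in> carrier L"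
      and c: "c \<in> {..<n::nat} \<rightarrow> aug_ideal K C fst" and z: "z \<in> {..<n} \<rightarrow> carrier L"
      and e: "\<eta> (C.tn \<one>\<^bsub>C\<^esub> x) (C.tn \<one>\<^bsub>C\<^esub> y) = C.tn \<one>\<^bsub>C\<^esub> (br x y) \<oplus>\<^bsub>C.T\<^esub> (\<Oplus>\<^bsub>C.T\<^esub>j\<in>{..<n}. C.tn (c j) (z j))"
    have cC: "c j \<in> carrier C" if "j \<in> {..<n}" for j
      using c that by (auto simp: aug_ideal_def a_kernel_def' simp del: C_simps)
    have "tn \<one>\<^bsub>A\<^esub> (br x y) \<oplus>\<^bsub>T\<^esub> (\<Oplus>\<^bsub>T\<^esub>j\<in>{..<n}. tn (\<phi> (c j)) (z j)) = ?p (\<eta> (C.tn \<one>\<^bsub>C\<^esub> x) (C.tn \<one>\<^bsub>C\<^esub> y))"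
      unfolding e by (rule P_expand[symmetric]) (use xy cC z in auto)
    also have "\<dots> = tn \<one>\<^bsub>A\<^esub> (br x y) \<oplus>\<^bsub>T\<^esub> (\<Oplus>\<^bsub>T\<^esub>i\<in>{1..r}. tn (\<phi> (\<zero>\<^bsub>K\<^esub>, g i)) (\<mu> (h i) (x, y)))"
      unfolding eta1_one[OF xy] by (rule P_expand) (use xy mu_L in auto)
    also have "\<dots> = lam' (tn \<one>\<^bsub>A\<^esub> x) (tn \<one>\<^bsub>A\<^esub> y)" using eq xy by simp
    finally show "lam' (tn \<one>\<^bsub>A\<^esub> x) (tn \<one>\<^bsub>A\<^esub> y) = tn \<one>\<^bsub>A\<^esub> (br x y) \<oplus>\<^bsub>T\<^esub> (\<Oplus>\<^bsub>T\<^esub>j\<in>{..<n}. tn (\<phi> (c j)) (z j))" by simp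
  qed
qed

definition pushout_class where
  "pushout_class a b = (\<Oplus>\<^bsub>H2\<^esub>i\<in>{1..r}. \<xi> b (a (g i)) \<odot>\<^bsub>H2\<^esub> h i)"

lemma pushout_class_closed: "\<lbrakk>ideal_map a; b \<in> B\<rbrakk> \<Longrightarrow> pushout_class a b \<in> carrier H2"
  unfolding pushout_class_def using ideal_mapD(1) by (intro H2.M.finsum_closed) auto

text \<open>
  In the coordinate of \<open>b\<close> the value of the push-out at \<open>1 \<otimes> x\<close> and \<open>1 \<otimes> y\<close> is the sum of the
  \<open>\<xi> b (a (g i)) \<mu>(h i)(x, y)\<close>, and \<open>\<mu>\<close> is linear.
\<close>

lemma is_pushout_id_plus_iff:
  assumes a: "ideal_map a" and lam': "deformation K L br \<alpha> A \<epsilon> lam'"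
  shows "is_pushout K L br \<alpha> C fst \<eta> A \<epsilon> (id_plus a) lam' \<longleftrightarrow> (\<forall>b\<in>B. \<psi> lam' b = \<mu> (pushout_class a b))"
proof -
  have mu_L: "\<mu> (h i) (x, y) \<in> carrier L" if "i \<in> {1..r}" "x \<in> carrier L" "y \<in> carrier L" for i x y
    using cocycle_simps(1)[OF mu_cocycle[OF h_closed[OF that(1)]] that(2,3)] .
  note ag = ideal_mapD[OF a g_closed]
  have "lam' (tn \<one>\<^bsub>A\<^esub> x) (tn \<one>\<^bsub>A\<^esub> y) = tn \<one>\<^bsub>A\<^esub> (br x y) \<oplus>\<^bsub>T\<^esub>
      (\<Oplus>\<^bsub>T\<^esub>i\<in>{1..r}. tn (id_plus a (\<zero>\<^bsub>K\<^esub>, g i)) (\<mu> (h i) (x, y)))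
    \<longleftrightarrow> (\<forall>b\<in>B. \<psi> lam' b (x, y) = \<mu> (pushout_class a b) (x, y))" (is "?l = ?r \<longleftrightarrow> _")
    if xy: "x \<in> carrier L" "y \<in> carrier L" for x y
  proof -
    let ?t = "\<lambda>i. tn (id_plus a (\<zero>\<^bsub>K\<^esub>, g i)) (\<mu> (h i) (x, y))"
    have t: "?t i \<in> carrier T" if "i \<in> {1..r}" for i
      using that a ag mu_L xy by (simp add: id_plus_zero)
    have sum: "(\<Oplus>\<^bsub>T\<^esub>i\<in>{1..r}. ?t i) \<in> carrier T" using t by (intro T.M.finsum_closed) auto
    have "E (\<Oplus>\<^bsub>T\<^esub>i\<in>{1..r}. ?t i) = (\<Oplus>\<^bsub>L\<^esub>i\<in>{1..r}. E (?t i))"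
      using t by (intro module_hom_finsum[OF E_hom tensor_module L.module_axioms])
    also have "\<dots> = (\<Oplus>\<^bsub>L\<^esub>i\<in>{1..r}. \<zero>\<^bsub>L\<^esub>)"
      using a ag mu_L xy by (intro L.M.finsum_cong') (auto simp: id_plus_zero)
    finally have E0: "E (\<Oplus>\<^bsub>T\<^esub>i\<in>{1..r}. ?t i) = \<zero>\<^bsub>L\<^esub>" by simp
    have Xt: "Xi b (\<Oplus>\<^bsub>T\<^esub>i\<in>{1..r}. ?t i) = \<mu> (pushout_class a b) (x, y)" if b: "b \<in> B" for b
    proof -
      have "Xi b (\<Oplus>\<^bsub>T\<^esub>i\<in>{1..r}. ?t i) = (\<Oplus>\<^bsub>L\<^esub>i\<in>{1..r}. Xi b (?t i))"
        using t b by (intro module_hom_finsum[OF Xi_hom tensor_module L.module_axioms])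
      also have "\<dots> = (\<Oplus>\<^bsub>L\<^esub>i\<in>{1..r}. \<mu> (\<xi> b (a (g i)) \<odot>\<^bsub>H2\<^esub> h i) (x, y))"
        using a ag mu_L xy b
        by (intro L.M.finsum_cong') (auto simp: id_plus_zero module_hom_smult[OF mu_eval_hom[OF xy]])
      also have "\<dots> = \<mu> (pushout_class a b) (x, y)"
        unfolding pushout_class_def using ag b
        by (intro module_hom_finsum[OF mu_eval_hom[OF xy] H2.module_axioms L.module_axioms, symmetric]) auto
      finally show ?thesis .
    qed
    have l: "?l \<in> carrier T" using lam_simps(1)[OF lam'] xy by simp
    have r: "?r \<in> carrier T" using sum xy by simp
    have "?l = ?r \<longleftrightarrow> E ?l = E ?r \<and> (\<forall>b\<in>B. Xi b ?l = Xi b ?r)"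
      using coords_eqI[OF l r] by auto
    also have "E ?l = E ?r"
      using lam_E[OF lam', of "tn \<one>\<^bsub>A\<^esub> x" "tn \<one>\<^bsub>A\<^esub> y"] xy sum E0 by simp
    finally have "?l = ?r \<longleftrightarrow> (\<forall>b\<in>B. Xi b ?l = Xi b ?r)" by simp
    moreover have "Xi b ?r = \<mu> (pushout_class a b) (x, y)" if b: "b \<in> B" for b
      using Xt[OF b] Xi_simps sum xy b cocycle_simps(1)[OF mu_cocycle[OF pushout_class_closed[OF a b]] xy]
      by simp
    moreover have "Xi b ?l = \<psi> lam' b (x, y)" for b using xy by (simp add: \<psi>_def)
    ultimately show ?thesis by simp
  qed
  then have "is_pushout K L br \<alpha> C fst \<eta> A \<epsilon> (id_plus a) lam' \<longleftrightarrow>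
      (\<forall>x\<in>carrier L. \<forall>y\<in>carrier L. \<forall>b\<in>B. \<psi> lam' b (x, y) = \<mu> (pushout_class a b) (x, y))"
    by (subst is_pushout_iff[OF id_plus_alg_hom[OF a] lam']) simp
  also have "\<dots> \<longleftrightarrow> (\<forall>b\<in>B. \<psi> lam' b = \<mu> (pushout_class a b))"
  proof (intro iffI ballI)
    fix b assume b: "b \<in> B"
      and all: "\<forall>x\<in>carrier L. \<forall>y\<in>carrier L. \<forall>b\<in>B. \<psi> lam' b (x, y) = \<mu> (pushout_class a b) (x, y)"
    show "\<psi> lam' b = \<mu> (pushout_class a b)"
    proof (rule extensionalityI[of _ "carrier L \<times> carrier L"])
      show "\<mu> (pushout_class a b) \<in> extensional (carrier L \<times> carrier L)"
        using mu_cocycle[OF pushout_class_closed[OF a b]] by (simp add: cocycle_iff)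
    qed (use all b in \<open>auto simp: \<psi>_def\<close>)
  qed auto
  finally show ?thesis .
qed

lemma equivalent_iff_cls:
  assumes "deformation K L br \<alpha> A \<epsilon> lam1" "deformation K L br \<alpha> A \<epsilon> lam2"
  shows "equivalent_deformations K L \<alpha> A \<epsilon> lam1 lam2 \<longleftrightarrow> (\<forall>b\<in>B. cls (\<psi> lam1 b) = cls (\<psi> lam2 b))"
  unfolding equivalent_deformations_iff[OF assms]
  by (simp add: cls_eq_iff deformation_cocycle assms)

text \<open>
  By the classification of deformations, the left-hand side says that the class of \<open>\<psi> lam b\<close> equals
  \<open>pushout_class a b\<close> for every \<open>b\<close>. Pairing with the dual basis turns this into
  \<open>\<xi> b (a (g i)) = g i (cls (\<psi> lam b))\<close>, and these are the coordinates of \<open>a (g i)\<close> with respect to \<open>B\<close>.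
\<close>

lemma pushout_equivalent_iff:
  assumes lam: "deformation K L br \<alpha> A \<epsilon> lam" and a: "ideal_map a"
  shows "(\<exists>lam'. is_pushout K L br \<alpha> C fst \<eta> A \<epsilon> (id_plus a) lam' \<and> equivalent_deformations K L \<alpha> A \<epsilon> lam lam')
    \<longleftrightarrow> (\<forall>i\<in>{1..r}. a (g i) = (\<Oplus>\<^bsub>A\<^esub>b\<in>B. g i (cls (\<psi> lam b)) \<odot>\<^bsub>A\<^esub> b))"
proof -
  define c where "c b = cls (\<psi> lam b)" for b
  have c: "c b \<in> carrier H2" if "b \<in> B" for b
    unfolding c_def using that deformation_cocycle[OF lam] by (intro cls_closed)
  note ag = ideal_mapD[OF a g_closed]
  have "(\<exists>lam'. is_pushout K L br \<alpha> C fst \<eta> A \<epsilon> (id_plus a) lam' \<and> equivalent_deformations K L \<alpha> A \<epsilon> lam lam')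
    \<longleftrightarrow> (\<forall>b\<in>B. c b = pushout_class a b)" (is "?ex \<longleftrightarrow> _")
  proof
    assume ?ex
    then obtain lam' where po: "is_pushout K L br \<alpha> C fst \<eta> A \<epsilon> (id_plus a) lam'"
      and eqv: "equivalent_deformations K L \<alpha> A \<epsilon> lam lam'" by blast
    have lam': "deformation K L br \<alpha> A \<epsilon> lam'" using po by (simp add: is_pushout_def)
    show "\<forall>b\<in>B. c b = pushout_class a b"
      using eqv po cls_mu[OF pushout_class_closed[OF a]]
      by (simp add: equivalent_iff_cls[OF lam lam'] is_pushout_id_plus_iff[OF a lam'] c_def)
  next
    assume eq: "\<forall>b\<in>B. c b = pushout_class a b"
    obtain lam' where lam': "deformation K L br \<alpha> A \<epsilon> lam'"
      and psi: "\<And>b. b \<in> B \<Longrightarrow> \<psi> lam' b = \<mu> (pushout_class a b)"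
      using deformation_of_cocycles[of "\<lambda>b. \<mu> (pushout_class a b)"] mu_cocycle pushout_class_closed[OF a]
      by blast
    have "is_pushout K L br \<alpha> C fst \<eta> A \<epsilon> (id_plus a) lam'"
      using psi by (simp add: is_pushout_id_plus_iff[OF a lam'])
    moreover have "equivalent_deformations K L \<alpha> A \<epsilon> lam lam'"
      using psi eq cls_mu[OF pushout_class_closed[OF a]] by (simp add: equivalent_iff_cls[OF lam lam'] c_def)
    ultimately show ?ex by blast
  qed
  also have "\<dots> \<longleftrightarrow> (\<forall>b\<in>B. \<forall>i\<in>{1..r}. \<xi> b (a (g i)) = g i (c b))"
  proof (intro ball_cong refl)
    fix b assume b: "b \<in> B"
    have x: "\<xi> b (a (g i)) \<in> carrier K" if "i \<in> {1..r}" for i using ag(1)[OF that] b by simp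
    show "c b = pushout_class a b \<longleftrightarrow> (\<forall>i\<in>{1..r}. \<xi> b (a (g i)) = g i (c b))"
    proof
      assume e: "c b = pushout_class a b"
      show "\<forall>i\<in>{1..r}. \<xi> b (a (g i)) = g i (c b)"
      proof
        fix j assume j: "j \<in> {1..r}"
        note gj = dual_space_hom[OF g_closed[OF j]]
        have "g j (c b) = (\<Oplus>\<^bsub>scalars K\<^esub>i\<in>{1..r}. g j (\<xi> b (a (g i)) \<odot>\<^bsub>H2\<^esub> h i))"
          unfolding e pushout_class_def using x
          by (intro module_hom_finsum[OF gj H2.module_axioms scalars_module[OF A.R.is_cring]]) auto
        also have "\<dots> = (\<Oplus>\<^bsub>K\<^esub>i\<in>{1..r}. if j = i then \<xi> b (a (g i)) else \<zero>\<^bsub>K\<^esub>)"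
          unfolding finsum_scalars using x j db
          by (intro A.R.finsum_cong') (auto simp: module_hom_smult[OF gj] dual_bases_def)
        also have "\<dots> = \<xi> b (a (g j))" using x j by (subst A.R.add.finprod_singleton) auto
        finally show "\<xi> b (a (g j)) = g j (c b)" by simp
      qed
    next
      assume e: "\<forall>i\<in>{1..r}. \<xi> b (a (g i)) = g i (c b)"
      have "pushout_class a b = (\<Oplus>\<^bsub>H2\<^esub>i\<in>{1..r}. g i (c b) \<odot>\<^bsub>H2\<^esub> h i)"
        unfolding pushout_class_def using e c[OF b] by (intro H2.M.finsum_cong') auto
      then show "c b = pushout_class a b" using H2.dual_bases_expand[OF db c[OF b]] by simp
    qed
  qed
  also have "\<dots> \<longleftrightarrow> (\<forall>i\<in>{1..r}. \<forall>b\<in>B. \<xi> b (a (g i)) = g i (c b))" by blast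
  also have "\<dots> \<longleftrightarrow> (\<forall>i\<in>{1..r}. a (g i) = (\<Oplus>\<^bsub>A\<^esub>b\<in>B. g i (c b) \<odot>\<^bsub>A\<^esub> b))"
  proof (intro ball_cong refl)
    fix i assume i: "i \<in> {1..r}"
    have gc: "g i (c b) \<in> carrier K" if "b \<in> B" for b using g_closed[OF i] c[OF that] by simp
    show "(\<forall>b\<in>B. \<xi> b (a (g i)) = g i (c b)) \<longleftrightarrow> a (g i) = (\<Oplus>\<^bsub>A\<^esub>b\<in>B. g i (c b) \<odot>\<^bsub>A\<^esub> b)"
    proof
      assume e: "\<forall>b\<in>B. \<xi> b (a (g i)) = g i (c b)"
      have "(\<Oplus>\<^bsub>A\<^esub>b\<in>B. \<xi> b (a (g i)) \<odot>\<^bsub>A\<^esub> b) = (\<Oplus>\<^bsub>A\<^esub>b\<in>B. g i (c b) \<odot>\<^bsub>A\<^esub> b)"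
        using e gc by (intro A.M.finsum_cong') auto
      moreover have "(\<Oplus>\<^bsub>A\<^esub>b\<in>B. g i (c b) \<odot>\<^bsub>A\<^esub> b) \<in> carrier A" using gc by (intro A.M.finsum_closed) auto
      ultimately show "a (g i) = (\<Oplus>\<^bsub>A\<^esub>b\<in>B. g i (c b) \<odot>\<^bsub>A\<^esub> b)"
        using decomp[OF ag(1)[OF i]] ag(2)[OF i] by simp
    next
      assume e: "a (g i) = (\<Oplus>\<^bsub>A\<^esub>b\<in>B. g i (c b) \<odot>\<^bsub>A\<^esub> b)"
      show "\<forall>b\<in>B. \<xi> b (a (g i)) = g i (c b)"
      proof
        fix b assume b: "b \<in> B"
        have "\<xi> b (a (g i)) = (\<Oplus>\<^bsub>scalars K\<^esub>d\<in>B. \<xi> b (g i (c d) \<odot>\<^bsub>A\<^esub> d))"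
          unfolding e using gc b
          by (intro module_hom_finsum[OF xi_hom A.module_axioms scalars_module[OF A.R.is_cring]]) auto
        also have "\<dots> = (\<Oplus>\<^bsub>K\<^esub>d\<in>B. if d = b then g i (c d) else \<zero>\<^bsub>K\<^esub>)"
          unfolding finsum_scalars using gc b
          by (intro A.R.finsum_cong') (auto simp: module_hom_smult[OF xi_hom] xi_B)
        also have "\<dots> = g i (c b)" using gc b by (subst A.R.add.finprod_singleton_swap) auto
        finally show "\<xi> b (a (g i)) = g i (c b)" .
      qed
    qed
  qed
  finally show ?thesis by (simp add: c_def)
qed

text \<open>
  For the classes \<open>c b = cls (\<psi> lam b)\<close> this map has the values at \<open>g i\<close> prescribed in \<open>pushout_equivalent_iff\<close>.
\<close>

lemma ideal_map_of_classes:
  assumes c: "\<And>b. b \<in> B \<Longrightarrow> c b \<in> carrier H2"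
  shows "ideal_map (\<lambda>f. \<Oplus>\<^bsub>A\<^esub>b\<in>B. f (c b) \<odot>\<^bsub>A\<^esub> b)"
proof -
  have "(\<lambda>f. f (c b) \<odot>\<^bsub>A\<^esub> b) \<in> module_hom K D A" if b: "b \<in> B" for b
    using c[OF b] b by (intro module_homI) (simp_all add: A.smult_l_distr A.smult_assoc1)
  then have "(\<lambda>f. \<Oplus>\<^bsub>A\<^esub>b\<in>B. f (c b) \<odot>\<^bsub>A\<^esub> b) \<in> module_hom K D A"
    by (intro module_hom_sum A.module_axioms)
  moreover have "(\<Oplus>\<^bsub>A\<^esub>b\<in>B. f (c b) \<odot>\<^bsub>A\<^esub> b) \<in> aug_ideal K A \<epsilon>" if f: "f \<in> carrier D" for f
  proof -
    have fc: "f (c b) \<in> carrier K" if "b \<in> B" for b using f c[OF that] by simp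
    have "\<epsilon> (\<Oplus>\<^bsub>A\<^esub>b\<in>B. f (c b) \<odot>\<^bsub>A\<^esub> b) = (\<Oplus>\<^bsub>scalars K\<^esub>b\<in>B. \<epsilon> (f (c b) \<odot>\<^bsub>A\<^esub> b))"
      using fc by (intro module_hom_finsum[OF eps_hom A.module_axioms scalars_module[OF A.R.is_cring]]) auto
    also have "\<dots> = (\<Oplus>\<^bsub>K\<^esub>b\<in>B. \<zero>\<^bsub>K\<^esub>)"
      unfolding finsum_scalars using fc
      by (intro A.R.finsum_cong') (auto simp: module_hom_smult[OF eps_hom])
    finally show ?thesis using fc by (auto simp: ideal_iff intro!: A.M.finsum_closed)
  qed
  ultimately show ?thesis by (auto simp: ideal_map_def)
qed

text \<open>
  The \<open>g i\<close> span the dual space.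
\<close>

lemma ideal_map_eqI:
  assumes a: "ideal_map a" and a': "ideal_map a'"
    and eq: "\<And>i. i \<in> {1..r} \<Longrightarrow> a (g i) = a' (g i)" and f: "f \<in> carrier D"
  shows "a f = a' f"
proof -
  have fh: "f (h i) \<in> carrier K" if "i \<in> {1..r}" for i using f h_closed[OF that] by simp
  have "x f = (\<Oplus>\<^bsub>A\<^esub>i\<in>{1..r}. f (h i) \<odot>\<^bsub>A\<^esub> x (g i))" if x: "ideal_map x" for x
  proof -
    have hom: "x \<in> module_hom K D A" using x by (simp add: ideal_map_def)
    have "x f = x (\<Oplus>\<^bsub>D\<^esub>i\<in>{1..r}. f (h i) \<odot>\<^bsub>D\<^esub> g i)"
      by (rule arg_cong[OF H2.dual_bases_expand_functional[OF db f]])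
    also have "\<dots> = (\<Oplus>\<^bsub>A\<^esub>i\<in>{1..r}. x (f (h i) \<odot>\<^bsub>D\<^esub> g i))"
      using fh by (intro module_hom_finsum[OF hom D.module_axioms A.module_axioms]) auto
    also have "\<dots> = (\<Oplus>\<^bsub>A\<^esub>i\<in>{1..r}. f (h i) \<odot>\<^bsub>A\<^esub> x (g i))"
      using fh ideal_mapD(1)[OF x g_closed] by (intro A.M.finsum_cong') (auto simp: module_hom_smult[OF hom])
    finally show ?thesis .
  qed
  note expand = this
  show ?thesis
    unfolding expand[OF a] expand[OF a'] using fh eq ideal_mapD(1)[OF a' g_closed]
    by (intro A.M.finsum_cong') auto
qed

lemma unique_id_plus:
  assumes lam: "deformation K L br \<alpha> A \<epsilon> lam"
  shows "\<exists>!\<phi>. \<phi> \<in> extensional (carrier C) \<and> \<phi> \<in> alg_hom K C A \<and>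
     (\<exists>a \<in> module_hom K D A. a ` carrier D \<subseteq> aug_ideal K A \<epsilon> \<and>
        (\<forall>k\<in>carrier K. \<forall>f\<in>carrier D. \<phi> (k, f) = k \<odot>\<^bsub>A\<^esub> \<one>\<^bsub>A\<^esub> \<oplus>\<^bsub>A\<^esub> a f)) \<and>
     (\<exists>lam'. is_pushout K L br \<alpha> C fst \<eta> A \<epsilon> \<phi> lam' \<and> equivalent_deformations K L \<alpha> A \<epsilon> lam lam')"
    (is "\<exists>!\<phi>. ?P \<phi>")
proof -
  have P_iff: "?P \<phi> \<longleftrightarrow> (\<exists>a. ideal_map a \<and> \<phi> = id_plus a \<and>
      (\<forall>i\<in>{1..r}. a (g i) = (\<Oplus>\<^bsub>A\<^esub>b\<in>B. g i (cls (\<psi> lam b)) \<odot>\<^bsub>A\<^esub> b)))" for \<phi>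
  proof
    assume P: "?P \<phi>"
    then obtain a where a: "ideal_map a"
      and phi: "\<And>k f. \<lbrakk>k \<in> carrier K; f \<in> carrier D\<rbrakk> \<Longrightarrow> \<phi> (k, f) = k \<odot>\<^bsub>A\<^esub> \<one>\<^bsub>A\<^esub> \<oplus>\<^bsub>A\<^esub> a f"
      unfolding ideal_map_def by blast
    have "\<phi> = id_plus a"
    proof (rule extensionalityI[of _ "carrier C"])
      show "\<phi> \<in> extensional (carrier C)" using P by blast
    qed (auto simp: id_plus_def phi)
    with P a pushout_equivalent_iff[OF lam a]
    show "\<exists>a. ideal_map a \<and> \<phi> = id_plus a \<and>
      (\<forall>i\<in>{1..r}. a (g i) = (\<Oplus>\<^bsub>A\<^esub>b\<in>B. g i (cls (\<psi> lam b)) \<odot>\<^bsub>A\<^esub> b))" by blast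
  next
    assume "\<exists>a. ideal_map a \<and> \<phi> = id_plus a \<and>
      (\<forall>i\<in>{1..r}. a (g i) = (\<Oplus>\<^bsub>A\<^esub>b\<in>B. g i (cls (\<psi> lam b)) \<odot>\<^bsub>A\<^esub> b))"
    then obtain a where a: "ideal_map a" and phi: "\<phi> = id_plus a"
      and ag: "\<forall>i\<in>{1..r}. a (g i) = (\<Oplus>\<^bsub>A\<^esub>b\<in>B. g i (cls (\<psi> lam b)) \<odot>\<^bsub>A\<^esub> b)" by blast
    have "id_plus a \<in> extensional (carrier C)" by (simp add: id_plus_def)
    moreover have "\<exists>a' \<in> module_hom K D A. a' ` carrier D \<subseteq> aug_ideal K A \<epsilon> \<and>
        (\<forall>k\<in>carrier K. \<forall>f\<in>carrier D. id_plus a (k, f) = k \<odot>\<^bsub>A\<^esub> \<one>\<^bsub>A\<^esub> \<oplus>\<^bsub>A\<^esub> a' f)"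
      using a by (intro bexI[of _ a]) (auto simp: ideal_map_def id_plus_apply)
    ultimately show "?P \<phi>"
      unfolding phi using id_plus_alg_hom[OF a] pushout_equivalent_iff[OF lam a] ag by blast
  qed
  show ?thesis
    unfolding P_iff
  proof (rule ex_ex1I)
    have "ideal_map (\<lambda>f. \<Oplus>\<^bsub>A\<^esub>b\<in>B. f (cls (\<psi> lam b)) \<odot>\<^bsub>A\<^esub> b)"
      using deformation_cocycle[OF lam] by (intro ideal_map_of_classes cls_closed)
    then show "\<exists>\<phi> a. ideal_map a \<and> \<phi> = id_plus a \<and>
      (\<forall>i\<in>{1..r}. a (g i) = (\<Oplus>\<^bsub>A\<^esub>b\<in>B. g i (cls (\<psi> lam b)) \<odot>\<^bsub>A\<^esub> b))" by blast
  next
    fix \<phi> \<phi>'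
    assume "\<exists>a. ideal_map a \<and> \<phi> = id_plus a \<and>
      (\<forall>i\<in>{1..r}. a (g i) = (\<Oplus>\<^bsub>A\<^esub>b\<in>B. g i (cls (\<psi> lam b)) \<odot>\<^bsub>A\<^esub> b))"
      and "\<exists>a. ideal_map a \<and> \<phi>' = id_plus a \<and>
      (\<forall>i\<in>{1..r}. a (g i) = (\<Oplus>\<^bsub>A\<^esub>b\<in>B. g i (cls (\<psi> lam b)) \<odot>\<^bsub>A\<^esub> b))"
    then obtain a a' where a: "ideal_map a" "\<phi> = id_plus a" and a': "ideal_map a'" "\<phi>' = id_plus a'"
      and eq: "\<And>i. i \<in> {1..r} \<Longrightarrow> a (g i) = a' (g i)" by auto
    show "\<phi> = \<phi>'"
      unfolding a(2) a'(2) id_plus_def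
      by (rule restrict_ext) (use ideal_map_eqI[OF a(1) a'(1) eq] in auto)
  qed
qed

end

theorem proposition3p4:
  fixes K :: "('k, 'm) ring_scheme"
    and L :: "('k, 'l, 'p) module_scheme"
    and br :: "'l \<Rightarrow> 'l \<Rightarrow> 'l" and \<alpha> :: "'l \<Rightarrow> 'l"
    and \<mu> :: "('l \<times> 'l \<Rightarrow> 'l) set \<Rightarrow> 'l \<times> 'l \<Rightarrow> 'l"
    and r :: nat
    and h :: "nat \<Rightarrow> ('l \<times> 'l \<Rightarrow> 'l) set"
    and g :: "nat \<Rightarrow> ('l \<times> 'l \<Rightarrow> 'l) set \<Rightarrow> 'k"
    and A :: "('k, 'a, 'n) module_scheme" and \<epsilon> :: "'a \<Rightarrow> 'k"
    and lam :: "('a \<times> 'l \<Rightarrow> 'k) set \<Rightarrow> ('a \<times> 'l \<Rightarrow> 'k) set \<Rightarrow> ('a \<times> 'l \<Rightarrow> 'k) set"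
  assumes "algebraically_closed K" and "char_zero K"
    and "hom_leibniz_algebra K L br \<alpha>"
    and "vectorspace.fin_dim K (cohomology2 K L br \<alpha>)"
    and "representative_map K L br \<alpha> \<mu>"
    and "dual_bases K (cohomology2 K L br \<alpha>) r h g"
    and "deformation K L br \<alpha> A \<epsilon> lam"
    and "infinitesimal_base K A \<epsilon>"
    and "vectorspace.fin_dim K A"
  shows "\<exists>!\<phi>. \<phi> \<in> extensional (carrier (base1 K L br \<alpha>)) \<and>
           \<phi> \<in> alg_hom K (base1 K L br \<alpha>) A \<and>
           (\<exists>a \<in> module_hom K (dual_space K (cohomology2 K L br \<alpha>)) A.
              a ` carrier (dual_space K (cohomology2 K L br \<alpha>)) \<subseteq> aug_ideal K A \<epsilon> \<and>
              (\<forall>k\<in>carrier K. \<forall>f\<in>carrier (dual_space K (cohomology2 K L br \<alpha>)).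
                 \<phi> (k, f) = k \<odot>\<^bsub>A\<^esub> \<one>\<^bsub>A\<^esub> \<oplus>\<^bsub>A\<^esub> a f)) \<and>
           (\<exists>lam'. is_pushout K L br \<alpha> (base1 K L br \<alpha>) fst (eta1 K L br \<alpha> \<mu> r h g) A \<epsilon> \<phi> lam' \<and>
                   equivalent_deformations K L \<alpha> A \<epsilon> lam lam')"
proof -
  interpret HL: hom_leibniz_algebra K L br \<alpha> by (fact assms(3))
  have "augmented_algebra K A \<epsilon>" using assms(7) by (simp add: deformation_def)
  then obtain B \<xi> where "infinitesimal_tensor K A L \<epsilon> B \<xi>"
    using infinitesimal_tensor_exists[OF HL.field_axioms _ assms(8,9) HL.module_axioms] by blast
  then interpret pushout_setting K A L \<epsilon> B \<xi> br \<alpha> \<mu> r h g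
    using assms(3,5,6)
    by (intro pushout_setting.intro infinitesimal_deformation_setting.intro universal_setting.intro
          universal_setting_axioms.intro)
  show ?thesis by (rule unique_id_plus[OF assms(7)])
qed

end
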